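(* For every $i\ge 1$ the polynomial $\widehat C_i$ (defined in the context) lies in $\mathbb{Q}[X_0,\dots,X_{i-1}]$. Moreover, fix $0<q<1$ and put $C_i(q)=\widehat C_i(A_0(q),A_1(q),\dots,A_{i-1}(q))$. Then for every integer $n\ge 1$, as $k\to\infty$, \[x_k=-kq^{1-k}\Big(1+\sum_{i=1}^{n}C_i(q)k^{-1-i}+o(k^{-1-n})\Big).\]
   Context: Fix $0<q<1$ and let $f(x)=\sum_{n\ge 0}\frac{1}{n!}q^{n(n-1)/2}x^n$ (the deformed exponential function). It is known that $f$ is entire and that its zeros are infinitely many, real, negative and simple; list them as a strictly decreasing sequence $x_1>x_2>x_3>\cdots$. For $m\ge1$ let $\sigma(m)$ be the sum of the positive divisors of $m$, and for $i\ge 0$ let $A_i(q)=\sum_{m\ge1}m^i\sigma(m)q^m$. Polynomials $S_i(n)$: let $a_0,a_1,a_2,\dots$ be indeterminates and $a(x)=\sum_{i\ge0}a_ix^i$ (formal power series). For a positive integer $j$ set $G(x)=\prod_{i=0}^{j-1}\frac{1+a(x)x^2}{1+ix}$, $H(x)=\prod_{i=1-j}^{-1}\frac{1+ix}{1+a(x)x^2}$ (so $G=1+a(x)x^2$, $H=1$ when $j=1$), $u=2j-1$, $v=j(j-1)$. For each $n\ge1$ there are unique polynomials $S_0(n),\dots,S_n(n)\in\mathbb{Q}[a_0,\dots,a_{n-2}]$ (rational constants if $n=1$), independent of $j$, such that for every positive integer $j$ the coefficient of $x^{n-1}$ in the power series $\frac{G(x)-H(x)}{x^2}(1+a(x)x^2)$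 equals $u\big(a_{n-1}+S_0(n)+S_1(n)v+\cdots+S_n(n)v^n\big)$. For elements $c_1,\dots,c_{n-1}$ of a commutative $\mathbb{Q}$-algebra write $S_i(n)(c_1,\dots,c_{n-1})$ for the result of substituting $a_k=c_{k+1}$ ($0\le k\le n-2$). Recursion: let $X_0,X_1,\dots$ be indeterminates and $D$ the $\mathbb{Q}$-linear derivation of $\mathbb{Q}[X_0,X_1,\dots]$ with $D(X_k)=X_{k+1}$. Put $P_1=X_0$, $P_{m+1}=D(P_m)-3X_0P_m$ ($m\ge1$), and define recursively for $m\ge1$ \[\widehat C_m=-S_0(m)(\widehat C_1,\dots,\widehat C_{m-1})+\sum_{i=1}^{m}3\cdot 2^{i}\,S_i(m)(\widehat C_1,\dots,\widehat C_{m-1})\,P_i .\] *)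

theory Defs
  imports Complex_Main "HOL-Library.Poly_Mapping" "HOL-Computational_Algebra.Formal_Power_Series"
    "HOL-Library.Landau_Symbols"
begin

definition defexp :: "real \<Rightarrow> real \<Rightarrow> real" where
  "defexp q x = suminf (\<lambda>n. q ^ (n * (n - 1) div 2) * x ^ n / fact n)"

definition defexp_zero :: "real \<Rightarrow> nat \<Rightarrow> real" where
  "defexp_zero q k = (THE x. defexp q x = 0 \<and> card {y. defexp q y = 0 \<and> x < y} = k - 1)"

definition sigma1 :: "nat \<Rightarrow> nat" where
  "sigma1 m = (\<Sum>d\<in>{d. d dvd m}. d)"

definition Aser :: "nat \<Rightarrow> real \<Rightarrow> real" where
  "Aser i q = suminf (\<lambda>m. real (Suc m) ^ i * real (sigma1 (Suc m)) * q ^ (Suc m))"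

type_synonym mpoly = "(nat \<Rightarrow>\<^sub>0 nat) \<Rightarrow>\<^sub>0 rat"

definition mp_const :: "rat \<Rightarrow> mpoly" where
  "mp_const c = Poly_Mapping.single 0 c"

definition mp_monom :: "(nat \<Rightarrow>\<^sub>0 nat) \<Rightarrow> mpoly" where
  "mp_monom m = Poly_Mapping.single m 1"

definition mp_var :: "nat \<Rightarrow> mpoly" where
  "mp_var k = mp_monom (Poly_Mapping.single k 1)"

definition mp_vars :: "mpoly \<Rightarrow> nat set" where
  "mp_vars p = (\<Union>m\<in>Poly_Mapping.keys p. Poly_Mapping.keys (m :: nat \<Rightarrow>\<^sub>0 nat))"

definition mp_eval :: "(rat \<Rightarrow> 'b::comm_ring_1) \<Rightarrow> (nat \<Rightarrow> 'b) \<Rightarrow> mpoly \<Rightarrow> 'b" where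
  "mp_eval phi vals p =
     (\<Sum>m\<in>Poly_Mapping.keys p. phi (Poly_Mapping.lookup p m) * (\<Prod>k\<in>Poly_Mapping.keys m. vals k ^ Poly_Mapping.lookup m k))"

text \<open>The Q-linear derivation D with D(X_k) = X_(k+1).\<close>
definition mp_D :: "mpoly \<Rightarrow> mpoly" where
  "mp_D p = (\<Sum>m\<in>Poly_Mapping.keys p. mp_const (Poly_Mapping.lookup p m) *
      (\<Sum>k\<in>Poly_Mapping.keys m. of_nat (Poly_Mapping.lookup m k) * mp_monom (m - Poly_Mapping.single k 1) * mp_var (Suc k)))"

text \<open>Indeterminate a_k is represented by mp_var k.\<close>
definition aser :: "mpoly fps" where
  "aser = Abs_fps (\<lambda>i. mp_var i)"

definition Gser :: "nat \<Rightarrow> mpoly fps" where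
  "Gser j = (\<Prod>i\<in>{0..<j}. (1 + aser * fps_X ^ 2) * fps_right_inverse (1 + of_nat i * fps_X) 1)"

definition Hser :: "nat \<Rightarrow> mpoly fps" where
  "Hser j = (\<Prod>i\<in>{1 - int j..-1}. (1 + of_int i * fps_X) * fps_right_inverse (1 + aser * fps_X ^ 2) 1)"

text \<open>Coefficient of x^(n-1) in ((G - H)/x^2) (1 + a(x) x^2); the division by x^2 is exact.\<close>
definition Scoeff :: "nat \<Rightarrow> nat \<Rightarrow> mpoly" where
  "Scoeff j n = fps_nth (fps_shift 2 (Gser j - Hser j) * (1 + aser * fps_X ^ 2)) (n - 1)"

definition Spoly :: "nat \<Rightarrow> nat \<Rightarrow> mpoly" where
  "Spoly n = (THE S. (\<forall>i>n. S i = 0) \<and> (\<forall>i. mp_vars (S i) \<subseteq> {..<n - 1}) \<and>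
     (\<forall>j\<ge>1. Scoeff j n = of_nat (2 * j - 1) *
        (mp_var (n - 1) + (\<Sum>i\<le>n. S i * of_nat (j * (j - 1)) ^ i))))"

text \<open>S_i(n)(c_1,...,c_{n-1}): substitute a_k := c_{k+1}.\<close>
definition Ssubst :: "nat \<Rightarrow> nat \<Rightarrow> (nat \<Rightarrow> mpoly) \<Rightarrow> mpoly" where
  "Ssubst n i c = mp_eval mp_const (\<lambda>k. c (Suc k)) (Spoly n i)"

fun Ppoly :: "nat \<Rightarrow> mpoly" where
  "Ppoly 0 = 0"
| "Ppoly (Suc 0) = mp_var 0"
| "Ppoly (Suc (Suc m)) = mp_D (Ppoly (Suc m)) - 3 * mp_var 0 * Ppoly (Suc m)"

fun Chat_list :: "nat \<Rightarrow> mpoly list" where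
  "Chat_list 0 = []"
| "Chat_list (Suc m) =
    (let cs = Chat_list m; c = (\<lambda>k. if 1 \<le> k \<and> k \<le> m then cs ! (k - 1) else 0) in
     cs @ [- Ssubst (Suc m) 0 c +
           (\<Sum>i\<in>{1..Suc m}. 3 * 2 ^ i * Ssubst (Suc m) i c * Ppoly i)])"

definition Chat :: "nat \<Rightarrow> mpoly" where
  "Chat m = Chat_list m ! (m - 1)"

definition Cq :: "nat \<Rightarrow> real \<Rightarrow> real" where
  "Cq i q = mp_eval of_rat (\<lambda>k. Aser k q) (Chat i)"

end

theory Submission
  imports Defs "HOL-Analysis.Analysis"
begin

text \<open>
  Write \<open>f\<close> for the deformed exponential, so that \<open>f'(x) = f(q x)\<close>. At \<open>x = - k q\<^sup>1\<^sup>-\<^sup>k y\<close> the series of \<open>f\<close>,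
  divided by its term of index \<open>k - 1\<close>, becomes \<open>\<Phi> = \<Sum>\<^sub>j (-1)\<^sup>j q\<^bsup>j(j-1)/2\<^esup> (G\<^sub>j - H\<^sub>j)\<close> evaluated at \<open>1/k\<close>, where
  \<open>y = 1 + a(1/k) / k\<^sup>2\<close>. The coefficients of \<open>G\<^sub>j\<close> and \<open>H\<^sub>j\<close> are polynomials in \<open>j\<close>, exchanged by \<open>j \<mapsto> 1 - j\<close>;
  this yields the polynomials \<open>S\<^sub>i(n)\<close>. By Jacobi's identity \<open>\<Sum>\<^sub>j (-1)\<^sup>j (2j+1) q\<^bsup>j(j+1)/2\<^esup> = \<Prod>(1 - q\<^sup>m)\<^sup>3\<close> and its derivatives
  under \<open>q d/dq\<close>, the recursion for \<open>C\<^sub>i\<close> says exactly that the coefficients of \<open>\<Phi>\<close> vanish. Perturbing \<open>C\<^sub>n\<close> by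
  \<open>\<plusminus>\<epsilon>\<close> makes \<open>\<Phi>\<close> negative respectively positive for large \<open>k\<close>, so a zero of \<open>f\<close> lies in between.

  It remains to see that this zero is the \<open>k\<close>-th one. Rolle's theorem shows that consecutive zeros have ratio larger than
  \<open>1/q\<close>, so zeros can be counted by sign changes along a geometric progression. The sign of \<open>f(- k q\<^bsup>1/2-k\<^esup>)\<close> is
  \<open>(-1)\<^sup>k\<close> for large \<open>k\<close>, locally uniformly in \<open>q\<close>, because a theta series is positive. Hence the number of
  zeros in \<open>(- k q\<^bsup>1/2-k\<^esup>, 0)\<close> is \<open>k + c(q)\<close> for large \<open>k\<close> with a locally constant \<open>c\<close>, and \<open>c(1/100) = 0\<close>.
\<close>

text \<open>The expansion alone yields some zero near -k q^(1-k), not its index, whereas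
  \<open>defexp_zero\<close> is fixed by a count of real zeros. That count is made on the real line.
  The radii in it belong to y = q^(-1/2): there the terms of Phi tend to theta terms in r = sqrt q,
  and the theta sum is a limit of squared products bounded away from 0. A geometric grid turns the
  count into finitely many signs, so it survives a small change of q. The second obstacle is
  uniformity in j: the Taylor coefficients of G_j and H_j are polynomials in j of growing degree,
  and all remainders must be summed over j. Bounds C E^j suffice, because q^(j(j-1)/2) beats any
  geometric growth. The points x = 1/k matter here: H_j vanishes for j > k, so the finite left part
  of the series of f becomes a full series, and the products of 1 - i x stay bounded by 1.\<close>

section \<open>Multivariate polynomials\<close>

definition mp_below :: "nat \<Rightarrow> mpoly set" where
  "mp_below N = {p. mp_vars p \<subseteq> {..<N}}"

lemma mp_below_mono: "M \<le> N \<Longrightarrow> p \<in> mp_below M \<Longrightarrow> p \<in> mp_below N"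
  unfolding mp_below_def by (auto simp: subset_eq intro: less_le_trans)

lemma mp_below_add: "p \<in> mp_below N \<Longrightarrow> r \<in> mp_below N \<Longrightarrow> p + r \<in> mp_below N"
  using keys_add[of p r] unfolding mp_below_def mp_vars_def by (fastforce simp: subset_eq)

lemma mp_below_uminus: "p \<in> mp_below N \<Longrightarrow> - p \<in> mp_below N"
  unfolding mp_below_def mp_vars_def by (auto simp: in_keys_iff)

lemma mp_below_diff: "p \<in> mp_below N \<Longrightarrow> r \<in> mp_below N \<Longrightarrow> p - r \<in> mp_below N"
  using mp_below_add[of p N "- r"] mp_below_uminus[of r N] by simp

lemma mp_below_mult: "p \<in> mp_below N \<Longrightarrow> r \<in> mp_below N \<Longrightarrow> p * r \<in> mp_below N"
proof -
  assume p: "p \<in> mp_below N" and r: "r \<in> mp_below N"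
  have "i < N" if m: "m \<in> Poly_Mapping.keys (p * r)" and i: "i \<in> Poly_Mapping.keys m" for m i
  proof -
    obtain a b where ab: "m = a + b" "a \<in> Poly_Mapping.keys p" "b \<in> Poly_Mapping.keys r"
      using m keys_mult[of p r] by blast
    have "i \<in> Poly_Mapping.keys a \<union> Poly_Mapping.keys b"
      using i ab(1) keys_add[of a b] by blast
    then show ?thesis
      using p r ab unfolding mp_below_def mp_vars_def by blast
  qed
  then show ?thesis unfolding mp_below_def mp_vars_def by blast
qed

lemma mp_below_zero: "0 \<in> mp_below N"
  unfolding mp_below_def mp_vars_def by simp

lemma mp_below_sum: "(\<And>x. x \<in> A \<Longrightarrow> g x \<in> mp_below N) \<Longrightarrow> sum g A \<in> mp_below N"
  by (induction A rule: infinite_finite_induct) (auto intro: mp_below_zero mp_below_add)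

lemma mp_below_const: "mp_const c \<in> mp_below N"
  unfolding mp_below_def mp_vars_def mp_const_def by auto

lemma mp_below_one: "1 \<in> mp_below N"
  unfolding mp_below_def mp_vars_def by auto

lemma mp_below_of_nat: "of_nat k \<in> mp_below N"
  by (induction k) (auto intro: mp_below_zero mp_below_add mp_below_one)

lemma mp_below_of_int: "of_int k \<in> mp_below N"
  by (cases k) (auto intro: mp_below_of_nat mp_below_uminus mp_below_add mp_below_one mp_below_diff simp del: of_nat_Suc)

lemma mp_below_numeral: "numeral k \<in> mp_below N"
  using mp_below_of_nat[of "numeral k" N] by simp

lemma mp_below_power: "p \<in> mp_below N \<Longrightarrow> p ^ k \<in> mp_below N"
  by (induction k) (auto intro: mp_below_one mp_below_mult)

lemma mp_below_prod: "(\<And>x. x \<in> A \<Longrightarrow> g x \<in> mp_below N) \<Longrightarrow> prod g A \<in> mp_below N"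
  by (induction A rule: infinite_finite_induct) (auto intro: mp_below_one mp_below_mult)

lemma mp_below_var: "k < N \<Longrightarrow> mp_var k \<in> mp_below N"
  unfolding mp_below_def mp_vars_def mp_var_def mp_monom_def by simp

lemmas mp_below_intros = mp_below_add mp_below_uminus mp_below_diff mp_below_mult mp_below_zero
  mp_below_sum mp_below_const mp_below_one mp_below_of_nat mp_below_of_int mp_below_numeral
  mp_below_power mp_below_var

lemma mp_below_monomD:
  "p \<in> mp_below N \<Longrightarrow> m \<in> Poly_Mapping.keys p \<Longrightarrow> k \<in> Poly_Mapping.keys m \<Longrightarrow> k < N"
  unfolding mp_below_def mp_vars_def by blast

lemma mp_D_below:
  assumes "p \<in> mp_below N" shows "mp_D p \<in> mp_below (Suc N)"
  unfolding mp_D_def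
proof (intro mp_below_sum mp_below_mult mp_below_const mp_below_of_nat)
  fix m k assume m: "m \<in> Poly_Mapping.keys p" and k: "k \<in> Poly_Mapping.keys m"
  show "mp_var (Suc k) \<in> mp_below (Suc N)"
    using mp_below_monomD[OF assms m k] by (intro mp_below_var) simp
  have "Poly_Mapping.keys (m - Poly_Mapping.single k 1) \<subseteq> Poly_Mapping.keys m"
    by (auto simp: in_keys_iff lookup_minus)
  then show "mp_monom (m - Poly_Mapping.single k 1) \<in> mp_below (Suc N)"
    using mp_below_monomD[OF assms m]
    unfolding mp_below_def mp_vars_def mp_monom_def by (auto simp: less_Suc_eq)
qed

section \<open>Evaluation as a ring homomorphism\<close>

definition mono_eval :: "(nat \<Rightarrow> 'b::comm_ring_1) \<Rightarrow> (nat \<Rightarrow>\<^sub>0 nat) \<Rightarrow> 'b" where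
  "mono_eval vals m = (\<Prod>k\<in>Poly_Mapping.keys m. vals k ^ Poly_Mapping.lookup m k)"

lemma mono_eval_superset:
  assumes "finite K" "Poly_Mapping.keys m \<subseteq> K"
  shows "mono_eval vals m = (\<Prod>k\<in>K. vals k ^ Poly_Mapping.lookup m k)"
  unfolding mono_eval_def using assms
  by (intro prod.mono_neutral_left) (auto simp: in_keys_iff)

lemma mono_eval_add: "mono_eval vals (m + n) = mono_eval vals m * mono_eval vals n"
proof -
  let ?K = "Poly_Mapping.keys m \<union> Poly_Mapping.keys n"
  have "mono_eval vals (m + n) = (\<Prod>k\<in>?K. vals k ^ Poly_Mapping.lookup (m + n) k)"
    using keys_add[of m n] by (intro mono_eval_superset) auto
  also have "\<dots> = (\<Prod>k\<in>?K. vals k ^ Poly_Mapping.lookup m k) * (\<Prod>k\<in>?K. vals k ^ Poly_Mapping.lookup n k)"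
    by (simp add: lookup_add power_add prod.distrib)
  also have "\<dots> = mono_eval vals m * mono_eval vals n"
    using mono_eval_superset[of ?K m vals] mono_eval_superset[of ?K n vals] by simp
  finally show ?thesis .
qed

lemma mpoly_sum_monomials: "p = (\<Sum>m\<in>Poly_Mapping.keys p. Poly_Mapping.single m (Poly_Mapping.lookup p m))"
  by (rule poly_mapping_eqI) (auto simp: lookup_sum lookup_single when_def in_keys_iff)

lemma mpoly_mult_monomials: "p * r = (\<Sum>m\<in>Poly_Mapping.keys p. \<Sum>n\<in>Poly_Mapping.keys r.
    Poly_Mapping.single (m + n) (Poly_Mapping.lookup p m * Poly_Mapping.lookup r n))" for p r :: mpoly
  by (subst mpoly_sum_monomials[of p], subst mpoly_sum_monomials[of r])
     (simp add: sum_product mult_single)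

locale rat_hom =
  fixes phi :: "rat \<Rightarrow> 'b::comm_ring_1"
  assumes phi_add: "phi (x + y) = phi x + phi y"
    and phi_mult: "phi (x * y) = phi x * phi y"
    and phi_one: "phi 1 = 1"
begin

lemma phi_zero: "phi 0 = 0"
  using phi_add[of 0 0] by simp

lemma mp_eval_superset:
  assumes "finite K" "Poly_Mapping.keys p \<subseteq> K"
  shows "mp_eval phi vals p = (\<Sum>m\<in>K. phi (Poly_Mapping.lookup p m) * mono_eval vals m)"
  unfolding mp_eval_def mono_eval_def[symmetric] using assms
  by (intro sum.mono_neutral_left) (auto simp: in_keys_iff phi_zero)

lemma mp_eval_add: "mp_eval phi vals (p + r) = mp_eval phi vals p + mp_eval phi vals r"
proof -
  let ?K = "Poly_Mapping.keys p \<union> Poly_Mapping.keys r"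
  have "mp_eval phi vals (p + r) = (\<Sum>m\<in>?K. phi (Poly_Mapping.lookup (p + r) m) * mono_eval vals m)"
    using keys_add[of p r] by (intro mp_eval_superset) auto
  also have "\<dots> = (\<Sum>m\<in>?K. phi (Poly_Mapping.lookup p m) * mono_eval vals m)
      + (\<Sum>m\<in>?K. phi (Poly_Mapping.lookup r m) * mono_eval vals m)"
    by (simp add: lookup_add phi_add distrib_right sum.distrib)
  also have "\<dots> = mp_eval phi vals p + mp_eval phi vals r"
    using mp_eval_superset[of ?K p vals] mp_eval_superset[of ?K r vals] by simp
  finally show ?thesis .
qed

lemma mp_eval_zero: "mp_eval phi vals 0 = 0"
  by (simp add: mp_eval_def)

lemma mp_eval_uminus: "mp_eval phi vals (- p) = - mp_eval phi vals p"
  using mp_eval_add[of vals p "- p"] by (simp add: mp_eval_zero eq_neg_iff_add_eq_0 add.commute)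

lemma mp_eval_diff: "mp_eval phi vals (p - r) = mp_eval phi vals p - mp_eval phi vals r"
  using mp_eval_add[of vals p "- r"] by (simp add: mp_eval_uminus)

lemma mp_eval_sum: "mp_eval phi vals (sum g A) = (\<Sum>x\<in>A. mp_eval phi vals (g x))"
  by (induction A rule: infinite_finite_induct) (auto simp: mp_eval_zero mp_eval_add)

lemma mp_eval_single: "mp_eval phi vals (Poly_Mapping.single m c) = phi c * mono_eval vals m"
  by (subst mp_eval_superset[of "{m}"]) auto

lemma mp_eval_mult: "mp_eval phi vals (p * r) = mp_eval phi vals p * mp_eval phi vals r"
proof -
  have "mp_eval phi vals (p * r) = (\<Sum>m\<in>Poly_Mapping.keys p. \<Sum>n\<in>Poly_Mapping.keys r.
     (phi (Poly_Mapping.lookup p m) * mono_eval vals m) * (phi (Poly_Mapping.lookup r n) * mono_eval vals n))"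
    unfolding mpoly_mult_monomials
    by (simp add: mp_eval_sum mp_eval_single phi_mult mono_eval_add mult_ac)
  also have "\<dots> = mp_eval phi vals p * mp_eval phi vals r"
    unfolding mp_eval_def mono_eval_def[symmetric] sum_product ..
  finally show ?thesis .
qed

lemma mp_eval_const: "mp_eval phi vals (mp_const c) = phi c"
  unfolding mp_const_def by (simp add: mp_eval_single mono_eval_def)

lemma mp_eval_one: "mp_eval phi vals 1 = 1"
  using mp_eval_const[of vals 1] by (simp add: mp_const_def phi_one)

lemma mp_eval_var: "mp_eval phi vals (mp_var k) = vals k"
  unfolding mp_var_def mp_monom_def by (simp add: mp_eval_single mono_eval_def phi_one)

lemma mp_eval_of_nat: "mp_eval phi vals (of_nat k) = of_nat k"
  by (induction k) (auto simp: mp_eval_zero mp_eval_add mp_eval_one)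

lemma mp_eval_numeral: "mp_eval phi vals (numeral k) = numeral k"
  using mp_eval_of_nat[of vals "numeral k"] by simp

lemma mp_eval_power: "mp_eval phi vals (p ^ k) = mp_eval phi vals p ^ k"
  by (induction k) (auto simp: mp_eval_one mp_eval_mult)

lemma mp_eval_prod: "mp_eval phi vals (prod g A) = (\<Prod>x\<in>A. mp_eval phi vals (g x))"
  by (induction A rule: infinite_finite_induct) (auto simp: mp_eval_one mp_eval_mult)

lemmas mp_eval_simps = mp_eval_zero mp_eval_add mp_eval_uminus mp_eval_diff mp_eval_sum
  mp_eval_mult mp_eval_const mp_eval_one mp_eval_var mp_eval_of_nat mp_eval_numeral mp_eval_power
  mp_eval_prod

text \<open>This turns the recursion between the polynomials \<open>Chat\<close> into one between
  the numbers \<open>Cq\<close>.\<close>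

lemma mp_eval_subst:
  "mp_eval phi vals (mp_eval mp_const c p) = mp_eval phi (\<lambda>k. mp_eval phi vals (c k)) p"
  unfolding mp_eval_def[of mp_const] mp_eval_def[of phi "\<lambda>k. mp_eval phi vals (c k)"]
  by (simp add: mp_eval_simps)

end

interpretation real_hom: rat_hom "of_rat :: rat \<Rightarrow> real"
  by unfold_locales (simp_all add: of_rat_add of_rat_mult)

lemma mp_eval_cong:
  assumes "p \<in> mp_below N" "\<And>k. k < N \<Longrightarrow> v k = w k"
  shows "mp_eval phi v p = mp_eval phi w p"
  unfolding mp_eval_def using mp_below_monomD[OF assms(1)] assms(2)
  by (intro sum.cong arg_cong2[where f = "(*)"] prod.cong refl) auto

lemma mp_eval_const_below:
  assumes "p \<in> mp_below N" "\<And>k. k < N \<Longrightarrow> c k \<in> mp_below M"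
  shows "mp_eval mp_const c p \<in> mp_below M"
  unfolding mp_eval_def using mp_below_monomD[OF assms(1)] assms(2)
  by (intro mp_below_sum mp_below_mult mp_below_prod mp_below_power mp_below_const) auto

section \<open>The coefficient polynomials\<close>

text \<open>Coefficients of G_j, read off from (1 + j x) G_{j+1} = (1 + a x^2) G_j. The general ring
  lets one recursion serve the indeterminates and real sequences.\<close>

fun gcoef :: "(nat \<Rightarrow> 'a::comm_ring_1) \<Rightarrow> nat \<Rightarrow> nat \<Rightarrow> 'a" where
  "gcoef a 0 m = (if m = 0 then 1 else 0)"
| "gcoef a (Suc j) 0 = gcoef a j 0"
| "gcoef a (Suc j) (Suc m) =
     gcoef a j (Suc m) + (\<Sum>i<m. a i * gcoef a j (m - 1 - i)) - of_nat j * gcoef a (Suc j) m"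

text \<open>Here \<open>j\<close> counts factors, so these are the coefficients of H_{j+1}; the
  source is (1 + a x^2) H_{j+2} = (1 - (j+1) x) H_{j+1}.\<close>

fun hcoef :: "(nat \<Rightarrow> 'a::comm_ring_1) \<Rightarrow> nat \<Rightarrow> nat \<Rightarrow> 'a" where
  "hcoef a 0 m = (if m = 0 then 1 else 0)"
| "hcoef a (Suc j) 0 = hcoef a j 0"
| "hcoef a (Suc j) (Suc m) =
     hcoef a j (Suc m) - of_nat (Suc j) * hcoef a j m - (\<Sum>i<m. a i * hcoef a (Suc j) (m - 1 - i))"

lemma (in rat_hom) mp_eval_gcoef: "mp_eval phi vals (gcoef c j m) = gcoef (\<lambda>i. mp_eval phi vals (c i)) j m"
  by (induction c j m rule: gcoef.induct) (simp_all add: mp_eval_simps)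

lemma (in rat_hom) mp_eval_hcoef: "mp_eval phi vals (hcoef c j m) = hcoef (\<lambda>i. mp_eval phi vals (c i)) j m"
  by (induction c j m rule: hcoef.induct) (simp_all add: mp_eval_simps del: of_nat_Suc)

lemma fps_nth_mult_one_plus_aser:
  "fps_nth ((1 + aser * fps_X ^ 2) * F) 0 = fps_nth F 0"
  "fps_nth ((1 + aser * fps_X ^ 2) * F) (Suc m) =
     fps_nth F (Suc m) + (\<Sum>i<m. mp_var i * fps_nth F (m - 1 - i))"
proof -
  have eq: "(1 + aser * fps_X ^ 2) * F = F + fps_X ^ 2 * (aser * F)"
    by (simp add: algebra_simps)
  show "fps_nth ((1 + aser * fps_X ^ 2) * F) 0 = fps_nth F 0"
    unfolding eq by (simp add: fps_X_power_mult_nth)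
  show "fps_nth ((1 + aser * fps_X ^ 2) * F) (Suc m) =
     fps_nth F (Suc m) + (\<Sum>i<m. mp_var i * fps_nth F (m - 1 - i))"
  proof (cases m)
    case 0
    then show ?thesis unfolding eq by (simp add: fps_X_power_mult_nth)
  next
    case (Suc k)
    have set: "{0..k} = {..<Suc k}" by auto
    have "fps_nth (fps_X ^ 2 * (aser * F)) (Suc (Suc k)) = fps_nth (aser * F) k"
      by (simp add: fps_X_power_mult_nth)
    also have "\<dots> = (\<Sum>i<Suc k. mp_var i * fps_nth F (k - i))"
      unfolding fps_mult_nth set by (simp add: aser_def)
    finally show ?thesis unfolding eq Suc by simp
  qed
qed

lemma fps_nth_mult_one_plus_of_int_X:
  "fps_nth ((1 + of_int c * fps_X) * F) 0 = fps_nth F 0"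
  "fps_nth ((1 + of_int c * fps_X) * F) (Suc m) = fps_nth F (Suc m) + of_int c * fps_nth (F :: 'a::comm_ring_1 fps) m"
proof -
  have eq: "(1 + of_int c * fps_X) * F = F + fps_const (of_int c) * (fps_X * F)"
    by (simp add: algebra_simps fps_of_int)
  show "fps_nth ((1 + of_int c * fps_X) * F) 0 = fps_nth F 0"
    "fps_nth ((1 + of_int c * fps_X) * F) (Suc m) = fps_nth F (Suc m) + of_int c * fps_nth F m"
    unfolding eq by simp_all
qed

lemma Gser_Suc: "(1 + of_int (int j) * fps_X) * Gser (Suc j) = (1 + aser * fps_X ^ 2) * Gser j"
proof -
  have "(1 + of_nat j * fps_X) * fps_right_inverse (1 + of_nat j * fps_X) 1 = (1 :: mpoly fps)"
    by (rule fps_right_inverse) simp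
  then show ?thesis
    unfolding Gser_def by (simp add: mult_ac)
qed

lemma Hser_Suc: "(1 + aser * fps_X ^ 2) * Hser (Suc (Suc j)) = (1 + of_int (- int (Suc j)) * fps_X) * Hser (Suc j)"
proof -
  have inv: "(1 + aser * fps_X ^ 2) * fps_right_inverse (1 + aser * fps_X ^ 2) 1 = (1 :: mpoly fps)"
    by (rule fps_right_inverse) (simp add: aser_def fps_X_power_mult_right_nth)
  have set: "{1 - int (Suc (Suc j))..-1} = insert (- int (Suc j)) {1 - int (Suc j)..-1}"
    by auto
  have "Hser (Suc (Suc j)) = (1 + of_int (- int (Suc j)) * fps_X) *
      fps_right_inverse (1 + aser * fps_X ^ 2) 1 * Hser (Suc j)"
    unfolding Hser_def set by (subst prod.insert) auto
  then have "(1 + aser * fps_X ^ 2) * Hser (Suc (Suc j)) = 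
      ((1 + aser * fps_X ^ 2) * fps_right_inverse (1 + aser * fps_X ^ 2) 1) *
      ((1 + of_int (- int (Suc j)) * fps_X) * Hser (Suc j))"
    by (simp only: mult_ac)
  then show ?thesis unfolding inv by simp
qed

lemma Gser_nth: "fps_nth (Gser j) m = gcoef mp_var j m"
proof (induction "mp_var" j m rule: gcoef.induct)
  case (1 m)
  then show ?case by (simp add: Gser_def)
next
  case (2 j)
  then show ?case
    using arg_cong[OF Gser_Suc[of j], of "\<lambda>F. fps_nth F 0"]
    by (simp only: fps_nth_mult_one_plus_of_int_X fps_nth_mult_one_plus_aser gcoef.simps)
next
  case (3 j m)
  show ?case
    using arg_cong[OF Gser_Suc[of j], of "\<lambda>F. fps_nth F (Suc m)"] 3
    unfolding fps_nth_mult_one_plus_of_int_X fps_nth_mult_one_plus_aser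
    by (simp add: algebra_simps)
qed

lemma Hser_nth: "fps_nth (Hser (Suc j)) m = hcoef mp_var j m"
proof (induction "mp_var" j m rule: hcoef.induct)
  case (1 m)
  then show ?case by (simp add: Hser_def)
next
  case (2 j)
  then show ?case
    using arg_cong[OF Hser_Suc[of j], of "\<lambda>F. fps_nth F 0"]
    by (simp only: fps_nth_mult_one_plus_of_int_X fps_nth_mult_one_plus_aser hcoef.simps)
next
  case (3 j m)
  show ?case
    using arg_cong[OF Hser_Suc[of j], of "\<lambda>F. fps_nth F (Suc m)"] 3
    unfolding fps_nth_mult_one_plus_of_int_X fps_nth_mult_one_plus_aser
    by (simp add: algebra_simps)
qed

text \<open>The two families are the halves of one sequence indexed by the integers: \<open>H\<^sub>j = G\<^bsub>1-j\<^esub>\<close>.\<close>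

definition zcoef :: "(nat \<Rightarrow> 'a::comm_ring_1) \<Rightarrow> int \<Rightarrow> nat \<Rightarrow> 'a" where
  "zcoef a z m = (if z \<ge> 0 then gcoef a (nat z) m else hcoef a (nat (- z)) m)"

lemma gcoef_0: "gcoef a j 0 = 1"
  by (induction j) auto

lemma hcoef_0: "hcoef a j 0 = 1"
  by (induction j) auto

lemma zcoef_0 [simp]: "zcoef a z 0 = 1"
  by (simp add: zcoef_def gcoef_0 hcoef_0)

lemma zcoef_int: "zcoef a (int j) m = gcoef a j m"
  by (simp add: zcoef_def)

lemma zcoef_minus_int: "zcoef a (- int j) m = hcoef a j m"
  by (cases j) (simp_all add: zcoef_def del: of_nat_Suc)

text \<open>One difference equation in \<open>z\<close> contains both recursions: read forwards it
  is that of \<open>gcoef\<close>, read from z + 1 back to z that of \<open>hcoef\<close>.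
  Polynomial dependence on \<open>z\<close> follows by summation.\<close>

lemma zcoef_rec:
  "zcoef a (z + 1) (Suc m) - zcoef a z (Suc m) =
     (\<Sum>i<m. a i * zcoef a z (m - 1 - i)) - of_int z * zcoef a (z + 1) m"
proof (cases z rule: int_cases)
  case (nonneg j)
  then have "z + 1 = int (Suc j)" by simp
  then show ?thesis unfolding nonneg by (simp only: zcoef_int) simp
next
  case (neg j)
  then have z1: "z + 1 = - int j" by simp
  show ?thesis unfolding z1 unfolding neg
    by (simp only: zcoef_minus_int) (simp add: algebra_simps)
qed

text \<open>\<open>d\<close> counts coefficients, so the degree is below \<open>d\<close>; the value
  0 leaves only the zero function and starts the induction on degrees.\<close>

definition poly_fun :: "nat \<Rightarrow> nat \<Rightarrow> (int \<Rightarrow> mpoly) \<Rightarrow> bool" where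
  "poly_fun N d h \<longleftrightarrow> (\<exists>c. (\<forall>i. c i \<in> mp_below N) \<and> (\<forall>z. h z = (\<Sum>i<d. c i * of_int z ^ i)))"

lemma poly_funI: "(\<And>i. c i \<in> mp_below N) \<Longrightarrow> (\<And>z. h z = (\<Sum>i<d. c i * of_int z ^ i)) \<Longrightarrow> poly_fun N d h"
  unfolding poly_fun_def by blast

lemma poly_funE:
  assumes "poly_fun N d h"
  obtains c where "\<And>i. c i \<in> mp_below N" "\<And>z. h z = (\<Sum>i<d. c i * of_int z ^ i)"
  using assms unfolding poly_fun_def by blast

lemma poly_fun_mono:
  assumes "poly_fun N d h" "N \<le> N'" "d \<le> d'"
  shows "poly_fun N' d' h"
proof -
  obtain c where c: "\<And>i. c i \<in> mp_below N" "\<And>z. h z = (\<Sum>i<d. c i * of_int z ^ i)"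
    using poly_funE[OF assms(1)] by blast
  show ?thesis
  proof (rule poly_funI[of "\<lambda>i. if i < d then c i else 0"])
    show "(if i < d then c i else 0) \<in> mp_below N'" for i
      using c(1) assms(2) by (auto intro: mp_below_mono mp_below_zero)
    show "h z = (\<Sum>i<d'. (if i < d then c i else 0) * of_int z ^ i)" for z
      unfolding c(2) using assms(3) by (intro sum.mono_neutral_cong_left) auto
  qed
qed

lemma poly_fun_zero: "poly_fun N d (\<lambda>_. 0)"
  by (rule poly_funI[of "\<lambda>_. 0"]) (auto intro: mp_below_zero)

lemma poly_fun_add:
  assumes "poly_fun N d h" "poly_fun N d k"
  shows "poly_fun N d (\<lambda>z. h z + k z)"
proof -
  obtain c where "\<And>i. c i \<in> mp_below N" "\<And>z. h z = (\<Sum>i<d. c i * of_int z ^ i)"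
    using poly_funE[OF assms(1)] by blast
  moreover obtain e where "\<And>i. e i \<in> mp_below N" "\<And>z. k z = (\<Sum>i<d. e i * of_int z ^ i)"
    using poly_funE[OF assms(2)] by blast
  ultimately show ?thesis
    by (intro poly_funI[of "\<lambda>i. c i + e i"]) (auto intro: mp_below_add simp: distrib_right sum.distrib)
qed

lemma poly_fun_cmult:
  assumes "p \<in> mp_below N" "poly_fun N d h"
  shows "poly_fun N d (\<lambda>z. p * h z)"
proof -
  obtain c where "\<And>i. c i \<in> mp_below N" "\<And>z. h z = (\<Sum>i<d. c i * of_int z ^ i)"
    using poly_funE[OF assms(2)] by blast
  then show ?thesis using assms(1)
    by (intro poly_funI[of "\<lambda>i. p * c i"]) (auto intro: mp_below_mult simp: sum_distrib_left mult_ac)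
qed

lemma poly_fun_diff:
  assumes "poly_fun N d h" "poly_fun N d k"
  shows "poly_fun N d (\<lambda>z. h z - k z)"
  using poly_fun_add[OF assms(1) poly_fun_cmult[OF mp_below_uminus[OF mp_below_one] assms(2)]] by simp

lemma poly_fun_sum:
  "(\<And>x. x \<in> A \<Longrightarrow> poly_fun N d (h x)) \<Longrightarrow> poly_fun N d (\<lambda>z. \<Sum>x\<in>A. h x z)"
  by (induction A rule: infinite_finite_induct) (auto intro: poly_fun_zero poly_fun_add)

lemma poly_fun_mult_of_int:
  assumes "poly_fun N d h"
  shows "poly_fun N (Suc d) (\<lambda>z. of_int z * h z)"
proof -
  obtain c where c: "\<And>i. c i \<in> mp_below N" "\<And>z. h z = (\<Sum>i<d. c i * of_int z ^ i)"
    using poly_funE[OF assms] by blast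
  show ?thesis
  proof (rule poly_funI[of "\<lambda>i. case i of 0 \<Rightarrow> 0 | Suc k \<Rightarrow> c k"])
    show "(case i of 0 \<Rightarrow> 0 | Suc k \<Rightarrow> c k) \<in> mp_below N" for i
      using c(1) by (cases i) (auto intro: mp_below_zero)
    show "of_int z * h z = (\<Sum>i<Suc d. (case i of 0 \<Rightarrow> 0 | Suc k \<Rightarrow> c k) * of_int z ^ i)" for z
      unfolding sum.lessThan_Suc_shift c(2) by (simp add: sum_distrib_left mult_ac)
  qed
qed

lemma poly_fun_binomial_part:
  "e \<le> d \<Longrightarrow> poly_fun N e (\<lambda>z. \<Sum>i<e. of_nat (d choose i) * of_int z ^ i)"
  by (rule poly_funI[of "\<lambda>i. of_nat (d choose i)"]) (auto intro: mp_below_of_nat)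

lemma of_int_plus_one_power:
  "(of_int (z + 1) :: 'a::comm_ring_1) ^ d = (\<Sum>i<Suc d. of_nat (d choose i) * of_int z ^ i)"
  using binomial_ring[of "of_int z :: 'a" 1 d] by (simp add: lessThan_Suc_atMost)

lemma poly_fun_shift:
  assumes "poly_fun N d h"
  shows "poly_fun N d (\<lambda>z. h (z + 1))"
proof -
  obtain c where c: "\<And>i. c i \<in> mp_below N" "\<And>z. h z = (\<Sum>i<d. c i * of_int z ^ i)"
    using poly_funE[OF assms] by blast
  have "poly_fun N d (\<lambda>z. \<Sum>i<d. c i * of_int (z + 1) ^ i)"
  proof (intro poly_fun_sum poly_fun_cmult c)
    fix i assume "i \<in> {..<d}"
    then show "poly_fun N d (\<lambda>z. of_int (z + 1) ^ i)"
      unfolding of_int_plus_one_power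
      by (intro poly_fun_mono[OF poly_funI[of "\<lambda>k. of_nat (i choose k)" N _ "Suc i"]])
         (auto intro: mp_below_of_nat)
  qed
  then show ?thesis unfolding c(2) .
qed

text \<open>Summation raises the degree by one: subtracting r z^(d+1), with r the top coefficient of
  the difference divided by d + 1, cancels that top term. This division is where rational
  coefficients enter; \<open>h 0\<close> is the constant of summation.\<close>

lemma poly_fun_antidifference:
  assumes "poly_fun N d e" "\<And>z. h (z + 1) - h z = e z" "h 0 \<in> mp_below N"
  shows "poly_fun N (Suc d) h"
  using assms
proof (induction d arbitrary: e h)
  case 0
  have "e z = 0" for z using 0(1) by (auto elim: poly_funE)
  then have step: "h (z + 1) = h z" for z using 0(2)[of z] by simp
  have "h z = h 0" for z
  proof (induction z rule: int_induct[of _ 0])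
    case (step2 i)
    then show ?case using step[of "i - 1"] by simp
  qed (auto simp: step)
  then show ?case using 0(3) by (intro poly_funI[of "\<lambda>_. h 0"]) auto
next
  case (Suc d)
  obtain c where c: "\<And>i. c i \<in> mp_below N" "\<And>z. e z = (\<Sum>i<Suc d. c i * of_int z ^ i)"
    using poly_funE[OF Suc.prems(1)] by blast
  define r where "r = c d * mp_const (1 / of_nat (Suc d))"
  have r: "r \<in> mp_below N" unfolding r_def using c by (intro mp_below_intros)
  have "mp_const (1 / of_nat (Suc d)) * of_nat (Suc d) = (1 :: mpoly)"
    unfolding mp_const_def single_of_nat[symmetric] mult_single
    by (simp del: of_nat_Suc single_of_nat)
  then have rd: "r * of_nat (Suc d) = c d" unfolding r_def by (simp add: mult.assoc del: of_nat_Suc)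
  have "poly_fun N d (\<lambda>z. (\<Sum>i<d. c i * of_int z ^ i) - r * (\<Sum>i<d. of_nat (Suc d choose i) * of_int z ^ i))"
    using c r by (intro poly_fun_diff poly_fun_cmult poly_fun_binomial_part poly_funI[of c]) auto
  moreover have "(h (z + 1) - r * of_int (z + 1) ^ Suc d) - (h z - r * of_int z ^ Suc d) =
     (\<Sum>i<d. c i * of_int z ^ i) - r * (\<Sum>i<d. of_nat (Suc d choose i) * of_int z ^ i)" for z
  proof -
    have "r * of_int (z + 1) ^ Suc d = r * (\<Sum>i<d. of_nat (Suc d choose i) * of_int z ^ i)
       + (r * of_nat (Suc d)) * of_int z ^ d + r * of_int z ^ Suc d"
      unfolding of_int_plus_one_power by (simp add: algebra_simps del: of_nat_Suc power_Suc)
    moreover have "h (z + 1) - h z = (\<Sum>i<d. c i * of_int z ^ i) + c d * of_int z ^ d"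
      using Suc.prems(2)[of z] c(2)[of z] by simp
    ultimately show ?thesis unfolding rd by (simp add: algebra_simps del: of_nat_Suc power_Suc)
  qed
  moreover have "h 0 - r * of_int 0 ^ Suc d \<in> mp_below N" using Suc.prems(3) by simp
  ultimately have "poly_fun N (Suc d) (\<lambda>z. h z - r * of_int z ^ Suc d)"
    by (rule Suc.IH)
  then have "poly_fun N (Suc (Suc d)) (\<lambda>z. h z - r * of_int z ^ Suc d)"
    by (rule poly_fun_mono) auto
  moreover have "poly_fun N (Suc (Suc d)) (\<lambda>z. r * of_int z ^ Suc d)"
    using r by (intro poly_funI[of "\<lambda>i. if i = Suc d then r else 0"])
      (auto intro: mp_below_zero simp: if_distrib if_distribR cong: if_cong)
  ultimately show ?case using poly_fun_add by fastforce
qed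

text \<open>Each further order in x costs at most two degrees in z, one from the factor z and one
  from the summation.\<close>

lemma poly_fun_zcoef: "poly_fun (m - 1) (2 * m + 1) (\<lambda>z. zcoef mp_var z m)"
proof (induction m rule: less_induct)
  case (less m)
  show ?case
  proof (cases m)
    case 0
    then show ?thesis by (intro poly_funI[of "\<lambda>_. 1"]) (auto intro: mp_below_one)
  next
    case (Suc k)
    have "poly_fun k (2 * k + 2) (\<lambda>z. (\<Sum>i<k. mp_var i * zcoef mp_var z (k - 1 - i)) - of_int z * zcoef mp_var (z + 1) k)"
    proof (intro poly_fun_diff poly_fun_sum poly_fun_cmult)
      fix i assume i: "i \<in> {..<k}"
      show "mp_var i \<in> mp_below k" using i by (auto intro: mp_below_var)
      show "poly_fun k (2 * k + 2) (\<lambda>z. zcoef mp_var z (k - 1 - i))"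
        using i Suc by (intro poly_fun_mono[OF less]) auto
    next
      have "poly_fun (k - 1) (2 * k + 1) (\<lambda>z. zcoef mp_var z k)" using Suc by (intro less) auto
      from poly_fun_mult_of_int[OF poly_fun_shift[OF this]]
      show "poly_fun k (2 * k + 2) (\<lambda>z. of_int z * zcoef mp_var (z + 1) k)"
        by (rule poly_fun_mono) auto
    qed
    from poly_fun_antidifference[OF this, of "\<lambda>z. zcoef mp_var z (Suc k)"]
    have "poly_fun k (Suc (2 * k + 2)) (\<lambda>z. zcoef mp_var z (Suc k))"
      by (simp add: zcoef_rec) (simp add: zcoef_def mp_below_zero)
    then show ?thesis using Suc by simp
  qed
qed

text \<open>The newest indeterminate meets only the constant coefficient 1 in the difference
  equation, so it enters as z a_{m-1} and nowhere else. Splitting it off explains the isolated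
  a_{n-1} in the definition of the S_i(n).\<close>

lemma poly_fun_zcoef_minus_leading:
  assumes "m \<ge> 1"
  shows "poly_fun (m - 1) (2 * m + 3) (\<lambda>z. zcoef mp_var z (Suc m) - of_int z * mp_var (m - 1))"
proof -
  obtain k where k: "m = Suc k" using assms by (cases m) auto
  have "poly_fun k (2 * m + 2) (\<lambda>z. (\<Sum>i<k. mp_var i * zcoef mp_var z (m - 1 - i)) - of_int z * zcoef mp_var (z + 1) m)"
  proof (intro poly_fun_diff poly_fun_sum poly_fun_cmult)
    fix i assume i: "i \<in> {..<k}"
    show "mp_var i \<in> mp_below k" using i by (auto intro: mp_below_var)
    show "poly_fun k (2 * m + 2) (\<lambda>z. zcoef mp_var z (m - 1 - i))"
      using i k by (intro poly_fun_mono[OF poly_fun_zcoef]) auto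
  next
    from poly_fun_mult_of_int[OF poly_fun_shift[OF poly_fun_zcoef[of m]]]
    show "poly_fun k (2 * m + 2) (\<lambda>z. of_int z * zcoef mp_var (z + 1) m)"
      by (rule poly_fun_mono) (auto simp: k)
  qed
  moreover have "(zcoef mp_var (z + 1) (Suc m) - of_int (z + 1) * mp_var (m - 1))
      - (zcoef mp_var z (Suc m) - of_int z * mp_var (m - 1))
      = (\<Sum>i<k. mp_var i * zcoef mp_var z (m - 1 - i)) - of_int z * zcoef mp_var (z + 1) m" for z
    using zcoef_rec[of mp_var z m] by (simp add: k algebra_simps)
  moreover have "zcoef mp_var 0 (Suc m) - of_int 0 * mp_var (m - 1) \<in> mp_below k"
    by (simp add: zcoef_def mp_below_zero)
  ultimately have "poly_fun k (Suc (2 * m + 2)) (\<lambda>z. zcoef mp_var z (Suc m) - of_int z * mp_var (m - 1))"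
    by (rule poly_fun_antidifference)
  then show ?thesis by (simp add: k eval_nat_numeral)
qed

text \<open>Both \<open>z\<close> and \<open>1 - z\<close> are roots of \<open>t\<^sup>2 = t + z (z - 1)\<close>, which gives a three-term recursion.\<close>

lemma power_minus_reflected_power:
  "\<exists>e::int poly. 2 * degree e \<le> i - 1 \<and> (\<forall>z::int. z ^ i - (1 - z) ^ i = (2 * z - 1) * poly e (z * (z - 1)))"
proof (induction i rule: less_induct)
  case (less i)
  consider "i = 0" | "i = 1" | "i = 2" | k where "i = Suc (Suc (Suc k))"
    by (metis One_nat_def Suc_1 not0_implies_Suc)
  then show ?case
  proof cases
    case 1
    then show ?thesis by (intro exI[of _ 0]) auto
  next
    case 2
    then show ?thesis by (intro exI[of _ 1]) auto
  next
    case 3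
    then show ?thesis by (intro exI[of _ 1]) (auto simp: power2_eq_square algebra_simps)
  next
    case 4
    obtain e where e: "2 * degree e \<le> Suc k" "\<And>z::int. z ^ Suc (Suc k) - (1 - z) ^ Suc (Suc k) = (2 * z - 1) * poly e (z * (z - 1))"
      using less[of "Suc (Suc k)"] 4 by (auto simp del: power_Suc)
    obtain e' where e': "2 * degree e' \<le> k" "\<And>z::int. z ^ Suc k - (1 - z) ^ Suc k = (2 * z - 1) * poly e' (z * (z - 1))"
      using less[of "Suc k"] 4 by (auto simp del: power_Suc)
    have "degree (pCons 0 e') \<le> Suc (degree e')" by simp
    then have "2 * degree (e + pCons 0 e') \<le> Suc (Suc k)"
      using degree_add_le_max[of e "pCons 0 e'"] e(1) e'(1) by auto
    moreover have "z ^ i - (1 - z) ^ i = (2 * z - 1) * poly (e + pCons 0 e') (z * (z - 1))" for z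
    proof -
      have "z ^ i - (1 - z) ^ i = (z ^ Suc (Suc k) - (1 - z) ^ Suc (Suc k)) +
          z * (z - 1) * (z ^ Suc k - (1 - z) ^ Suc k)"
        unfolding 4 by (simp add: algebra_simps)
      then show ?thesis unfolding e(2) e'(2) by (simp add: algebra_simps)
    qed
    ultimately show ?thesis using 4 by auto
  qed
qed

text \<open>Powers up to z^(2n+2) have reflected differences with cofactor of degree at most n in z
  (z - 1). With u = 2z - 1 and v = z (z - 1) this is the shape u (S_0 + ... + S_n v^n).\<close>

lemma poly_fun_antisymmetrize:
  assumes "poly_fun N (2 * n + 3) h"
  shows "\<exists>S. (\<forall>i. S i \<in> mp_below N) \<and>
    (\<forall>z. h z - h (1 - z) = of_int (2 * z - 1) * (\<Sum>i\<le>n. S i * of_int (z * (z - 1)) ^ i))"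
proof -
  obtain c where c: "\<And>i. c i \<in> mp_below N" "\<And>z. h z = (\<Sum>i<2*n+3. c i * of_int z ^ i)"
    using poly_funE[OF assms] by blast
  obtain e where e: "\<And>i. 2 * degree (e i) \<le> i - 1"
     "\<And>i z. z ^ i - (1 - z) ^ i = (2 * z - 1) * poly (e i :: int poly) (z * (z - 1))"
    using power_minus_reflected_power by metis
  define S where "S l = (\<Sum>i<2*n+3. c i * of_int (coeff (e i) l))" for l
  have "h z - h (1 - z) = of_int (2 * z - 1) * (\<Sum>l\<le>n. S l * of_int (z * (z - 1)) ^ l)" for z
  proof -
    have "h z - h (1 - z) = (\<Sum>i<2*n+3. c i * of_int (z ^ i - (1 - z) ^ i))"
      unfolding c(2) sum_subtractf[symmetric] by (simp add: algebra_simps)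
    also have "\<dots> = (\<Sum>i<2*n+3. c i * of_int ((2 * z - 1) * (\<Sum>l\<le>n. coeff (e i) l * (z * (z - 1)) ^ l)))"
    proof (intro sum.cong refl arg_cong2[where f = "(*)"] arg_cong[where f = of_int])
      fix i assume "i \<in> {..<2*n+3}"
      then have "degree (e i) \<le> n" using e(1)[of i] by auto
      then have "poly (e i) (z * (z - 1)) = (\<Sum>l\<le>n. coeff (e i) l * (z * (z - 1)) ^ l)"
        unfolding poly_altdef by (intro sum.mono_neutral_left) (auto simp: coeff_eq_0)
      then show "z ^ i - (1 - z) ^ i = (2 * z - 1) * (\<Sum>l\<le>n. coeff (e i) l * (z * (z - 1)) ^ l)"
        using e(2) by simp
    qed
    also have "\<dots> = of_int (2 * z - 1) * (\<Sum>l\<le>n. S l * of_int (z * (z - 1)) ^ l)"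
      unfolding S_def sum_distrib_right sum_distrib_left of_int_mult of_int_sum
      by (subst sum.swap) (simp add: mult_ac)
    finally show ?thesis .
  qed
  moreover have "S l \<in> mp_below N" for l
    unfolding S_def using c by (intro mp_below_intros)
  ultimately show ?thesis by blast
qed

text \<open>The sum stops at \<open>i < n - 2\<close> because division by x^2 has removed the two
  lowest coefficients. H_j sits at index 1 - j of the integer family, so the result is an
  antisymmetrization.\<close>

lemma Scoeff_eq_zcoef:
  assumes "n \<ge> 1" "j \<ge> 1"
  defines "p \<equiv> \<lambda>z. zcoef mp_var z (Suc n) + (\<Sum>i<n - 2. mp_var i * zcoef mp_var z (n - 1 - i))"
  shows "Scoeff j n = p (int j) - p (1 - int j)"
proof -
  obtain k where k: "j = Suc k" using assms by (cases j) auto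
  define F where "F = fps_shift 2 (Gser j - Hser j)"
  have F: "fps_nth F m = zcoef mp_var (int j) (m + 2) - zcoef mp_var (1 - int j) (m + 2)" for m
  proof -
    have "fps_nth F m = fps_nth (Gser j) (m + 2) - fps_nth (Hser (Suc k)) (m + 2)"
      by (simp add: F_def k)
    moreover have "1 - int j = - int k" by (simp add: k)
    ultimately show ?thesis by (simp only: Gser_nth zcoef_int Hser_nth zcoef_minus_int)
  qed
  have S: "Scoeff j n = fps_nth ((1 + aser * fps_X ^ 2) * F) (n - 1)"
    unfolding Scoeff_def F_def by (simp add: mult.commute)
  show ?thesis
  proof (cases "n = 1")
    case True
    then have "p z = zcoef mp_var z (0 + 2)" for z
      unfolding p_def by (simp only: One_nat_def numeral_2_eq_2 add_0) simp
    moreover have "Scoeff j n = fps_nth F 0"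
      unfolding S using True by (simp only: diff_self_eq_0 fps_nth_mult_one_plus_aser(1))
    ultimately show ?thesis by (simp only: F)
  next
    case False
    define m where "m = n - 2"
    have m: "n = Suc (Suc m)" unfolding m_def using False assms(1) by simp
    have "(\<Sum>i<m. mp_var i * fps_nth F (m - 1 - i)) =
       (\<Sum>i<m. mp_var i * zcoef mp_var (int j) (n - 1 - i)) - (\<Sum>i<m. mp_var i * zcoef mp_var (1 - int j) (n - 1 - i))"
      unfolding sum_subtractf[symmetric] F
    proof (intro sum.cong refl)
      fix i assume "i \<in> {..<m}"
      then have "m - 1 - i + 2 = n - 1 - i" using m by auto
      then show "mp_var i * (zcoef mp_var (int j) (m - 1 - i + 2) - zcoef mp_var (1 - int j) (m - 1 - i + 2)) =
        mp_var i * zcoef mp_var (int j) (n - 1 - i) - mp_var i * zcoef mp_var (1 - int j) (n - 1 - i)"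
        by (simp only: right_diff_distrib)
    qed
    moreover have n: "n - 1 = Suc m" "Suc n = Suc m + 2" "n - 2 = m" using m by simp_all
    moreover have "Scoeff j n = fps_nth F (Suc m) + (\<Sum>i<m. mp_var i * fps_nth F (m - 1 - i))"
      unfolding S n(1) by (rule fps_nth_mult_one_plus_aser(2))
    ultimately have "Scoeff j n = (zcoef mp_var (int j) (Suc n) - zcoef mp_var (1 - int j) (Suc n)) +
      ((\<Sum>i<m. mp_var i * zcoef mp_var (int j) (n - 1 - i)) - (\<Sum>i<m. mp_var i * zcoef mp_var (1 - int j) (n - 1 - i)))"
      by (simp only: F n(2))
    then show ?thesis unfolding p_def n(3) by (simp only: algebra_simps)
  qed
qed

text \<open>The property under \<open>THE\<close> in \<open>Spoly\<close>, named so that existence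
  and uniqueness can be shown separately.\<close>

definition is_Spoly :: "nat \<Rightarrow> (nat \<Rightarrow> mpoly) \<Rightarrow> bool" where
  "is_Spoly n S \<longleftrightarrow> (\<forall>i>n. S i = 0) \<and> (\<forall>i. mp_vars (S i) \<subseteq> {..<n - 1}) \<and>
     (\<forall>j\<ge>1. Scoeff j n = of_nat (2 * j - 1) *
        (mp_var (n - 1) + (\<Sum>i\<le>n. S i * of_nat (j * (j - 1)) ^ i)))"

lemma is_SpolyD:
  "is_Spoly n S \<Longrightarrow> j \<ge> 1 \<Longrightarrow> Scoeff j n = of_nat (2 * j - 1) *
     (mp_var (n - 1) + (\<Sum>i\<le>n. S i * of_nat (j * (j - 1)) ^ i))"
  unfolding is_Spoly_def by (drule conjunct2, drule conjunct2, drule spec, erule mp)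

text \<open>The part z a_{n-1} antisymmetrizes to (2j - 1) a_{n-1}; the remaining part, free of
  a_{n-1}, is left to \<open>poly_fun_antisymmetrize\<close>.\<close>

lemma is_Spoly_exists:
  assumes "n \<ge> 1"
  shows "\<exists>S. is_Spoly n S"
proof -
  define p where "p = (\<lambda>z. zcoef mp_var z (Suc n) + (\<Sum>i<n - 2. mp_var i * zcoef mp_var z (n - 1 - i)))"
  define r where "r = (\<lambda>z. (zcoef mp_var z (Suc n) - of_int z * mp_var (n - 1)) + (\<Sum>i<n - 2. mp_var i * zcoef mp_var z (n - 1 - i)))"
  have "poly_fun (n - 1) (2 * n + 3) r"
    unfolding r_def using assms
    by (intro poly_fun_add poly_fun_sum poly_fun_cmult poly_fun_zcoef_minus_leading
        poly_fun_mono[OF poly_fun_zcoef] mp_below_var) auto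
  from poly_fun_antisymmetrize[OF this] obtain S where
    S: "\<And>i. S i \<in> mp_below (n - 1)"
      "\<And>z. r z - r (1 - z) = of_int (2 * z - 1) * (\<Sum>i\<le>n. S i * of_int (z * (z - 1)) ^ i)"
    by blast
  \<comment> \<open>The solution is a function on all indices, so its values beyond \<open>n\<close>
    are fixed as 0.\<close>
  define S' where "S' i = (if i \<le> n then S i else 0)" for i
  have "Scoeff j n = of_nat (2 * j - 1) * (mp_var (n - 1) + (\<Sum>i\<le>n. S' i * of_nat (j * (j - 1)) ^ i))"
    if "j \<ge> 1" for j
  proof -
    have "Scoeff j n = p (int j) - p (1 - int j)"
      unfolding p_def using assms that by (rule Scoeff_eq_zcoef)
    also have "\<dots> = of_int (2 * int j - 1) * mp_var (n - 1) + (r (int j) - r (1 - int j))"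
      unfolding p_def r_def by (simp add: algebra_simps)
    also have "\<dots> = of_int (2 * int j - 1) * (mp_var (n - 1) + (\<Sum>i\<le>n. S i * of_int (int j * (int j - 1)) ^ i))"
      unfolding S(2) by (simp add: distrib_left)
    also have "2 * int j - 1 = int (2 * j - 1)" using that by auto
    also have "int j * (int j - 1) = int (j * (j - 1))" using that by (simp add: of_nat_diff)
    finally show ?thesis unfolding of_int_of_nat_eq by (simp add: S'_def)
  qed
  moreover have "mp_vars (S' i) \<subseteq> {..<n - 1}" for i
    using S(1)[of i] mp_below_zero[of "n - 1"] unfolding S'_def mp_below_def by auto
  ultimately show ?thesis unfolding is_Spoly_def S'_def by (intro exI[of _ S']) (auto simp: S'_def)
qed

text \<open>After cancelling 2j - 1, two solutions differ by a polynomial over an integral domain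
  that vanishes at the infinitely many values j (j - 1).\<close>

lemma is_Spoly_unique:
  assumes S: "is_Spoly n S" and T: "is_Spoly n T"
  shows "S = T"
proof -
  define P :: "mpoly poly" where "P = (\<Sum>i\<le>n. monom (S i - T i) i)"
  have P: "poly P x = (\<Sum>i\<le>n. S i * x ^ i) - (\<Sum>i\<le>n. T i * x ^ i)" for x
    unfolding P_def by (simp add: poly_sum poly_monom sum_subtractf left_diff_distrib)
  have root: "poly P (of_nat (j * (j - 1))) = 0" if "j \<ge> 1" for j
  proof -
    have nz: "(of_nat (2 * j - 1) :: mpoly) \<noteq> 0"
      unfolding of_nat_eq_0_iff using that by auto
    have "of_nat (2 * j - 1) * (mp_var (n - 1) + (\<Sum>i\<le>n. S i * of_nat (j * (j - 1)) ^ i)) =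
       of_nat (2 * j - 1) * (mp_var (n - 1) + (\<Sum>i\<le>n. T i * of_nat (j * (j - 1)) ^ i))"
      by (rule trans[OF is_SpolyD[OF S that, symmetric] is_SpolyD[OF T that]])
    then have "mp_var (n - 1) + (\<Sum>i\<le>n. S i * of_nat (j * (j - 1)) ^ i) =
       mp_var (n - 1) + (\<Sum>i\<le>n. T i * of_nat (j * (j - 1)) ^ i)"
      by (rule mult_left_cancel[OF nz, THEN iffD1])
    then show ?thesis unfolding P by simp
  qed
  have "inj_on (\<lambda>j. of_nat (j * (j - 1)) :: mpoly) {1..}"
  proof (rule inj_onI)
    fix i j :: nat assume "i \<in> {1..}" "j \<in> {1..}" "(of_nat (i * (i - 1)) :: mpoly) = of_nat (j * (j - 1))"
    then have ij: "i \<ge> 1" "j \<ge> 1" "i * (i - 1) = j * (j - 1)" by (simp_all only: of_nat_eq_iff atLeast_iff)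
    have "a * (a - 1) < b * (b - 1)" if "1 \<le> a" "a < b" for a b :: nat
      using that by (intro mult_le_less_imp_less) auto
    with ij show "i = j" by (metis less_irrefl nat_neq_iff)
  qed
  then have "infinite ((\<lambda>j. of_nat (j * (j - 1)) :: mpoly) ` {1..})"
    by (subst finite_image_iff) (auto simp: infinite_Ici)
  moreover have "(\<lambda>j. of_nat (j * (j - 1)) :: mpoly) ` {1..} \<subseteq> {x. poly P x = 0}"
    using root by auto
  ultimately have "P = 0" using poly_roots_finite[of P] finite_subset by blast
  then have "S i = T i" if "i \<le> n" for i
  proof -
    have "coeff P i = S i - T i" unfolding P_def using that
      by (simp add: coeff_sum)
    then show ?thesis using \<open>P = 0\<close> by simp
  qed
  moreover have "S i = T i" if "i > n" for i
    using that S T unfolding is_Spoly_def by simp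
  ultimately show ?thesis by (intro ext) (meson not_le)
qed

lemma is_Spoly_Spoly:
  assumes "n \<ge> 1" shows "is_Spoly n (Spoly n)"
proof -
  have "\<exists>!S. is_Spoly n S" using is_Spoly_exists[OF assms] is_Spoly_unique by blast
  from theI'[OF this] show ?thesis unfolding Spoly_def is_Spoly_def .
qed

lemma Spoly_below: "n \<ge> 1 \<Longrightarrow> Spoly n i \<in> mp_below (n - 1)"
  using is_Spoly_Spoly[of n] unfolding is_Spoly_def mp_below_def by blast

section \<open>Indeterminates in the recursion for the C_i\<close>

lemma Ppoly_below: "Ppoly i \<in> mp_below i"
proof (induction i rule: Ppoly.induct)
  case (3 m)
  then show ?case
    using mp_D_below[OF 3(1)] mp_below_mono[OF _ 3(1), of "Suc (Suc m)"]
    by (auto intro!: mp_below_intros)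
qed (auto intro: mp_below_intros)

lemma length_Chat_list: "length (Chat_list m) = m"
  by (induction m) (auto simp: Let_def)

lemma Chat_list_nth: "k < m \<Longrightarrow> Chat_list m ! k = Chat (Suc k)"
proof (induction m)
  case (Suc m)
  show ?case
  proof (cases "k = m")
    case True
    then show ?thesis by (simp add: Chat_def)
  next
    case False
    then have "Chat_list (Suc m) ! k = Chat_list m ! k"
      using Suc.prems by (simp add: Let_def nth_append length_Chat_list)
    then show ?thesis using Suc False by simp
  qed
qed simp

lemma Chat_rec:
  assumes "m \<ge> 1"
  shows "Chat m = - mp_eval mp_const (\<lambda>k. if k < m - 1 then Chat (Suc k) else 0) (Spoly m 0) +
    (\<Sum>i\<in>{1..m}. 3 * 2 ^ i * mp_eval mp_const (\<lambda>k. if k < m - 1 then Chat (Suc k) else 0) (Spoly m i) * Ppoly i)"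
proof -
  obtain k where k: "m = Suc k" using assms by (cases m) auto
  have "(\<lambda>l. if 1 \<le> Suc l \<and> Suc l \<le> k then Chat_list k ! (Suc l - 1) else 0) =
     (\<lambda>l. if l < k then Chat (Suc l) else 0)"
    using Chat_list_nth[of _ k] by (auto simp: fun_eq_iff)
  then show ?thesis
    unfolding k Chat_def[of "Suc k"]
    by (simp add: Let_def nth_append length_Chat_list Ssubst_def del: sum.cl_ivl_Suc)
qed

lemma Chat_below: "i \<ge> 1 \<Longrightarrow> Chat i \<in> mp_below i"
proof (induction i rule: less_induct)
  case (less m)
  have sub: "mp_eval mp_const (\<lambda>k. if k < m - 1 then Chat (Suc k) else 0) (Spoly m i) \<in> mp_below m" for i
  proof (rule mp_eval_const_below[OF Spoly_below[OF less.prems]])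
    fix k assume "k < m - 1"
    then show "(if k < m - 1 then Chat (Suc k) else 0) \<in> mp_below m"
      using mp_below_mono[OF _ less.IH[of "Suc k"], of m] by auto
  qed
  show ?case unfolding Chat_rec[OF less.prems]
    using sub mp_below_mono[OF _ Ppoly_below, of _ m]
    by (intro mp_below_intros) auto
qed

text \<open>Substitution followed by evaluation is evaluation at the numbers \<open>Cq\<close>.
  Since \<open>Spoly m i\<close> sees only indices below m - 1, the default 0 may be replaced by the
  full sequence, which is the same for every \<open>m\<close>.\<close>

lemma Cq_rec:
  assumes "m \<ge> 1"
  shows "Cq m q = - mp_eval of_rat (\<lambda>k. Cq (Suc k) q) (Spoly m 0) +
    (\<Sum>i\<in>{1..m}. 3 * 2 ^ i * mp_eval of_rat (\<lambda>k. Cq (Suc k) q) (Spoly m i) * mp_eval of_rat (\<lambda>k. Aser k q) (Ppoly i))"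
proof -
  have "mp_eval of_rat (\<lambda>k. Aser k q) (mp_eval mp_const (\<lambda>k. if k < m - 1 then Chat (Suc k) else 0) (Spoly m i))
     = mp_eval of_rat (\<lambda>k. Cq (Suc k) q) (Spoly m i)" for i
    unfolding real_hom.mp_eval_subst Cq_def
    by (rule mp_eval_cong[OF Spoly_below[OF assms]]) simp
  then show ?thesis unfolding Cq_def[of m] Chat_rec[OF assms]
    by (simp add: real_hom.mp_eval_simps)
qed

text \<open>The coefficient of \<open>x\<^sup>n\<^sup>-\<^sup>1\<close> in \<open>(G - H)/x\<^sup>2 (1 + a x\<^sup>2)\<close> for a real sequence \<open>a\<close> and \<open>j + 1\<close> in place of \<open>j\<close>.\<close>

lemma Spoly_real:
  fixes a :: "nat \<Rightarrow> real"
  assumes "n \<ge> 1"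
  defines "d \<equiv> \<lambda>j m. gcoef a (Suc j) m - hcoef a j m"
  shows "d j (Suc n) + (\<Sum>i<n - 2. a i * d j (n - 1 - i)) = (2 * real j + 1) *
    (a (n - 1) + (\<Sum>i\<le>n. mp_eval of_rat a (Spoly n i) * (real j * (real j + 1)) ^ i))"
proof -
  define D where "D = (\<lambda>m. zcoef mp_var (int (Suc j)) m - zcoef mp_var (1 - int (Suc j)) m)"
  have D: "mp_eval of_rat a (D m) = d j m" for m
    unfolding D_def d_def using zcoef_minus_int[of mp_var j m] zcoef_int[of mp_var "Suc j" m]
    by (simp add: real_hom.mp_eval_simps real_hom.mp_eval_gcoef real_hom.mp_eval_hcoef)
  have "Scoeff (Suc j) n = D (Suc n) + (\<Sum>i<n - 2. mp_var i * D (n - 1 - i))"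
    unfolding D_def using Scoeff_eq_zcoef[of n "Suc j"] assms(1)
    by (simp add: algebra_simps sum_subtractf)
  then have "mp_eval of_rat a (Scoeff (Suc j) n) = d j (Suc n) + (\<Sum>i<n - 2. a i * d j (n - 1 - i))"
    by (simp add: real_hom.mp_eval_simps D)
  moreover have "Scoeff (Suc j) n = of_nat (2 * Suc j - 1) *
        (mp_var (n - 1) + (\<Sum>i\<le>n. Spoly n i * of_nat (Suc j * (Suc j - 1)) ^ i))"
    by (rule is_SpolyD[OF is_Spoly_Spoly[OF assms(1)]]) simp
  moreover have "real (2 * Suc j - 1) = 2 * real j + 1" "real (Suc j * (Suc j - 1)) = real j * (real j + 1)"
    by (simp_all add: algebra_simps)
  ultimately show ?thesis
    by (simp only: real_hom.mp_eval_simps)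
qed

section \<open>Jacobi's identity\<close>

definition tri :: "nat \<Rightarrow> nat" where "tri j = j * (j + 1) div 2"

lemma tri_0 [simp]: "tri 0 = 0"
  by (simp add: tri_def)

lemma tri_Suc: "tri (Suc j) = tri j + Suc j"
  by (simp add: tri_def)

lemma tri_eq: "2 * tri j = j * (j + 1)"
  by (induction j) (auto simp: tri_Suc)

lemma real_tri: "real (tri j) = real j * (real j + 1) / 2"
proof -
  have "2 * real (tri j) = real j * (real j + 1)"
    using arg_cong[OF tri_eq[of j], of real] by (simp only: of_nat_mult of_nat_add of_nat_numeral of_nat_1)
  then show ?thesis by simp
qed

lemma strict_mono_tri: "strict_mono tri"
  by (rule strict_monoI_Suc) (simp add: tri_Suc)

lemma tri_ge: "j \<le> tri j"
  by (cases j) (auto simp: tri_Suc)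

section \<open>Gaussian binomial coefficients\<close>

definition qfac :: "real \<Rightarrow> nat \<Rightarrow> real" where
  "qfac q n = (\<Prod>i<n. 1 - q ^ Suc i)"

text \<open>Gaussian binomials by a q-Pascal rule, free of division. The weight q^(N - k) fits the
  induction in \<open>q_binomial_theorem\<close>, which splits off the last factor 1 + y
  q^N.\<close>

fun qbin :: "real \<Rightarrow> nat \<Rightarrow> nat \<Rightarrow> real" where
  "qbin q N 0 = 1"
| "qbin q 0 (Suc k) = 0"
| "qbin q (Suc N) (Suc k) = qbin q N (Suc k) + q ^ (N - k) * qbin q N k"

lemma qbin_eq_0: "N < k \<Longrightarrow> qbin q N k = 0"
  by (induction q N k rule: qbin.induct) auto

lemma qfac_0 [simp]: "qfac q 0 = 1"
  by (simp add: qfac_def)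

lemma qfac_Suc: "qfac q (Suc n) = qfac q n * (1 - q ^ Suc n)"
  by (simp add: qfac_def)

lemma qbin_mult_qfac: "k \<le> N \<Longrightarrow> qbin q N k * (qfac q k * qfac q (N - k)) = qfac q N"
proof (induction q N k rule: qbin.induct)
  case (3 q N k)
  have 2: "q ^ (N - k) * qbin q N k * (qfac q (Suc k) * qfac q (N - k)) = q ^ (N - k) * (1 - q ^ Suc k) * qfac q N"
    using 3(2)[symmetric] 3(3) by (simp add: qfac_Suc)
  show ?case
  proof (cases "k = N")
    case True
    then show ?thesis using 2 by (simp add: qbin_eq_0 qfac_Suc)
  next
    case False
    then have kN: "Suc k \<le> N" "N - k = Suc (N - Suc k)" using 3(3) by auto
    then have "qbin q N (Suc k) * (qfac q (Suc k) * qfac q (N - k)) = (1 - q ^ (N - k)) * qfac q N"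
      using 3(1) by (simp add: qfac_Suc)
    moreover have "q ^ Suc N = q ^ (N - k) * q ^ Suc k"
      unfolding power_add[symmetric] using 3(3) by simp
    ultimately show ?thesis using 2 unfolding qfac_Suc[of q N] qbin.simps(3) diff_Suc_Suc
      by (simp only: algebra_simps)
  qed
qed auto

lemma pairs_Suc: "Suc k * (Suc k - 1) div 2 = k * (k - 1) div 2 + k"
proof (cases k)
  case (Suc m)
  have "Suc k * k = k * (k - 1) + k * 2" using Suc by simp
  then show ?thesis by simp
qed simp

lemma tri_eq_pairs: "tri k = k * (k - 1) div 2 + k"
  using pairs_Suc[of k] by (simp add: tri_def mult.commute)

lemma q_binomial_theorem:
  "(\<Prod>i<N. 1 + y * q ^ i) = (\<Sum>k\<le>N. q ^ (k * (k - 1) div 2) * qbin q N k * y ^ k)"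
proof (induction N)
  case (Suc N)
  let ?t = "\<lambda>N k. q ^ (k * (k - 1) div 2) * qbin q N k * y ^ k"
  have "?t (Suc N) (Suc k) = ?t N (Suc k) + y * q ^ N * ?t N k" if "k \<le> N" for k
  proof -
    have "q ^ (Suc k * (Suc k - 1) div 2) * q ^ (N - k) = q ^ N * q ^ (k * (k - 1) div 2)"
      unfolding pairs_Suc power_add[symmetric] using that by (simp add: add.commute)
    then have "q ^ (Suc k * (Suc k - 1) div 2) * q ^ (N - k) * qbin q N k * y ^ Suc k = y * q ^ N * ?t N k"
      by simp
    then show ?thesis by (simp only: qbin.simps(3) distrib_left distrib_right mult.assoc)
  qed
  then have "(\<Sum>k\<le>Suc N. ?t (Suc N) k) = 1 + (\<Sum>k\<le>N. ?t N (Suc k)) + y * q ^ N * (\<Sum>k\<le>N. ?t N k)"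
    unfolding sum.atMost_Suc_shift by (simp add: sum.distrib sum_distrib_left del: qbin.simps(3))
  also have "1 + (\<Sum>k\<le>N. ?t N (Suc k)) = (\<Sum>k\<le>Suc N. ?t N k)"
    unfolding sum.atMost_Suc_shift by simp
  also have "\<dots> = (\<Sum>k\<le>N. ?t N k)" by (simp add: qbin_eq_0)
  finally show ?case using Suc by (simp add: algebra_simps)
qed simp

lemma qfac_pos: "0 < q \<Longrightarrow> q < 1 \<Longrightarrow> 0 < qfac q n"
  unfolding qfac_def by (intro prod_pos) (simp add: power_less_one_iff del: power_Suc)

lemma qfac_le_1: "0 < q \<Longrightarrow> q < 1 \<Longrightarrow> qfac q n \<le> 1"
  unfolding qfac_def by (intro prod_le_1) (simp add: power_le_one del: power_Suc)

section \<open>Termwise differentiation, divisor sums and the Euler product\<close>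

lemma summable_power_series_mult_index:
  fixes c :: "nat \<Rightarrow> real"
  assumes "\<And>x. \<bar>x\<bar> < 1 \<Longrightarrow> summable (\<lambda>N. c N * x ^ N)" "\<bar>x\<bar> < 1"
  shows "summable (\<lambda>N. real N * c N * x ^ N)"
proof -
  have "summable (\<lambda>n. diffs c n * x ^ n)"
    using termdiff_converges[of x 1 c] assms by simp
  then have "summable (\<lambda>n. x * (diffs c n * x ^ n))" by (rule summable_mult)
  then have "summable (\<lambda>n. real (Suc n) * c (Suc n) * x ^ Suc n)"
    by (simp add: diffs_def mult_ac)
  then show ?thesis by (subst (asm) summable_Suc_iff)
qed

text \<open>The operator x d/dx multiplies the N-th coefficient by N; it sends A_i to A_{i+1} and
  one moment of Jacobi's series to the next.\<close>

lemma power_series_euler_derivative: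
  fixes c :: "nat \<Rightarrow> real"
  assumes c: "\<And>x. \<bar>x\<bar> < 1 \<Longrightarrow> summable (\<lambda>N. c N * x ^ N)" and x: "0 < x" "x < 1"
  shows "((\<lambda>x. suminf (\<lambda>N. c N * x ^ N)) has_field_derivative suminf (\<lambda>N. real N * c N * x ^ N) / x) (at x)"
proof -
  have "((\<lambda>x. suminf (\<lambda>N. c N * x ^ N)) has_field_derivative suminf (\<lambda>n. diffs c n * x ^ n)) (at x)"
    by (rule termdiffs_strong'[of 1]) (use c x in auto)
  moreover have "suminf (\<lambda>N. real N * c N * x ^ N) = x * suminf (\<lambda>n. diffs c n * x ^ n)"
  proof -
    have "summable (\<lambda>N. real N * c N * x ^ N)"
      by (rule summable_power_series_mult_index) (use c x in auto)
    from suminf_split_head[OF this]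
    have "suminf (\<lambda>N. real N * c N * x ^ N) = suminf (\<lambda>n. real (Suc n) * c (Suc n) * x ^ Suc n)" by simp
    also have "\<dots> = suminf (\<lambda>n. x * (diffs c n * x ^ n))" by (simp add: diffs_def mult_ac)
    also have "\<dots> = x * suminf (\<lambda>n. diffs c n * x ^ n)"
      using termdiff_converges[of x 1 c] c x by (intro suminf_mult) simp
    finally show ?thesis .
  qed
  ultimately show ?thesis using x by simp
qed

lemma summable_index_power: "\<bar>x\<bar> < 1 \<Longrightarrow> summable (\<lambda>N. real N ^ k * x ^ N)"
proof (induction k arbitrary: x)
  case (Suc k)
  from summable_power_series_mult_index[OF Suc.IH Suc.prems] show ?case by simp
qed (simp add: summable_geometric)

lemma sigma1_0 [simp]: "sigma1 0 = 0"
  by (simp add: sigma1_def)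

lemma sigma1_le: "sigma1 m \<le> m * m"
proof (cases "m = 0")
  case False
  have "sigma1 m \<le> (\<Sum>d\<in>{1..m}. m)"
    unfolding sigma1_def
  proof (rule order_trans[OF sum_mono2])
    show "(\<Sum>d\<in>{1..m}. d) \<le> (\<Sum>d\<in>{1..m}. m)" by (intro sum_mono) auto
    show "{d. d dvd m} \<subseteq> {1..m}" using False by (auto dest: dvd_imp_le intro: Suc_leI dvd_pos_nat)
  qed auto
  then show ?thesis by simp
qed simp

lemma summable_sigma1: "\<bar>x\<bar> < 1 \<Longrightarrow> summable (\<lambda>N. real N ^ k * real (sigma1 N) * x ^ N)"
proof (rule summable_comparison_test')
  assume x: "\<bar>x\<bar> < 1"
  show "summable (\<lambda>N. real N ^ (k + 2) * \<bar>x\<bar> ^ N)" using x by (intro summable_index_power) simp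
  show "norm (real N ^ k * real (sigma1 N) * x ^ N) \<le> real N ^ (k + 2) * \<bar>x\<bar> ^ N" if "N \<ge> 0" for N
  proof -
    have "real (sigma1 N) \<le> real N ^ 2"
      using sigma1_le[of N] unfolding power2_eq_square of_nat_mult[symmetric] of_nat_le_iff .
    then have "real N ^ k * real (sigma1 N) * \<bar>x\<bar> ^ N \<le> real N ^ k * real N ^ 2 * \<bar>x\<bar> ^ N"
      by (intro mult_right_mono mult_left_mono) auto
    then show ?thesis by (simp add: abs_mult power_abs power_add power2_eq_square mult_ac)
  qed
qed

lemma Aser_eq: 
  assumes "\<bar>q\<bar> < 1"
  shows "Aser k q = suminf (\<lambda>N. real N ^ k * real (sigma1 N) * q ^ N)"
  using suminf_split_head[OF summable_sigma1[OF assms, of k]] by (simp add: Aser_def)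

lemma Aser_has_derivative:
  assumes "0 < q" "q < 1"
  shows "(Aser k has_field_derivative Aser (Suc k) q / q) (at q)"
proof -
  have "((\<lambda>q. suminf (\<lambda>N. real N ^ k * real (sigma1 N) * q ^ N)) has_field_derivative
      suminf (\<lambda>N. real N * (real N ^ k * real (sigma1 N)) * q ^ N) / q) (at q)"
    by (rule power_series_euler_derivative) (use assms summable_sigma1 in auto)
  moreover have "suminf (\<lambda>N. real N * (real N ^ k * real (sigma1 N)) * q ^ N) = Aser (Suc k) q"
    using assms by (simp add: Aser_eq mult_ac)
  moreover have "\<forall>\<^sub>F x in nhds q. x \<in> {0<..<1}"
    using assms by (intro eventually_nhds_in_open) auto
  then have "\<forall>\<^sub>F x in nhds q. suminf (\<lambda>N. real N ^ k * real (sigma1 N) * x ^ N) = Aser k x"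
    by eventually_elim (simp add: Aser_eq)
  ultimately show ?thesis using DERIV_cong_ev by fastforce
qed

text \<open>Minus the logarithm of the Euler product over 1 - q^m, given as a power series so that q
  d/dq produces A_0 termwise.\<close>

definition log_euler :: "real \<Rightarrow> real" where
  "log_euler q = suminf (\<lambda>N. real (sigma1 N) / real N * q ^ N)"

lemma summable_log_euler: "\<bar>x\<bar> < 1 \<Longrightarrow> summable (\<lambda>N. real (sigma1 N) / real N * x ^ N)"
proof (rule summable_comparison_test')
  assume x: "\<bar>x\<bar> < 1"
  show "summable (\<lambda>N. real N ^ 1 * \<bar>x\<bar> ^ N)" using x by (intro summable_index_power) simp
  show "norm (real (sigma1 N) / real N * x ^ N) \<le> real N ^ 1 * \<bar>x\<bar> ^ N" if "N \<ge> 0" for N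
  proof -
    have "real (sigma1 N) \<le> real N * real N"
      using sigma1_le[of N] unfolding of_nat_mult[symmetric] of_nat_le_iff .
    then have "real (sigma1 N) / real N \<le> real N"
      by (cases "N = 0") (auto simp: divide_simps)
    from mult_right_mono[OF this, of "\<bar>x\<bar> ^ N"] show ?thesis by (simp add: abs_mult power_abs)
  qed
qed

lemma log_euler_has_derivative:
  assumes "0 < q" "q < 1"
  shows "(log_euler has_field_derivative Aser 0 q / q) (at q)"
proof -
  have "(log_euler has_field_derivative suminf (\<lambda>N. real N * (real (sigma1 N) / real N) * q ^ N) / q) (at q)"
    unfolding log_euler_def[abs_def]
    by (rule power_series_euler_derivative) (use assms summable_log_euler in auto)
  moreover have "real N * (real (sigma1 N) / real N) = real (sigma1 N)" for N by (cases "N = 0") auto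
  ultimately show ?thesis using assms by (simp add: Aser_eq)
qed

lemma sum_inverse_divisors:
  assumes "N \<ge> 1"
  shows "(\<Sum>d | d dvd N. 1 / real d) = real (sigma1 N) / real N"
proof -
  have "(\<Sum>d | d dvd N. 1 / real d) = (\<Sum>d | d dvd N. real d / real N)"
    by (rule sum.reindex_bij_witness[of _ "\<lambda>d. N div d" "\<lambda>d. N div d"])
       (use assms in \<open>auto simp: real_of_nat_div field_simps dvd_pos_nat elim!: dvdE\<close>)
  then show ?thesis by (simp add: sigma1_def sum_divide_distrib)
qed

text \<open>Expanding -ln (1 - q^m) gives a double series of q^(m d) / d. Its terms are nonnegative,
  so it may be summed along N = m d instead, where the reciprocals of the divisors d of N add up to
  sigma(N) / N.\<close>

lemma qfac_tendsto:
  assumes q: "0 < q" "q < 1"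
  shows "qfac q \<longlonglongrightarrow> exp (- log_euler q)"
proof -
  define f where "f = (\<lambda>(N::nat, d::nat). q ^ N / real d)"
  define B where "B = (\<lambda>N::nat. {d. d dvd N})"
  define g where "g = (\<lambda>N. real (sigma1 N) / real N * q ^ N)"
  have "(g has_sum log_euler q) UNIV"
    unfolding g_def using q summable_log_euler[of q]
    by (intro sums_nonneg_imp_has_sum) (auto simp: log_euler_def)
  then have g: "(g has_sum log_euler q) {1..}"
    by (subst has_sum_cong_neutral[where T = UNIV and g = g]) (auto simp: g_def not_le)
  have inner: "((\<lambda>d. f (N, d)) has_sum g N) (B N)" if "N \<in> {1..}" for N
  proof (rule has_sum_finiteI)
    show "finite (B N)" using that by (simp add: B_def)
    have "(\<Sum>d\<in>B N. f (N, d)) = (\<Sum>d | d dvd N. 1 / real d) * q ^ N"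
      by (simp add: f_def B_def sum_distrib_right)
    then show "g N = (\<Sum>d\<in>B N. f (N, d))"
      using sum_inverse_divisors[of N] that by (simp add: g_def)
  qed
  have "f summable_on Sigma {1..} B"
    by (rule summable_on_SigmaI[OF inner]) (use g q in \<open>auto simp: f_def summable_on_def\<close>)
  from has_sum_SigmaI[OF inner g this]
  have "(f has_sum log_euler q) (Sigma {1..} B)" by simp
  also have "?this \<longleftrightarrow> ((\<lambda>(m, d). q ^ (m * d) / real d) has_sum log_euler q) (Sigma {1..} (\<lambda>_. {1..}))"
    by (rule has_sum_reindex_bij_witness[of _ "\<lambda>(m, d). (m * d, d)" "\<lambda>(N, d). (N div d, d)"])
       (auto simp: B_def f_def mult.commute elim!: dvdE)
  finally have S: "((\<lambda>(m, d). q ^ (m * d) / real d) has_sum log_euler q) (Sigma {1..} (\<lambda>_. {1..}))" .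
  have L: "((\<lambda>d. q ^ (m * d) / real d) has_sum - ln (1 - q ^ m)) {1..}" if "m \<in> {1..}" for m
  proof -
    have qm: "0 < q ^ m" "q ^ m < 1" using q that by (auto simp: power_less_one_iff)
    have "summable (\<lambda>n. (q ^ m) ^ Suc n / real (n + 1))"
    proof (rule summable_comparison_test')
      show "summable (\<lambda>n. (q ^ m) ^ n)" using qm by (intro summable_geometric) auto
      show "norm ((q ^ m) ^ Suc n / real (n + 1)) \<le> (q ^ m) ^ n" if "n \<ge> 0" for n
      proof -
        have "(q ^ m) ^ Suc n \<le> (q ^ m) ^ n * real (n + 1)"
          using qm by (simp add: mult.commute)
        then show ?thesis using qm by (simp add: field_simps del: power_Suc)
      qed
    qed
    moreover have "ln (1 - q ^ m) = suminf (\<lambda>n. - ((q ^ m) ^ Suc n / real (n + 1)))"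
    proof -
      have "(-1) ^ n * (1 / real (n + 1)) * (1 - q ^ m - 1) ^ Suc n = - ((q ^ m) ^ Suc n / real (n + 1))" for n
      proof -
        have neg: "(1 - q ^ m - 1) ^ Suc n = (-1) ^ Suc n * (q ^ m) ^ Suc n"
          unfolding power_mult_distrib[symmetric] by simp
        have sgn: "(-1::real) ^ n * (-1) ^ Suc n = -1" by (simp flip: power_mult_distrib)
        have "(-1) ^ n * (1 / real (n + 1)) * (1 - q ^ m - 1) ^ Suc n =
            ((-1) ^ n * (-1) ^ Suc n) * ((q ^ m) ^ Suc n / real (n + 1))"
          unfolding neg by (simp only: mult_ac times_divide_eq_right times_divide_eq_left mult_1_left mult_1_right)
        then show ?thesis unfolding sgn by simp
      qed
      moreover have "ln (1 - q ^ m) = suminf (\<lambda>n. (-1) ^ n * (1 / real (n + 1)) * (1 - q ^ m - 1) ^ Suc n)"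
        by (rule ln_series) (use qm in auto)
      ultimately show ?thesis by (simp only:)
    qed
    ultimately have "(\<lambda>n. (q ^ m) ^ Suc n / real (n + 1)) sums (- ln (1 - q ^ m))"
      by (simp add: suminf_minus summable_sums)
    then have "((\<lambda>n. (q ^ m) ^ Suc n / real (n + 1)) has_sum (- ln (1 - q ^ m))) UNIV"
      by (rule sums_nonneg_imp_has_sum) (use qm in auto)
    also have "?this \<longleftrightarrow> ?thesis"
      by (rule has_sum_reindex_bij_witness[of _ "\<lambda>d. d - 1" Suc]) (auto simp: power_mult power_add)
    finally show ?thesis .
  qed
  have "((\<lambda>m. - ln (1 - q ^ m)) has_sum log_euler q) {1..}"
    by (rule has_sum_SigmaD[OF S]) (use L in auto)
  also have "?this \<longleftrightarrow> ((\<lambda>m. - ln (1 - q ^ Suc m)) has_sum log_euler q) UNIV"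
    by (rule has_sum_reindex_bij_witness[of _ Suc "\<lambda>d. d - 1"]) auto
  finally have "(\<lambda>n. \<Sum>m<n. - ln (1 - q ^ Suc m)) \<longlonglongrightarrow> log_euler q"
    using has_sum_imp_sums unfolding sums_def by blast
  then have "(\<lambda>n. exp (- (\<Sum>m<n. - ln (1 - q ^ Suc m)))) \<longlonglongrightarrow> exp (- log_euler q)"
    by (intro tendsto_intros)
  moreover have "exp (- (\<Sum>m<n. - ln (1 - q ^ Suc m))) = qfac q n" for n
  proof -
    have "0 < 1 - q ^ Suc m" for m using q by (simp add: power_less_one_iff del: power_Suc)
    then show ?thesis unfolding qfac_def by (simp add: sum_negf exp_sum del: power_Suc)
  qed
  ultimately show ?thesis by simp
qed

lemma qfac_ge:
  assumes q: "0 < q" "q < 1"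
  shows "exp (- log_euler q) \<le> qfac q n"
proof (rule decseq_ge[OF _ qfac_tendsto[OF q]])
  show "decseq (qfac q)"
  proof (rule decseq_SucI)
    fix n
    have "qfac q n * (1 - q ^ Suc n) \<le> qfac q n * 1"
      using qfac_pos[OF q, of n] q by (intro mult_left_mono) auto
    then show "qfac q (Suc n) \<le> qfac q n" by (simp add: qfac_Suc)
  qed
qed

text \<open>A majorant independent of \<open>N\<close> and \<open>k\<close> for limits under the
  sum: the numerator is at most 1, and both factors of the denominator are at least the infinite
  product.\<close>

lemma qbin_bounded:
  assumes q: "0 < q" "q < 1"
  shows "\<bar>qbin q N k\<bar> \<le> exp (2 * log_euler q)"
proof (cases "k \<le> N")
  case True
  let ?E = "exp (- log_euler q)"
  have "0 < qfac q k * qfac q (N - k)" using qfac_pos[OF q] by simp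
  then have eq: "qbin q N k = qfac q N / (qfac q k * qfac q (N - k))"
    using qbin_mult_qfac[OF True, of q] by (subst nonzero_eq_divide_eq) auto
  have "?E * ?E \<le> qfac q k * qfac q (N - k)"
    using qfac_ge[OF q] qfac_pos[OF q] by (intro mult_mono) (auto intro: less_imp_le)
  then have "qbin q N k \<le> 1 / (?E * ?E)"
    unfolding eq using qfac_le_1[OF q] by (intro frac_le) auto
  also have "\<dots> = exp (2 * log_euler q)" by (simp add: exp_minus field_simps flip: exp_add)
  finally show ?thesis using qfac_pos[OF q] unfolding eq by (simp add: abs_mult abs_of_pos)
qed (simp add: qbin_eq_0)

lemma qbin_tendsto:
  assumes q: "0 < q" "q < 1" and f: "filterlim f at_top sequentially"
    and g: "filterlim g at_top sequentially" and h: "filterlim h at_top sequentially"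
    and fgh: "\<forall>\<^sub>F n in sequentially. f n = g n + h n"
  shows "(\<lambda>n. qbin q (f n) (g n)) \<longlonglongrightarrow> exp (log_euler q)"
proof -
  note lim = filterlim_compose[OF qfac_tendsto[OF q]]
  have "(\<lambda>n. qfac q (f n) / (qfac q (g n) * qfac q (h n))) \<longlonglongrightarrow>
     exp (- log_euler q) / (exp (- log_euler q) * exp (- log_euler q))"
    by (intro tendsto_intros lim f g h) auto
  moreover have "\<forall>\<^sub>F n in sequentially. qfac q (f n) / (qfac q (g n) * qfac q (h n)) = qbin q (f n) (g n)"
    using fgh
  proof eventually_elim
    case (elim n)
    have "0 < qfac q (g n) * qfac q (h n)" using qfac_pos[OF q] by simp
    then show ?case
      using qbin_mult_qfac[of "g n" "f n" q] elim by (subst nonzero_divide_eq_eq) auto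
  qed
  ultimately have "(\<lambda>n. qbin q (f n) (g n)) \<longlonglongrightarrow> exp (- log_euler q) / (exp (- log_euler q) * exp (- log_euler q))"
    by (rule Lim_transform_eventually)
  then show ?thesis by (simp add: exp_minus inverse_eq_divide)
qed

section \<open>Theta positivity and Jacobi's identity as limits of finite identities\<close>

lemma prod_lessThan_add:
  fixes g :: "nat \<Rightarrow> 'a::comm_monoid_mult"
  shows "(\<Prod>i<n + m. g i) = (\<Prod>i<n. g i) * (\<Prod>i<m. g (n + i))"
  by (induction m) (auto simp: mult_ac)

lemma prod_reflect:
  "(\<Prod>i<n. g (n - Suc i)) = (\<Prod>i<n. g i :: 'a::comm_monoid_mult)"
  by (rule prod.nat_diff_reindex)

text \<open>A finite triple product at argument -1. In the q-binomial theorem with base r^2 and 2n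
  factors, the choice y = -r / r^(2n) makes the two halves of the product equal up to sign and a
  power of r.\<close>

lemma finite_theta:
  assumes r: "0 < r" "r < 1"
  shows "(\<Prod>i<n. 1 - r ^ (2 * i + 1))\<^sup>2 =
    qbin (r\<^sup>2) (2 * n) n + (\<Sum>j<n. (-1) ^ Suc j * r ^ (Suc j)\<^sup>2 * (qbin (r\<^sup>2) (2 * n) (n - Suc j) + qbin (r\<^sup>2) (2 * n) (n + Suc j)))"
proof -
  define P where "P = (\<Prod>i<n. 1 - r ^ (2 * i + 1))"
  define t where "t k = (-1) ^ n * r ^ n\<^sup>2 * ((r\<^sup>2) ^ (k * (k - 1) div 2) * qbin (r\<^sup>2) (2 * n) k * (- (r / r ^ (2 * n))) ^ k)" for k
  have odd_prod: "(\<Prod>i<n. r ^ (2 * i + 1)) = r ^ n\<^sup>2"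
  proof (induction n)
    case (Suc n)
    have "(Suc n)\<^sup>2 = n\<^sup>2 + (2 * n + 1)" by (simp add: power2_eq_square)
    then show ?case using Suc by (simp only: prod.lessThan_Suc power_add)
  qed simp
  have "(\<Prod>i<2*n. 1 + - (r / r ^ (2 * n)) * (r\<^sup>2) ^ i) =
     (\<Prod>i<n. 1 + - (r / r ^ (2 * n)) * (r\<^sup>2) ^ i) * (\<Prod>i<n. 1 + - (r / r ^ (2 * n)) * (r\<^sup>2) ^ (n + i))"
    unfolding mult_2[of n] by (rule prod_lessThan_add)
  also have "(\<Prod>i<n. 1 + - (r / r ^ (2 * n)) * (r\<^sup>2) ^ (n + i)) = P"
    unfolding P_def
  proof (rule prod.cong[OF refl])
    fix i
    have "(r\<^sup>2) ^ (n + i) = r ^ (2 * n) * r ^ (2 * i)" by (simp add: power_mult power_add)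
    then show "1 + - (r / r ^ (2 * n)) * (r\<^sup>2) ^ (n + i) = 1 - r ^ (2 * i + 1)"
      using r by simp
  qed
  also have "(\<Prod>i<n. 1 + - (r / r ^ (2 * n)) * (r\<^sup>2) ^ i) = (\<Prod>i<n. 1 + - (r / r ^ (2 * n)) * (r\<^sup>2) ^ (n - Suc i))"
    by (rule prod_reflect[symmetric])
  also have "\<dots> = (\<Prod>i<n. (-1) * (1 - r ^ (2 * i + 1)) / r ^ (2 * i + 1))"
  proof (rule prod.cong[OF refl])
    fix i assume "i \<in> {..<n}"
    then have "2 * n = 2 * (n - Suc i) + (2 * i + 1) + 1" by auto
    then have "r ^ (2 * n) = r ^ (2 * (n - Suc i) + (2 * i + 1) + 1)" by (rule arg_cong)
    then have "r ^ (2 * n) = (r\<^sup>2) ^ (n - Suc i) * r ^ (2 * i + 1) * r"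
      by (simp only: power_add power_mult power_one_right)
    then show "1 + - (r / r ^ (2 * n)) * (r\<^sup>2) ^ (n - Suc i) = (-1) * (1 - r ^ (2 * i + 1)) / r ^ (2 * i + 1)"
      using r by (simp add: field_simps)
  qed
  also have "\<dots> = (-1) ^ n * P / r ^ n\<^sup>2"
    unfolding P_def odd_prod[symmetric] by (simp only: prod_dividef prod.distrib prod_constant card_lessThan)
  finally have "P\<^sup>2 = (-1) ^ n * r ^ n\<^sup>2 * (\<Prod>i<2*n. 1 + - (r / r ^ (2 * n)) * (r\<^sup>2) ^ i)"
    using r by (simp add: power2_eq_square flip: power_add)
  also have "\<dots> = (\<Sum>k\<le>2*n. t k)"
    unfolding q_binomial_theorem t_def sum_distrib_left ..
  finally have P: "P\<^sup>2 = (\<Sum>k\<le>2*n. t k)" .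
  \<comment> \<open>The exponent \<open>e\<close> is (k - n)^2, written without subtraction; this is
    why k = n - j - 1 and k = n + j + 1 pair up below.\<close>
  have t: "t k = (-1) ^ (n + k) * r ^ e * qbin (r\<^sup>2) (2 * n) k" if "e + 2 * n * k = k\<^sup>2 + n\<^sup>2" for k e
  proof -
    have "2 * (k * (k - 1) div 2) + k = k\<^sup>2"
      using tri_eq[of k] unfolding tri_eq_pairs by (simp add: power2_eq_square)
    then have rk: "(r\<^sup>2) ^ (k * (k - 1) div 2) * r ^ k = r ^ k\<^sup>2"
      by (simp only: power_mult[symmetric] power_add[symmetric])
    have "(- (r / r ^ (2 * n))) ^ k = (-1) ^ k * r ^ k / r ^ (2 * n * k)"
      by (simp only: power_minus[of "r / r ^ (2 * n)"] power_divide power_mult[of r "2 * n" k] times_divide_eq_right)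
    then have "t k = (-1) ^ (n + k) * (((r\<^sup>2) ^ (k * (k - 1) div 2) * r ^ k) * r ^ n\<^sup>2 / r ^ (2 * n * k)) * qbin (r\<^sup>2) (2 * n) k"
      unfolding t_def by (simp only: power_add mult_ac times_divide_eq_right times_divide_eq_left)
    then have "t k = (-1) ^ (n + k) * (r ^ k\<^sup>2 * r ^ n\<^sup>2 / r ^ (2 * n * k)) * qbin (r\<^sup>2) (2 * n) k"
      unfolding rk .
    moreover have "r ^ k\<^sup>2 * r ^ n\<^sup>2 / r ^ (2 * n * k) = r ^ e"
      using that r by (simp add: nonzero_divide_eq_eq flip: power_add)
    ultimately show ?thesis by simp
  qed
  have "(\<Sum>k\<le>2*n. t k) = (\<Sum>k\<in>{..<n} \<union> {n<..<n + Suc n}. t k) + t n"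
    by (subst sum.remove[of _ n]) (auto intro!: sum.cong)
  also have "(\<Sum>k\<in>{..<n} \<union> {n<..<n + Suc n}. t k) = (\<Sum>k<n. t k) + (\<Sum>k\<in>{n<..<n + Suc n}. t k)"
    by (rule sum.union_disjoint) auto
  also have "(\<Sum>k<n. t k) + (\<Sum>k\<in>{n<..<n + Suc n}. t k) + t n = (\<Sum>k<n. t k) + t n + (\<Sum>k\<in>{n<..<n + Suc n}. t k)"
    by simp
  also have "(\<Sum>k<n. t k) = (\<Sum>j<n. t (n - Suc j))" by (rule sum.nat_diff_reindex[symmetric])
  also have "(\<Sum>k\<in>{n<..<n + Suc n}. t k) = (\<Sum>j<n. t (n + Suc j))"
    by (rule sum.reindex_bij_witness[of _ "\<lambda>j. n + Suc j" "\<lambda>k. k - n - 1"]) auto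
  also have "t n = qbin (r\<^sup>2) (2 * n) n"
    using t[of 0 n] by (simp add: power2_eq_square)
  also have "(\<Sum>j<n. t (n - Suc j)) = (\<Sum>j<n. (-1) ^ Suc j * r ^ (Suc j)\<^sup>2 * qbin (r\<^sup>2) (2 * n) (n - Suc j))"
  proof (rule sum.cong[OF refl])
    fix j assume "j \<in> {..<n}"
    define l where "l = n - Suc j"
    have l: "n = l + Suc j" using \<open>j \<in> {..<n}\<close> by (simp add: l_def)
    have "(-1::real) ^ (n + l) = (-1) ^ Suc j"
      unfolding l by (simp add: power_add)
    then show "t (n - Suc j) = (-1) ^ Suc j * r ^ (Suc j)\<^sup>2 * qbin (r\<^sup>2) (2 * n) (n - Suc j)"
      using t[of "(Suc j)\<^sup>2" l] l by (simp add: power2_eq_square algebra_simps)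
  qed
  also have "(\<Sum>j<n. t (n + Suc j)) = (\<Sum>j<n. (-1) ^ Suc j * r ^ (Suc j)\<^sup>2 * qbin (r\<^sup>2) (2 * n) (n + Suc j))"
  proof (rule sum.cong[OF refl])
    fix j
    have "(-1::real) ^ (n + (n + Suc j)) = (-1) ^ Suc j"
      by (simp add: power_add)
    then show "t (n + Suc j) = (-1) ^ Suc j * r ^ (Suc j)\<^sup>2 * qbin (r\<^sup>2) (2 * n) (n + Suc j)"
      using t[of "(Suc j)\<^sup>2" "n + Suc j"] by (simp add: power2_eq_square algebra_simps)
  qed
  finally show ?thesis
    unfolding P[symmetric] P_def distrib_left sum.distrib by (simp only: add_ac)
qed


lemma sum_of_tendsto_suminf:
  fixes a :: "nat \<Rightarrow> nat \<Rightarrow> real"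
  assumes "\<And>j. (\<lambda>n. a j n) \<longlonglongrightarrow> b j" "\<And>j n. \<bar>a j n\<bar> \<le> M j" "summable M" "\<And>j n. n < j \<Longrightarrow> a j n = 0"
  shows "(\<lambda>n. \<Sum>j\<le>n. a j n) \<longlonglongrightarrow> suminf b"
proof -
  have "(\<lambda>n. suminf (\<lambda>j. a j n)) \<longlonglongrightarrow> suminf b"
    using tannerys_theorem[of a b sequentially M] assms by (auto intro!: always_eventually)
  moreover have "suminf (\<lambda>j. a j n) = (\<Sum>j\<le>n. a j n)" for n
    using assms(4) by (intro suminf_finite) auto
  ultimately show ?thesis by simp
qed

text \<open>Passing to the limit in \<open>finite_theta\<close> could lose strictness. It is saved
  by a uniform lower bound: \<open>P n\<close> arises from \<open>qfac r (2 * n)\<close> by omitting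
  factors at most 1, and \<open>qfac_ge\<close> bounds the latter from below.\<close>

lemma theta_pos:
  fixes r :: real
  assumes r: "0 < r" "r < 1"
  shows "0 < 1 + 2 * suminf (\<lambda>j. (-1) ^ Suc j * r ^ (Suc j)\<^sup>2)"
proof -
  define L where "L = exp (log_euler (r\<^sup>2))"
  define P where "P n = (\<Prod>i<n. 1 - r ^ (2 * i + 1))" for n
  have q: "0 < r\<^sup>2" "r\<^sup>2 < 1" using r by (auto simp: power_less_one_iff)
  define a where "a j n = (if j < n then (-1) ^ Suc j * r ^ (Suc j)\<^sup>2 *
     (qbin (r\<^sup>2) (2 * n) (n - Suc j) + qbin (r\<^sup>2) (2 * n) (n + Suc j)) else 0)" for j n
  have ev: "\<forall>\<^sub>F n in sequentially. j < n" for j :: nat by (rule eventually_gt_at_top)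
  have lims: "filterlim (\<lambda>n::nat. 2 * n) at_top sequentially" "filterlim (\<lambda>n::nat. n - k) at_top sequentially"
     "filterlim (\<lambda>n::nat. n + k) at_top sequentially" for k
    by (intro filterlim_subseq strict_monoI filterlim_minus_const_nat_at_top; simp)+
  have qb: "(\<lambda>n. qbin (r\<^sup>2) (2 * n) (n - k)) \<longlonglongrightarrow> L" "(\<lambda>n. qbin (r\<^sup>2) (2 * n) (n + k)) \<longlonglongrightarrow> L" for k
    unfolding L_def
    by (rule qbin_tendsto[OF q lims(1) lims(2)[of k] lims(3)[of k]],
        use ev[of k] in eventually_elim, simp,
        rule qbin_tendsto[OF q lims(1) lims(3)[of k] lims(2)[of k]],
        use ev[of k] in eventually_elim, simp)
  have "(\<lambda>n. a j n) \<longlonglongrightarrow> (-1) ^ Suc j * r ^ (Suc j)\<^sup>2 * (L + L)" for j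
  proof (rule Lim_transform_eventually)
    show "(\<lambda>n. (-1) ^ Suc j * r ^ (Suc j)\<^sup>2 *
     (qbin (r\<^sup>2) (2 * n) (n - Suc j) + qbin (r\<^sup>2) (2 * n) (n + Suc j))) \<longlonglongrightarrow> (-1) ^ Suc j * r ^ (Suc j)\<^sup>2 * (L + L)"
      by (intro tendsto_intros qb)
    show "\<forall>\<^sub>F n in sequentially. (-1) ^ Suc j * r ^ (Suc j)\<^sup>2 *
     (qbin (r\<^sup>2) (2 * n) (n - Suc j) + qbin (r\<^sup>2) (2 * n) (n + Suc j)) = a j n"
      using ev[of j] by eventually_elim (simp add: a_def)
  qed
  moreover have "\<bar>a j n\<bar> \<le> r ^ j * (2 * exp (2 * log_euler (r\<^sup>2)))" for j n
  proof -
    have "j \<le> (Suc j)\<^sup>2" by (simp add: power2_eq_square)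
    then have "r ^ (Suc j)\<^sup>2 \<le> r ^ j" using r by (intro power_decreasing) auto
    moreover have "\<bar>qbin (r\<^sup>2) (2 * n) (n - Suc j) + qbin (r\<^sup>2) (2 * n) (n + Suc j)\<bar> \<le> 2 * exp (2 * log_euler (r\<^sup>2))"
      using qbin_bounded[OF q, of "2 * n" "n - Suc j"] qbin_bounded[OF q, of "2 * n" "n + Suc j"] by linarith
    ultimately show ?thesis using r
      by (auto simp: a_def abs_mult power_abs simp del: power_Suc intro!: mult_mono)
  qed
  moreover have "summable (\<lambda>j. r ^ j * (2 * exp (2 * log_euler (r\<^sup>2))))"
    using r by (intro summable_mult2 summable_geometric) auto
  ultimately have "(\<lambda>n. \<Sum>j\<le>n. a j n) \<longlonglongrightarrow> suminf (\<lambda>j. (-1) ^ Suc j * r ^ (Suc j)\<^sup>2 * (L + L))"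
    by (rule sum_of_tendsto_suminf) (auto simp: a_def)
  moreover have "suminf (\<lambda>j. (-1) ^ Suc j * r ^ (Suc j)\<^sup>2 * (L + L)) = suminf (\<lambda>j. (-1) ^ Suc j * r ^ (Suc j)\<^sup>2) * (L + L)"
  proof (rule suminf_mult2[symmetric], rule summable_comparison_test')
    show "summable (\<lambda>j. r ^ j)" using r by (intro summable_geometric) auto
    show "norm ((-1) ^ Suc j * r ^ (Suc j)\<^sup>2) \<le> r ^ j" if "j \<ge> 0" for j
    proof -
      have "j \<le> (Suc j)\<^sup>2" by (simp add: power2_eq_square)
      then have "r ^ (Suc j)\<^sup>2 \<le> r ^ j" using r by (intro power_decreasing) auto
      then show ?thesis using r by (simp add: abs_mult power_abs del: power_Suc)
    qed
  qed
  moreover have "(P n)\<^sup>2 = qbin (r\<^sup>2) (2 * n) n + (\<Sum>j\<le>n. a j n)" for n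
  proof -
    have "(\<Sum>j\<le>n. a j n) = (\<Sum>j<n. a j n)" by (simp add: a_def flip: lessThan_Suc_atMost)
    then show ?thesis unfolding P_def finite_theta[OF r] by (simp add: a_def)
  qed
  ultimately have "(\<lambda>n. (P n)\<^sup>2) \<longlonglongrightarrow> L + suminf (\<lambda>j. (-1) ^ Suc j * r ^ (Suc j)\<^sup>2) * (L + L)"
    using tendsto_add[OF qb(2)[of 0]] by simp
  moreover have "(exp (- log_euler r))\<^sup>2 \<le> (P n)\<^sup>2" for n
  proof (rule power_mono)
    have "qfac r (2 * n) \<le> P n"
      unfolding P_def
    proof (induction n)
      case (Suc n)
      have "1 - r ^ Suc (Suc (2 * n)) \<le> 1" "0 \<le> 1 - r ^ Suc (2 * n)"
        using r by (auto simp: power_le_one simp del: power_Suc)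
      then have "qfac r (2 * n) * (1 - r ^ Suc (2 * n)) * (1 - r ^ Suc (Suc (2 * n))) \<le> qfac r (2 * n) * (1 - r ^ Suc (2 * n))"
        using qfac_pos[OF r, of "2 * n"] by (intro mult_right_le_one_le) (auto simp: power_le_one r less_imp_le simp del: power_Suc)
      also have "\<dots> \<le> (\<Prod>i<n. 1 - r ^ (2 * i + 1)) * (1 - r ^ Suc (2 * n))"
        using Suc \<open>0 \<le> 1 - r ^ Suc (2 * n)\<close> by (intro mult_right_mono) auto
      finally show ?case by (simp add: qfac_Suc)
    qed (simp add: qfac_def)
    then show "exp (- log_euler r) \<le> P n" using qfac_ge[OF r, of "2 * n"] by simp
  qed simp
  ultimately have "(exp (- log_euler r))\<^sup>2 \<le> L + suminf (\<lambda>j. (-1) ^ Suc j * r ^ (Suc j)\<^sup>2) * (L + L)"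
    by (intro tendsto_lowerbound) auto
  moreover have "0 < (exp (- log_euler r))\<^sup>2" by simp
  ultimately have "0 < L * (1 + 2 * suminf (\<lambda>j. (-1) ^ Suc j * r ^ (Suc j)\<^sup>2))"
    by (simp only: algebra_simps)
  moreover have "L > 0" by (simp add: L_def)
  ultimately show ?thesis using zero_less_mult_pos by blast
qed

text \<open>Differentiate the q-binomial theorem with 2n + 1 factors at the root of the middle
  factor: one summand of the product rule survives. In the expanded sum the terms n - j and n + 1 +
  j share their Gaussian binomial and have opposite signs, and their indices differ by 2j + 1, which
  is the coefficient in Jacobi's series.\<close>

lemma finite_jacobi:
  assumes q: "0 < q" "q < 1"
  shows "(qfac q n)\<^sup>2 = (\<Sum>j\<le>n. (-1) ^ j * (2 * real j + 1) * q ^ tri j * qbin q (Suc (2 * n)) (n - j))"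
proof -
  define N where "N = Suc (2 * n)"
  define y where "y = - (1 / q ^ n)"
  \<comment> \<open>The prefactor cancels sign and power of q in the derivative of the product; one
    further factor \<open>y\<close> turns y^(k-1) into y^k.\<close>
  define t where "t k = - ((-1) ^ n) * q ^ tri n * (q ^ (k * (k - 1) div 2) * qbin q N k * (real k * y ^ k))" for k
  have y0: "1 + y * q ^ n = 0" using q by (simp add: y_def)
  have pw: "(\<Prod>i<n. q ^ Suc i) = q ^ tri n" by (induction n) (auto simp: tri_Suc power_add)
  have "((\<lambda>y. \<Prod>i<N. 1 + y * q ^ i) has_field_derivative
      (\<Sum>x<N. q ^ x * (\<Prod>i\<in>{..<N} - {x}. 1 + y * q ^ i))) (at y)"
    by (rule has_field_derivative_prod) (auto intro!: derivative_eq_intros)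
  moreover have "((\<lambda>y. \<Prod>i<N. 1 + y * q ^ i) has_field_derivative
      (\<Sum>k\<le>N. q ^ (k * (k - 1) div 2) * qbin q N k * (real k * y ^ (k - 1)))) (at y)"
    unfolding q_binomial_theorem
    by (auto intro!: derivative_eq_intros sum.cong)
  ultimately have D: "(\<Sum>x<N. q ^ x * (\<Prod>i\<in>{..<N} - {x}. 1 + y * q ^ i)) =
     (\<Sum>k\<le>N. q ^ (k * (k - 1) div 2) * qbin q N k * (real k * y ^ (k - 1)))"
    by (rule DERIV_unique)
  have "(\<Sum>x<N. q ^ x * (\<Prod>i\<in>{..<N} - {x}. 1 + y * q ^ i)) = (\<Sum>x\<in>{n}. q ^ x * (\<Prod>i\<in>{..<N} - {x}. 1 + y * q ^ i))"
  proof (rule sum.mono_neutral_right)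
    show "\<forall>x\<in>{..<N} - {n}. q ^ x * (\<Prod>i\<in>{..<N} - {x}. 1 + y * q ^ i) = 0"
      using y0 by (auto simp: N_def intro!: bexI[of _ n])
  qed (auto simp: N_def)
  also have "\<dots> = q ^ n * (\<Prod>i\<in>{..<N} - {n}. 1 + y * q ^ i)" by simp
  also have "{..<N} - {n} = {..<n} \<union> {n<..<N}" by (auto simp: N_def)
  also have "(\<Prod>i\<in>{..<n} \<union> {n<..<N}. 1 + y * q ^ i) = (\<Prod>i<n. 1 + y * q ^ i) * (\<Prod>i\<in>{n<..<N}. 1 + y * q ^ i)"
    by (rule prod.union_disjoint) auto
  also have "(\<Prod>i\<in>{n<..<N}. 1 + y * q ^ i) = qfac q n"
    unfolding qfac_def
    by (rule prod.reindex_bij_witness[of _ "\<lambda>j. n + Suc j" "\<lambda>k. k - n - 1"])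
       (use q in \<open>auto simp: N_def y_def power_add power_diff field_simps\<close>)
  also have "(\<Prod>i<n. 1 + y * q ^ i) = (\<Prod>i<n. 1 + y * q ^ (n - Suc i))"
    by (rule prod_reflect[symmetric])
  also have "\<dots> = (\<Prod>i<n. (-1) * (1 - q ^ Suc i) / q ^ Suc i)"
  proof (rule prod.cong[OF refl])
    fix i assume "i \<in> {..<n}"
    then have "q ^ n = q ^ (n - Suc i) * q ^ Suc i" by (simp flip: power_add power_Suc)
    then show "1 + y * q ^ (n - Suc i) = (-1) * (1 - q ^ Suc i) / q ^ Suc i"
      using q by (simp add: y_def field_simps)
  qed
  also have "\<dots> = (-1) ^ n * qfac q n / q ^ tri n"
    unfolding qfac_def pw[symmetric] by (simp only: prod_dividef prod.distrib prod_constant card_lessThan)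
  finally have lhs: "(\<Sum>k\<le>N. q ^ (k * (k - 1) div 2) * qbin q N k * (real k * y ^ (k - 1))) =
     q ^ n * ((-1) ^ n * qfac q n / q ^ tri n * qfac q n)" unfolding D .
  have "(\<Sum>k\<le>N. t k) = - ((-1) ^ n) * q ^ tri n * y * (\<Sum>k\<le>N. q ^ (k * (k - 1) div 2) * qbin q N k * (real k * y ^ (k - 1)))"
    unfolding sum_distrib_left
  proof (rule sum.cong[OF refl])
    fix k
    have "real k * y ^ k = y * (real k * y ^ (k - 1))" by (cases k) auto
    then show "t k = - ((-1) ^ n) * q ^ tri n * y * (q ^ (k * (k - 1) div 2) * qbin q N k * (real k * y ^ (k - 1)))"
      unfolding t_def by (simp only: mult_ac)
  qed
  also have "\<dots> = (-1) ^ n * (-1) ^ n * (- (y * q ^ n)) * (qfac q n)\<^sup>2"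
    unfolding lhs using q by (simp add: power2_eq_square field_simps)
  also have "\<dots> = (qfac q n)\<^sup>2"
  proof -
    have "- (y * q ^ n) = 1" using y0 by linarith
    then show ?thesis by (simp flip: power_mult_distrib)
  qed
  finally have S: "(qfac q n)\<^sup>2 = (\<Sum>k\<le>N. t k)" ..
  have t: "t k = - ((-1) ^ (n + k)) * q ^ e * (real k * qbin q N k)" if "e + n * k = k * (k - 1) div 2 + tri n" for k e
  proof -
    have "q ^ (k * (k - 1) div 2) * q ^ tri n / q ^ (n * k) = q ^ e"
      using that q by (simp add: nonzero_divide_eq_eq flip: power_add)
    moreover have "y ^ k = (-1) ^ k / q ^ (n * k)"
      unfolding y_def by (simp add: power_minus[of "1 / q ^ n"] power_divide power_mult)
    ultimately show ?thesis unfolding t_def by (simp add: power_add mult_ac flip: times_divide_eq_right)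
  qed
  have "{..N} = {..n} \<union> {n<..N}" by (auto simp: N_def)
  then have "(\<Sum>k\<le>N. t k) = (\<Sum>k\<le>n. t k) + (\<Sum>k\<in>{n<..N}. t k)"
    by (simp add: sum.union_disjoint ivl_disj_int)
  also have "(\<Sum>k\<le>n. t k) = (\<Sum>j\<le>n. t (n - j))"
    by (rule sum.reindex_bij_witness[of _ "\<lambda>j. n - j" "\<lambda>j. n - j"]) auto
  also have "(\<Sum>k\<in>{n<..N}. t k) = (\<Sum>j\<le>n. t (n + Suc j))"
    by (rule sum.reindex_bij_witness[of _ "\<lambda>j. n + Suc j" "\<lambda>k. k - n - 1"]) (auto simp: N_def)
  also have "(\<Sum>j\<le>n. t (n - j)) + (\<Sum>j\<le>n. t (n + Suc j)) =
      (\<Sum>j\<le>n. (-1) ^ j * (2 * real j + 1) * q ^ tri j * qbin q N (n - j))"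
    unfolding sum.distrib[symmetric]
  proof (rule sum.cong[OF refl])
    fix j assume "j \<in> {..n}"
    define l where "l = n - j"
    have l: "n = l + j" using \<open>j \<in> {..n}\<close> by (simp add: l_def)
    have e1: "tri j + n * l = l * (l - 1) div 2 + tri n"
    proof -
      have "2 * (tri j + n * l + l) = 2 * (l * (l - 1) div 2 + l + tri n)"
        unfolding tri_eq_pairs[of l, symmetric] distrib_left tri_eq l by (simp add: algebra_simps)
      then show ?thesis by simp
    qed
    have e2: "tri j + n * (n + Suc j) = (n + Suc j) * (n + Suc j - 1) div 2 + tri n"
    proof -
      have "(n + Suc j) * (n + Suc j - 1) div 2 = tri (n + j)"
        by (simp add: tri_def mult.commute)
      moreover have "2 * (tri j + n * (n + Suc j)) = 2 * (tri (n + j) + tri n)"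
        unfolding distrib_left tri_eq by (simp add: algebra_simps)
      ultimately show ?thesis by simp
    qed
    have sym: "qbin q N (n + Suc j) = qbin q N l"
    proof -
      have le: "l \<le> N" "n + Suc j \<le> N" and diff: "N - l = n + Suc j" "N - (n + Suc j) = l"
        using l by (auto simp: N_def)
      have "qbin q N (n + Suc j) * (qfac q (n + Suc j) * qfac q l) = qbin q N l * (qfac q (n + Suc j) * qfac q l)"
        using qbin_mult_qfac[OF le(1), of q] qbin_mult_qfac[OF le(2), of q] unfolding diff by (simp only: mult.commute)
      moreover have "qfac q (n + Suc j) * qfac q l \<noteq> 0" using qfac_pos[OF q] by (simp add: less_imp_neq[symmetric])
      ultimately show ?thesis using mult_right_cancel by blast
    qed
    have s1: "- ((-1::real) ^ (n + l)) = - ((-1) ^ j)" "- ((-1::real) ^ (n + (n + Suc j))) = (-1) ^ j"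
      unfolding l by (simp_all add: power_add flip: power_mult_distrib)
    have "t l + t (n + Suc j) = (-1) ^ j * q ^ tri j * qbin q N l * (real (n + Suc j) - real l)"
      unfolding t[OF e1] t[OF e2] s1 sym by (simp add: right_diff_distrib mult_ac del: of_nat_add of_nat_Suc)
    also have "real (n + Suc j) - real l = 2 * real j + 1" unfolding l by simp
    finally show "t (n - j) + t (n + Suc j) = (-1) ^ j * (2 * real j + 1) * q ^ tri j * qbin q N (n - j)"
      using l by (simp add: mult_ac)
  qed
  finally show ?thesis unfolding S N_def .
qed

lemma summable_tri:
  assumes "0 < q" "q < 1"
  shows "summable (\<lambda>j. (2 * real j + 1) * q ^ tri j)"
proof (rule summable_comparison_test')
  have "summable (\<lambda>j. 2 * (real j ^ 1 * q ^ j) + real j ^ 0 * q ^ j)"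
    using assms by (intro summable_add summable_mult summable_index_power) auto
  then show "summable (\<lambda>j. (2 * real j + 1) * q ^ j)" by (simp add: algebra_simps)
  show "norm ((2 * real j + 1) * q ^ tri j) \<le> (2 * real j + 1) * q ^ j" if "j \<ge> 0" for j
    using assms power_decreasing[OF tri_ge[of j], of q] by (simp add: abs_mult)
qed

text \<open>With E the Euler product, each Gaussian binomial tends to 1/E and the left side of
  \<open>finite_jacobi\<close> to E^2, so the series equals E^3.\<close>

lemma jacobi_identity:
  assumes q: "0 < q" "q < 1"
  shows "suminf (\<lambda>j. (-1) ^ j * (2 * real j + 1) * q ^ tri j) = exp (- 3 * log_euler q)"
proof -
  define L where "L = exp (log_euler q)"
  define a where "a j n = (if j \<le> n then (-1) ^ j * (2 * real j + 1) * q ^ tri j * qbin q (Suc (2 * n)) (n - j) else 0)" for j n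
  have "(\<lambda>n. a j n) \<longlonglongrightarrow> (-1) ^ j * (2 * real j + 1) * q ^ tri j * L" for j
  proof (rule Lim_transform_eventually)
    have "(\<lambda>n. qbin q (Suc (2 * n)) (n - j)) \<longlonglongrightarrow> L"
      unfolding L_def
    proof (rule qbin_tendsto[OF q, where h = "\<lambda>n. n + Suc j"])
      show "\<forall>\<^sub>F n in sequentially. Suc (2 * n) = n - j + (n + Suc j)"
        using eventually_ge_at_top[of j] by eventually_elim simp
    qed (auto intro!: filterlim_subseq strict_monoI filterlim_minus_const_nat_at_top)
    then show "(\<lambda>n. (-1) ^ j * (2 * real j + 1) * q ^ tri j * qbin q (Suc (2 * n)) (n - j)) \<longlonglongrightarrow>
       (-1) ^ j * (2 * real j + 1) * q ^ tri j * L"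
      by (intro tendsto_intros)
    show "\<forall>\<^sub>F n in sequentially. (-1) ^ j * (2 * real j + 1) * q ^ tri j * qbin q (Suc (2 * n)) (n - j) = a j n"
      using eventually_ge_at_top[of j] by eventually_elim (simp add: a_def)
  qed
  moreover have "\<bar>a j n\<bar> \<le> (2 * real j + 1) * q ^ tri j * exp (2 * log_euler q)" for j n
    using qbin_bounded[OF q, of "Suc (2 * n)" "n - j"] q
    by (auto simp: a_def abs_mult power_abs intro!: mult_mono)
  moreover have "summable (\<lambda>j. (2 * real j + 1) * q ^ tri j * exp (2 * log_euler q))"
    using summable_tri[OF q] by (rule summable_mult2)
  ultimately have "(\<lambda>n. \<Sum>j\<le>n. a j n) \<longlonglongrightarrow> suminf (\<lambda>j. (-1) ^ j * (2 * real j + 1) * q ^ tri j * L)"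
    by (rule sum_of_tendsto_suminf) (auto simp: a_def)
  moreover have "(\<Sum>j\<le>n. a j n) = (qfac q n)\<^sup>2" for n
    unfolding finite_jacobi[OF q] by (simp add: a_def)
  moreover have "suminf (\<lambda>j. (-1) ^ j * (2 * real j + 1) * q ^ tri j * L) = suminf (\<lambda>j. (-1) ^ j * (2 * real j + 1) * q ^ tri j) * L"
  proof (rule suminf_mult2[symmetric], rule summable_comparison_test'[OF summable_tri[OF q]])
    show "norm ((-1) ^ j * (2 * real j + 1) * q ^ tri j) \<le> (2 * real j + 1) * q ^ tri j" if "j \<ge> 0" for j
      using q by (simp add: abs_mult power_abs)
  qed
  moreover have "(\<lambda>n. (qfac q n)\<^sup>2) \<longlonglongrightarrow> (exp (- log_euler q))\<^sup>2"
    by (intro tendsto_intros qfac_tendsto q)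
  ultimately have "suminf (\<lambda>j. (-1) ^ j * (2 * real j + 1) * q ^ tri j) * L = (exp (- log_euler q))\<^sup>2"
    using LIMSEQ_unique by auto
  then have "suminf (\<lambda>j. (-1) ^ j * (2 * real j + 1) * q ^ tri j) = (exp (- log_euler q))\<^sup>2 / L"
    by (simp add: L_def field_simps)
  also have "\<dots> = exp (- 3 * log_euler q)"
    unfolding L_def by (simp add: power2_eq_square flip: exp_add exp_diff)
  finally show ?thesis .
qed

text \<open>The i-fold application of q d/dq to Jacobi's series.\<close>

definition tser :: "nat \<Rightarrow> real \<Rightarrow> real" where
  "tser i q = suminf (\<lambda>j. (-1) ^ j * (2 * real j + 1) * real (tri j) ^ i * q ^ tri j)"

text \<open>Jacobi's series as an ordinary power series with coefficients at the triangular numbers,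
  the form to which termwise differentiation applies.\<close>

definition tcoef :: "nat \<Rightarrow> real" where
  "tcoef N = (if N \<in> range tri then (-1) ^ inv tri N * (2 * real (inv tri N) + 1) else 0)"

lemma inv_tri: "inv tri (tri j) = j"
  by (rule inv_f_f) (rule strict_mono_imp_inj_on[OF strict_mono_tri])

lemma tser_eq: "tser i q = suminf (\<lambda>N. real N ^ i * tcoef N * q ^ N)"
proof -
  have "suminf (\<lambda>j. real (tri j) ^ i * tcoef (tri j) * q ^ tri j) = suminf (\<lambda>N. real N ^ i * tcoef N * q ^ N)"
    by (rule suminf_mono_reindex[OF strict_mono_tri]) (simp add: tcoef_def)
  then show ?thesis by (simp add: tser_def tcoef_def inv_tri mult_ac)
qed

lemma summable_tcoef:
  assumes "\<bar>x\<bar> < 1"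
  shows "summable (\<lambda>N. real N ^ i * tcoef N * x ^ N)"
proof (rule summable_comparison_test')
  have "summable (\<lambda>N. 2 * (real N ^ Suc i * \<bar>x\<bar> ^ N) + real N ^ i * \<bar>x\<bar> ^ N)"
    using assms by (intro summable_add summable_mult summable_index_power) auto
  then show "summable (\<lambda>N. real N ^ i * (2 * real N + 1) * \<bar>x\<bar> ^ N)" by (simp add: algebra_simps)
  show "norm (real N ^ i * tcoef N * x ^ N) \<le> real N ^ i * (2 * real N + 1) * \<bar>x\<bar> ^ N" if "N \<ge> 0" for N
  proof -
    have "\<bar>tcoef N\<bar> \<le> 2 * real N + 1"
      using tri_ge by (auto simp: tcoef_def inv_tri abs_mult power_abs)
    then have "real N ^ i * \<bar>tcoef N\<bar> * \<bar>x\<bar> ^ N \<le> real N ^ i * (2 * real N + 1) * \<bar>x\<bar> ^ N"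
      by (intro mult_right_mono mult_left_mono) auto
    then show ?thesis by (simp add: abs_mult power_abs)
  qed
qed

lemma tser_has_derivative:
  assumes "0 < q" "q < 1"
  shows "(tser i has_field_derivative tser (Suc i) q / q) (at q)"
proof -
  have "((\<lambda>q. suminf (\<lambda>N. real N ^ i * tcoef N * q ^ N)) has_field_derivative
      suminf (\<lambda>N. real N * (real N ^ i * tcoef N) * q ^ N) / q) (at q)"
    by (rule power_series_euler_derivative) (use assms summable_tcoef in auto)
  then show ?thesis unfolding tser_eq[abs_def] by (simp add: mult_ac)
qed

lemma tser_0:
  assumes "0 < q" "q < 1"
  shows "tser 0 q = exp (- 3 * log_euler q)"
  using jacobi_identity[OF assms] by (simp add: tser_def)

lemma derivative_unique_on_unit_interval:
  fixes f g :: "real \<Rightarrow> real"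
  assumes "\<And>x. 0 < x \<Longrightarrow> x < 1 \<Longrightarrow> f x = g x" "0 < q" "q < 1"
    "(f has_field_derivative a) (at q)" "(g has_field_derivative b) (at q)"
  shows "a = b"
proof -
  have "(g has_field_derivative a) (at q)"
    using assms(4) by (rule has_field_derivative_transform_within_open[of _ _ _ "{0<..<1}"]) (use assms in auto)
  then show ?thesis using assms(5) by (rule DERIV_unique)
qed

text \<open>On polynomials in the A_k the formal derivation \<open>mp_D\<close> is q d/dq, because q
  A_k' = A_{k+1}.\<close>

lemma mp_eval_Aser_has_derivative:
  assumes q: "0 < q" "q < 1"
  shows "((\<lambda>q. mp_eval of_rat (\<lambda>k. Aser k q) p) has_field_derivative
     mp_eval of_rat (\<lambda>k. Aser k q) (mp_D p) / q) (at q)"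
proof -
  define A where "A = (\<lambda>k. Aser k q)"
  have mono: "mono_eval A (m - Poly_Mapping.single k 1) =
     A k ^ (Poly_Mapping.lookup m k - 1) * (\<Prod>l\<in>Poly_Mapping.keys m - {k}. A l ^ Poly_Mapping.lookup m l)"
    if "k \<in> Poly_Mapping.keys m" for m k
  proof -
    have "Poly_Mapping.keys (m - Poly_Mapping.single k 1) \<subseteq> Poly_Mapping.keys m"
      by (auto simp: in_keys_iff lookup_minus)
    then have "mono_eval A (m - Poly_Mapping.single k 1) =
       (\<Prod>l\<in>Poly_Mapping.keys m. A l ^ Poly_Mapping.lookup (m - Poly_Mapping.single k 1) l)"
      by (intro mono_eval_superset) auto
    also have "\<dots> = A k ^ (Poly_Mapping.lookup m k - 1) *
       (\<Prod>l\<in>Poly_Mapping.keys m - {k}. A l ^ Poly_Mapping.lookup (m - Poly_Mapping.single k 1) l)"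
      using that by (subst prod.remove[of _ k]) (auto simp: lookup_minus)
    also have "(\<Prod>l\<in>Poly_Mapping.keys m - {k}. A l ^ Poly_Mapping.lookup (m - Poly_Mapping.single k 1) l) =
       (\<Prod>l\<in>Poly_Mapping.keys m - {k}. A l ^ Poly_Mapping.lookup m l)"
      by (intro prod.cong) (auto simp: lookup_minus lookup_single_not_eq)
    finally show ?thesis .
  qed
  have "((\<lambda>q. mp_eval of_rat (\<lambda>k. Aser k q) p) has_field_derivative
     (\<Sum>m\<in>Poly_Mapping.keys p. of_rat (Poly_Mapping.lookup p m) *
       (\<Sum>k\<in>Poly_Mapping.keys m. (real (Poly_Mapping.lookup m k) * A k ^ (Poly_Mapping.lookup m k - 1) * (A (Suc k) / q)) *
          (\<Prod>l\<in>Poly_Mapping.keys m - {k}. A l ^ Poly_Mapping.lookup m l)))) (at q)"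
    unfolding mp_eval_def A_def
    by (intro DERIV_sum DERIV_cmult has_field_derivative_prod)
       (auto intro!: derivative_eq_intros Aser_has_derivative q)
  also have "(\<Sum>m\<in>Poly_Mapping.keys p. of_rat (Poly_Mapping.lookup p m) *
       (\<Sum>k\<in>Poly_Mapping.keys m. (real (Poly_Mapping.lookup m k) * A k ^ (Poly_Mapping.lookup m k - 1) * (A (Suc k) / q)) *
          (\<Prod>l\<in>Poly_Mapping.keys m - {k}. A l ^ Poly_Mapping.lookup m l))) = mp_eval of_rat A (mp_D p) / q"
    unfolding mp_D_def real_hom.mp_eval_simps mp_monom_def real_hom.mp_eval_single sum_divide_distrib sum_distrib_left
    by (intro sum.cong refl) (simp add: mono[unfolded One_nat_def] mult_ac)
  finally show ?thesis unfolding A_def .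
qed

text \<open>For T = E^3, q d/dq gives -3 A_0 T. Applied to -3 P T it gives -3 (D P - 3 A_0 P) T,
  which is the origin of the recursion \<open>Ppoly\<close>.\<close>

lemma tser_Ppoly:
  assumes "0 < q" "q < 1"
  shows "tser (Suc i) q = - 3 * mp_eval of_rat (\<lambda>k. Aser k q) (Ppoly (Suc i)) * tser 0 q"
  using assms
proof (induction i arbitrary: q)
  case 0
  have "((\<lambda>q. exp (- 3 * log_euler q)) has_field_derivative exp (- 3 * log_euler q) * (- 3 * (Aser 0 q / q))) (at q)"
    by (auto intro!: derivative_eq_intros log_euler_has_derivative 0)
  from derivative_unique_on_unit_interval[OF tser_0 0 tser_has_derivative[OF 0] this]
  have "tser 1 q / q = exp (- 3 * log_euler q) * (- 3 * (Aser 0 q / q))" by simp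
  then show ?case using 0 by (simp add: tser_0 real_hom.mp_eval_simps field_simps)
next
  case (Suc i)
  define E where "E = (\<lambda>p. mp_eval of_rat (\<lambda>k. Aser k q) p)"
  have one: "tser 1 q = - 3 * Aser 0 q * tser 0 q"
  proof -
    have "((\<lambda>q. exp (- 3 * log_euler q)) has_field_derivative exp (- 3 * log_euler q) * (- 3 * (Aser 0 q / q))) (at q)"
      by (auto intro!: derivative_eq_intros log_euler_has_derivative Suc.prems)
    from derivative_unique_on_unit_interval[OF tser_0 Suc.prems tser_has_derivative[OF Suc.prems] this]
    show ?thesis using Suc.prems by (simp add: tser_0 field_simps)
  qed
  have "((\<lambda>q. - 3 * mp_eval of_rat (\<lambda>k. Aser k q) (Ppoly (Suc i)) * tser 0 q) has_field_derivative
      (- 3 * E (Ppoly (Suc i))) * (tser 1 q / q) + (- 3 * (E (mp_D (Ppoly (Suc i))) / q)) * tser 0 q) (at q)"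
    unfolding E_def
    by (rule DERIV_mult'[OF DERIV_cmult[OF mp_eval_Aser_has_derivative[OF Suc.prems]]
          tser_has_derivative[OF Suc.prems, of 0, folded One_nat_def]])
  from derivative_unique_on_unit_interval[OF Suc.IH Suc.prems tser_has_derivative[OF Suc.prems] this]
  have "tser (Suc (Suc i)) q / q = (- 3 * E (Ppoly (Suc i))) * (tser 1 q / q) + (- 3 * (E (mp_D (Ppoly (Suc i))) / q)) * tser 0 q"
    by simp
  then have "tser (Suc (Suc i)) q = (- 3 * E (Ppoly (Suc i))) * tser 1 q + (- 3 * E (mp_D (Ppoly (Suc i)))) * tser 0 q"
    using Suc.prems by (simp add: field_simps)
  then show ?case
    unfolding one by (simp add: real_hom.mp_eval_simps E_def algebra_simps)
qed

section \<open>Real zeros of the deformed exponential\<close>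

lemma defexp_term_bound:
  fixes q x :: real
  assumes "0 \<le> q" "q \<le> 1"
  shows "\<bar>q ^ (n * (n - 1) div 2) * x ^ n / fact n\<bar> \<le> \<bar>x\<bar> ^ n / fact n"
proof -
  have "q ^ (n * (n - 1) div 2) * \<bar>x\<bar> ^ n \<le> 1 * \<bar>x\<bar> ^ n"
    using assms by (intro mult_right_mono power_le_one) auto
  then show ?thesis using assms
    by (simp add: abs_mult power_abs divide_right_mono del: abs_divide add: abs_divide)
qed

lemma summable_exp_div: "summable (\<lambda>n. (x::real) ^ n / fact n)"
  using summable_exp[of x] by (simp add: divide_inverse mult.commute)

lemma suminf_exp_div: "suminf (\<lambda>n. (x::real) ^ n / fact n) = exp x"
  by (simp add: exp_def divide_inverse scaleR_conv_of_real mult.commute)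

lemma summable_defexp:
  fixes q x :: real
  assumes "0 \<le> q" "q \<le> 1"
  shows "summable (\<lambda>n. q ^ (n * (n - 1) div 2) * x ^ n / fact n)"
  by (rule summable_comparison_test'[OF summable_exp_div[of "\<bar>x\<bar>"]])
     (use defexp_term_bound[OF assms] in auto)

lemma tannery_uniform:
  fixes a :: "nat \<Rightarrow> 'b \<Rightarrow> real"
  assumes "\<And>k. ((\<lambda>n. a k n) \<longlongrightarrow> b k) F" "\<forall>\<^sub>F n in F. \<forall>k. \<bar>a k n\<bar> \<le> M k" "summable M" "F \<noteq> bot"
  shows "((\<lambda>n. suminf (\<lambda>k. a k n)) \<longlongrightarrow> suminf b) F"
proof -
  have "eventually (\<lambda>(k,n). norm (a k n) \<le> M k) (at_top \<times>\<^sub>F F)"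
    unfolding eventually_prod_filter using assms(2)
    by (intro exI[of _ "\<lambda>_. True"] exI[of _ "\<lambda>n. \<forall>k. \<bar>a k n\<bar> \<le> M k"]) auto
  from tannerys_theorem[OF assms(1) this assms(3,4)] show ?thesis by blast
qed

text \<open>Joint continuity in both arguments, needed because the counting argument lets
  \<open>q\<close> vary.\<close>

lemma tendsto_defexp:
  assumes Q: "(Q \<longlongrightarrow> q0) F" and g: "(g \<longlongrightarrow> x0) F" and ev: "\<forall>\<^sub>F t in F. 0 \<le> Q t \<and> Q t \<le> 1" and F: "F \<noteq> bot"
  shows "((\<lambda>t. defexp (Q t) (g t)) \<longlongrightarrow> defexp q0 x0) F"
  unfolding defexp_def
proof (rule tannery_uniform[OF _ _ _ F])
  show "((\<lambda>t. Q t ^ (n * (n - 1) div 2) * g t ^ n / fact n) \<longlongrightarrow> q0 ^ (n * (n - 1) div 2) * x0 ^ n / fact n) F" for n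
    by (intro tendsto_intros Q g) auto
  show "summable (\<lambda>n. (\<bar>x0\<bar> + 1) ^ n / fact n)" by (rule summable_exp_div)
  have "\<forall>\<^sub>F t in F. \<bar>g t\<bar> < \<bar>x0\<bar> + 1"
    by (rule order_tendstoD(2)[OF tendsto_rabs[OF g]]) simp
  then show "\<forall>\<^sub>F t in F. \<forall>n. \<bar>Q t ^ (n * (n - 1) div 2) * g t ^ n / fact n\<bar> \<le> (\<bar>x0\<bar> + 1) ^ n / fact n"
    using ev
  proof eventually_elim
    case (elim t)
    show ?case
    proof
      fix n
      have "\<bar>Q t ^ (n * (n - 1) div 2) * g t ^ n / fact n\<bar> \<le> \<bar>g t\<bar> ^ n / fact n"
        using elim by (intro defexp_term_bound) auto
      also have "\<dots> \<le> (\<bar>x0\<bar> + 1) ^ n / fact n"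
        using elim by (intro divide_right_mono power_mono) auto
      finally show "\<bar>Q t ^ (n * (n - 1) div 2) * g t ^ n / fact n\<bar> \<le> (\<bar>x0\<bar> + 1) ^ n / fact n" .
    qed
  qed
qed

text \<open>For x in [-1/2, 0) one has |f(x) - 1| <= exp |x| - 1 <= |x| + |x|^2 <= 3/4. This
  zero-free half-line anchors the descent for the separation of zeros and the counts.\<close>

lemma defexp_pos:
  assumes q: "0 < q" "q < 1" and x: "x \<ge> - 1 / 2"
  shows "defexp q x > 0"
proof -
  let ?t = "\<lambda>n. q ^ (n * (n - 1) div 2) * x ^ n / fact n"
  have sm: "summable ?t" using q by (intro summable_defexp) auto
  have split: "defexp q x = suminf (\<lambda>n. ?t (Suc n)) + 1"
    unfolding defexp_def using suminf_split_head[OF sm] by simp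
  have sm': "summable (\<lambda>n. ?t (Suc n))" using sm by (subst summable_Suc_iff)
  show ?thesis
  proof (cases "x \<ge> 0")
    case True
    have "0 \<le> suminf (\<lambda>n. ?t (Suc n))"
      using True q by (intro suminf_nonneg[OF sm']) auto
    then show ?thesis unfolding split by linarith
  next
    case False
    have sme: "summable (\<lambda>n. \<bar>x\<bar> ^ Suc n / fact (Suc n))"
      using summable_exp_div[of "\<bar>x\<bar>"] by (subst summable_Suc_iff)
    have "\<bar>suminf (\<lambda>n. ?t (Suc n))\<bar> \<le> suminf (\<lambda>n. \<bar>x\<bar> ^ Suc n / fact (Suc n))"
      using norm_suminf_le[of "\<lambda>n. ?t (Suc n)", OF _ sme] defexp_term_bound[of q "Suc _" x] q
      by (simp only: real_norm_def)
    also have "\<dots> = exp \<bar>x\<bar> - 1"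
      using suminf_split_head[OF summable_exp_div[of "\<bar>x\<bar>"]] by (simp add: suminf_exp_div)
    also have "exp \<bar>x\<bar> \<le> 1 + \<bar>x\<bar> + \<bar>x\<bar>\<^sup>2" using False x by (intro exp_bound) auto
    also have "\<bar>x\<bar>\<^sup>2 \<le> \<bar>x\<bar> * (1/2)" unfolding power2_eq_square using False x by (intro mult_left_mono) auto
    finally show ?thesis unfolding split using False x by linarith
  qed
qed


lemma defexp_has_derivative:
  assumes "0 < q" "q < 1"
  shows "(defexp q has_field_derivative defexp q (q * x)) (at x)"
proof -
  define c where "c n = q ^ (n * (n - 1) div 2) / fact n" for n
  have eq: "defexp q x = suminf (\<lambda>n. c n * x ^ n)" for x
    by (simp add: defexp_def c_def)
  have "((\<lambda>x. suminf (\<lambda>n. c n * x ^ n)) has_field_derivative suminf (\<lambda>n. diffs c n * x ^ n)) (at x)"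
    by (rule termdiffs_strong_converges_everywhere) (use summable_defexp[of q] assms in \<open>simp add: c_def\<close>)
  moreover have "diffs c n * x ^ n = c n * (q * x) ^ n" for n
  proof -
    have "q ^ (Suc n * (Suc n - 1) div 2) = q ^ (n * (n - 1) div 2) * q ^ n"
      unfolding pairs_Suc by (simp add: power_add)
    then have "c (Suc n) = q ^ (n * (n - 1) div 2) * q ^ n / (real (Suc n) * fact n)"
      unfolding c_def by simp
    then show ?thesis by (simp add: diffs_def c_def power_mult_distrib del: of_nat_Suc)
  qed
  ultimately show ?thesis using assms unfolding eq[abs_def] by simp
qed

lemma defexp_continuous: "0 < q \<Longrightarrow> q < 1 \<Longrightarrow> continuous_on S (defexp q)"
  by (meson DERIV_continuous_on defexp_has_derivative has_field_derivative_at_within)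

lemma defexp_zero_less: "0 < q \<Longrightarrow> q < 1 \<Longrightarrow> defexp q x = 0 \<Longrightarrow> x < - 1 / 2"
  using defexp_pos[of q x] by force

section \<open>Separation and simplicity of the zeros\<close>

lemma defexp_rolle:
  assumes "0 < q" "q < 1" "y < x" "defexp q y = 0" "defexp q x = 0"
  obtains w where "y < w" "w < x" "defexp q (q * w) = 0"
proof -
  obtain w where "y < w" "w < x" "defexp q x - defexp q y = (x - y) * defexp q (q * w)"
    using MVT2[OF assms(3), of "defexp q" "\<lambda>x. defexp q (q * x)"] defexp_has_derivative[OF assms(1,2)] by blast
  then show thesis using that assms by auto
qed

text \<open>If \<open>y < x\<close> violated the conclusion, two applications of Rolle's theorem to \<open>f'(x) = f(q x)\<close>
  would give another violating pair closer to the origin by the factor \<open>q\<close>.\<close>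

lemma defexp_zeros_separated:
  assumes q: "0 < q" "q < 1" and "y < x" "defexp q y = 0" "defexp q x = 0"
  shows "q * y < x"
proof -
  \<comment> \<open>\<open>n\<close> bounds how many factors q are needed to bring \<open>y\<close>
    into the zero-free half-line; the violating pair passed to the induction hypothesis is q w, q
    w'.\<close>
  have sep: "q * y < x" if "y \<ge> - (1 / 2) / q ^ n" "y < x" "defexp q y = 0" "defexp q x = 0" for n y x
    using that
  proof (induction n arbitrary: y x)
    case 0
    then show ?case using defexp_zero_less[OF q, of y] by simp
  next
    case (Suc n)
    show ?case
    proof (rule ccontr)
      assume "\<not> q * y < x"
      then have v: "x \<le> q * y" by simp
      obtain w where w: "y < w" "w < x" "defexp q (q * w) = 0"
        using defexp_rolle[OF q Suc.prems(2-4)] by blast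
      have z: "q * y < q * w" "q * w < q * x" using w q by auto
      \<comment> \<open>The assumed violation puts the zero \<open>x\<close> to the left of the zero
        q w, so Rolle's theorem applies a second time.\<close>
      then have "x < q * w" using v by simp
      then obtain w' where w': "x < w'" "w' < q * w" "defexp q (q * w') = 0"
        using defexp_rolle[OF q _ Suc.prems(4) w(3)] by blast
      have z': "q * x < q * w'" "q * w' < q * (q * w)" using w' q by auto
      have "q * (- (1 / 2) / q ^ Suc n) \<le> q * y" using Suc.prems(1) q by (intro mult_left_mono) auto
      moreover have "q * (- (1 / 2) / q ^ Suc n) = - (1 / 2) / q ^ n" using q by (simp add: field_simps)
      ultimately have "- (1 / 2) / q ^ n \<le> q * w" using z by linarith
      from Suc.IH[OF this _ w(3) w'(3)] z z' show False by simp
    qed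
  qed
  obtain n where "(1 / q) ^ n > - 2 * y"
    using real_arch_pow[of "1 / q" "- 2 * y"] q by auto
  then have "y \<ge> - (1 / 2) / q ^ n" by (simp add: power_one_over field_simps)
  then show ?thesis using sep assms by blast
qed

text \<open>The derivative at \<open>z\<close> is f(q z); were it zero, z and q z would be zeros
  with ratio exactly 1/q.\<close>

lemma defexp_zero_simple:
  assumes q: "0 < q" "q < 1" and z: "defexp q z = 0"
  shows "defexp q (q * z) \<noteq> 0"
proof
  assume "defexp q (q * z) = 0"
  moreover have "z < q * z" using defexp_zero_less[OF q z] q by simp
  ultimately show False using defexp_zeros_separated[OF q _ z] by blast
qed

lemma defexp_same_sign:
  assumes q: "0 < q" "q < 1" and "a \<le> b" "\<And>x. a \<le> x \<Longrightarrow> x \<le> b \<Longrightarrow> defexp q x \<noteq> 0"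
  shows "0 < defexp q a * defexp q b"
proof (rule ccontr)
  assume "\<not> 0 < defexp q a * defexp q b"
  then consider "defexp q a \<le> 0" "0 \<le> defexp q b" | "defexp q b \<le> 0" "0 \<le> defexp q a"
    by (metis linorder_le_cases linorder_not_le mult_neg_neg mult_pos_pos order_le_imp_less_or_eq mult_zero_left mult_zero_right order_refl)
  then show False
  proof cases
    case 1
    then show False using IVT'[of "defexp q" a 0 b] assms defexp_continuous[OF q] by blast
  next
    case 2
    then show False using IVT2'[of "defexp q" b 0 a] assms defexp_continuous[OF q] by blast
  qed
qed

lemma defexp_sign_change:
  assumes q: "0 < q" "q < 1" and z: "s < z" "z < t" "defexp q z = 0"
    and only: "\<And>x. s \<le> x \<Longrightarrow> x \<le> t \<Longrightarrow> defexp q x = 0 \<Longrightarrow> x = z"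
  shows "defexp q s * defexp q t < 0"
proof -
  note D = defexp_has_derivative[OF q, of z]
  have left: "0 < defexp q s * defexp q (z - h)" if "0 < h" "h < z - s" for h
  proof (rule defexp_same_sign[OF q])
    show "defexp q x \<noteq> 0" if "s \<le> x" "x \<le> z - h" for x
      using only[of x] that \<open>0 < h\<close> z by auto
  qed (use that in simp)
  have right: "0 < defexp q (z + h) * defexp q t" if "0 < h" "h < t - z" for h
  proof (rule defexp_same_sign[OF q])
    show "defexp q x \<noteq> 0" if "z + h \<le> x" "x \<le> t" for x
      using only[of x] that \<open>0 < h\<close> z by auto
  qed (use that in simp)
  consider "0 < defexp q (q * z)" | "defexp q (q * z) < 0"
    using defexp_zero_simple[OF q z(3)] by linarith
  then show ?thesis
  proof cases
    case 1
    obtain d where d: "d > 0" "\<And>h. 0 < h \<Longrightarrow> h < d \<Longrightarrow> 0 < defexp q (z + h)"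
      using DERIV_pos_inc_right[OF D 1] z(3) by auto
    obtain e where e: "e > 0" "\<And>h. 0 < h \<Longrightarrow> h < e \<Longrightarrow> defexp q (z - h) < 0"
      using DERIV_pos_inc_left[OF D 1] z(3) by auto
    obtain h where h: "0 < h" "h < min (min d e) (min (z - s) (t - z))"
      using dense[of 0 "min (min d e) (min (z - s) (t - z))"] d e z by auto
    have "defexp q s < 0" using left[of h] e(2)[of h] h by (auto simp: zero_less_mult_iff)
    moreover have "0 < defexp q t" using right[of h] d(2)[of h] h by (auto simp: zero_less_mult_iff)
    ultimately show ?thesis by (rule mult_neg_pos)
  next
    case 2
    obtain d where d: "d > 0" "\<And>h. 0 < h \<Longrightarrow> h < d \<Longrightarrow> defexp q (z + h) < 0"
      using DERIV_neg_dec_right[OF D 2] z(3) by auto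
    obtain e where e: "e > 0" "\<And>h. 0 < h \<Longrightarrow> h < e \<Longrightarrow> 0 < defexp q (z - h)"
      using DERIV_neg_dec_left[OF D 2] z(3) by auto
    obtain h where h: "0 < h" "h < min (min d e) (min (z - s) (t - z))"
      using dense[of 0 "min (min d e) (min (z - s) (t - z))"] d e z by auto
    have "0 < defexp q s" using left[of h] e(2)[of h] h by (auto simp: zero_less_mult_iff)
    moreover have "defexp q t < 0" using right[of h] d(2)[of h] h by (auto simp: zero_less_mult_iff)
    ultimately show ?thesis by (rule mult_pos_neg)
  qed
qed

lemma defexp_zero_between:
  assumes q: "0 < q" "q < 1" and "a < b" "defexp q a * defexp q b < 0"
  obtains z where "a < z" "z < b" "defexp q z = 0"
proof -
  have "\<exists>x. a \<le> x \<and> x \<le> b \<and> defexp q x = 0"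
    using defexp_same_sign[OF q, of a b] assms(3,4) by fastforce
  then obtain x where x: "a \<le> x" "x \<le> b" "defexp q x = 0" by blast
  moreover have "x \<noteq> a" "x \<noteq> b" using assms(4) x by auto
  ultimately show thesis using that by force
qed

section \<open>Counting zeros by sign changes\<close>

definition zcount :: "real \<Rightarrow> real \<Rightarrow> nat" where
  "zcount q R = card {x. - R < x \<and> defexp q x = 0}"

text \<open>Zeros lie below -1/2 and have ratio above 1/q, so any two are at least (1 - q)/2
  apart.\<close>

lemma finite_defexp_zeros:
  assumes q: "0 < q" "q < 1"
  shows "finite {x. - R < x \<and> defexp q x = 0}"
proof -
  let ?S = "{x. - R < x \<and> defexp q x = 0}"
  have sep: "(1 - q) / 2 \<le> \<bar>x - y\<bar>" if "y < x" "defexp q y = 0" "defexp q x = 0" for x y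
  proof -
    have "q * y < x" by (rule defexp_zeros_separated[OF q that])
    moreover have "(1 - q) * y < (1 - q) * (- 1 / 2)"
      using defexp_zero_less[OF q that(2)] q by (intro mult_strict_left_mono) auto
    ultimately show ?thesis using that by (simp add: algebra_simps)
  qed
  have "uniform_discrete ?S"
  proof (rule uniformI2)
    show "0 < (1 - q) / 2" using q by simp
    fix x y assume xy: "x \<in> ?S" "y \<in> ?S" "x \<noteq> y"
    show "(1 - q) / 2 \<le> dist x y"
    proof (cases "y < x")
      case True
      then show ?thesis using sep[of y x] xy by (simp add: dist_real_def)
    next
      case False
      then show ?thesis using sep[of x y] xy by (simp add: dist_real_def abs_minus_commute)
    qed
  qed
  moreover have "bounded ?S"
  proof (rule bounded_subset[of "{-R..0}"])
    show "?S \<subseteq> {-R..0}" using defexp_zero_less[OF q] by force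
  qed simp
  ultimately show ?thesis using uniform_discrete_finite_iff by blast
qed

lemma zcount_half: "0 < q \<Longrightarrow> q < 1 \<Longrightarrow> R \<le> 1 / 2 \<Longrightarrow> zcount q R = 0"
  unfolding zcount_def using defexp_zero_less[of q] by (fastforce intro: card_eq_0_iff[THEN iffD2])

lemma zcount_split:
  assumes q: "0 < q" "q < 1" and "a < b" "defexp q (- a) \<noteq> 0"
  shows "zcount q b = zcount q a + card {x. - b < x \<and> x < - a \<and> defexp q x = 0}"
proof -
  let ?A = "{x. - a < x \<and> defexp q x = 0}" and ?B = "{x. - b < x \<and> x < - a \<and> defexp q x = 0}"
  have eq: "{x. - b < x \<and> defexp q x = 0} = ?A \<union> ?B"
    using assms(3,4) by (auto simp: not_less order_le_less)
  have "finite ?B"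
    by (rule finite_subset[OF _ finite_defexp_zeros[OF q, of b]]) auto
  then show ?thesis
    unfolding zcount_def eq by (intro card_Un_disjoint finite_defexp_zeros[OF q]) auto
qed

text \<open>A segment whose ends have ratio at most 1/q holds at most one zero, which is simple, so
  the signs at the ends decide.\<close>

lemma zcount_step:
  assumes q: "0 < q" "q < 1" and ab: "0 < a" "a < b" "q * b \<le> a"
    and nz: "defexp q (- a) \<noteq> 0" "defexp q (- b) \<noteq> 0"
  shows "zcount q b = zcount q a + (if defexp q (- a) * defexp q (- b) < 0 then 1 else 0)"
proof -
  let ?Z = "{x. - b < x \<and> x < - a \<and> defexp q x = 0}"
  have uniq: "x = y" if "x \<in> ?Z" "y \<in> ?Z" for x y
  proof -
    have False if "x \<in> ?Z" "y \<in> ?Z" "y < x" for x y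
    proof -
      have "q * y < x" using defexp_zeros_separated[OF q] that by blast
      moreover have "q * - b < q * y" using that q by (intro mult_strict_left_mono) auto
      ultimately show False using that ab by auto
    qed
    then show ?thesis using that by (meson linorder_neqE_linordered_idom)
  qed
  have "card ?Z = (if defexp q (- a) * defexp q (- b) < 0 then 1 else 0)"
  proof (cases "?Z = {}")
    case True
    then have "\<not> defexp q (- b) * defexp q (- a) < 0"
      using defexp_zero_between[OF q, of "- b" "- a"] ab by auto
    then show ?thesis unfolding True by (simp add: mult.commute)
  next
    case False
    then obtain z where z: "z \<in> ?Z" by blast
    then have "?Z = {z}" using uniq by blast
    moreover have "defexp q (- b) * defexp q (- a) < 0"
    proof (rule defexp_sign_change[OF q])
      show "x = z" if "- b \<le> x" "x \<le> - a" "defexp q x = 0" for x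
        using that nz z uniq[of x z] by (auto simp: order_le_less)
    qed (use z in auto)
    ultimately show ?thesis by (simp add: mult.commute)
  qed
  then show ?thesis using zcount_split[OF q ab(2) nz(1)] by simp
qed

text \<open>Consecutive separating radii have ratio slightly above 1/q, beyond the reach of
  \<open>zcount_step\<close>. Up to ratio 1/q^2 there are at most two zeros, and opposite signs at
  the ends exclude 0 and 2.\<close>

lemma zcount_double_step:
  assumes q: "0 < q" "q < 1" and ab: "0 < a" "a < b" "q\<^sup>2 * b \<le> a"
    and sgn: "defexp q (- b) * defexp q (- a) < 0"
  shows "zcount q b = Suc (zcount q a)"
proof -
  let ?Z = "{x. - b < x \<and> x < - a \<and> defexp q x = 0}"
  have three: False if "x \<in> ?Z" "y \<in> ?Z" "w \<in> ?Z" "w < y" "y < x" for x y w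
  proof -
    have "q * y < x" "q * w < y" using defexp_zeros_separated[OF q] that by blast+
    moreover from this(2) have "q * (q * w) < q * y" using q by simp
    moreover have "q\<^sup>2 * - b < q\<^sup>2 * w" using that q by (intro mult_strict_left_mono) auto
    ultimately show False using that ab by (auto simp: power2_eq_square)
  qed
  have two: False if "x \<in> ?Z" "y \<in> ?Z" "y < x" for x y
  proof -
    obtain c where c: "y < c" "c < x" using dense[OF \<open>y < x\<close>] by blast
    have nz: "defexp q (- b) \<noteq> 0" "defexp q (- a) \<noteq> 0" using sgn by auto
    have only: "w = x \<or> w = y" if "- b \<le> w" "w \<le> - a" "defexp q w = 0" for w
    proof -
      have "w \<in> ?Z" using that nz by (auto simp: order_le_less)
      then show ?thesis
        using three[of x y w] three[of x w y] three[of w x y] \<open>x \<in> ?Z\<close> \<open>y \<in> ?Z\<close> \<open>y < x\<close>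
        by (meson linorder_neqE_linordered_idom)
    qed
    have "defexp q (- b) * defexp q c < 0"
    proof (rule defexp_sign_change[OF q, of _ y])
      show "w = y" if "- b \<le> w" "w \<le> c" "defexp q w = 0" for w
        using only[of w] that c \<open>x \<in> ?Z\<close> by auto
    qed (use that c in auto)
    moreover have "defexp q c * defexp q (- a) < 0"
    proof (rule defexp_sign_change[OF q, of _ x])
      show "w = x" if "c \<le> w" "w \<le> - a" "defexp q w = 0" for w
        using only[of w] that c \<open>y \<in> ?Z\<close> by auto
    qed (use that c in auto)
    ultimately show False using sgn
      by (smt (verit, ccfv_threshold) mult_less_0_iff)
  qed
  obtain z where z: "- b < z" "z < - a" "defexp q z = 0"
    using defexp_zero_between[OF q _ sgn] ab by auto
  have "?Z = {z}"
    using z two by (auto, metis (mono_tags, lifting) linorder_neqE_linordered_idom mem_Collect_eq)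
  then have "card ?Z = 1" by simp
  moreover have "defexp q (- a) \<noteq> 0" using sgn by auto
  ultimately show ?thesis using zcount_split[OF q ab(2)] by simp
qed

text \<open>\<open>q < r\<close> keeps every cell within the reach of \<open>zcount_step\<close>,
  and the last grid point lies in the zero-free half-line. The count thus depends on finitely many
  signs only.\<close>

lemma zcount_grid:
  assumes q: "0 < q" "q < 1" and r: "q < r" "r < 1" and R: "0 < R" "R * r ^ m \<le> 1 / 2"
    and nz: "\<And>i. i \<le> m \<Longrightarrow> defexp q (- (R * r ^ i)) \<noteq> 0"
  shows "zcount q R = card {i. i < m \<and> defexp q (- (R * r ^ Suc i)) * defexp q (- (R * r ^ i)) < 0}"
proof -
  have "zcount q R = zcount q (R * r ^ n) +
      card {i. i < n \<and> defexp q (- (R * r ^ Suc i)) * defexp q (- (R * r ^ i)) < 0}" if "n \<le> m" for n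
    using that
  proof (induction n)
    case (Suc n)
    have pos: "0 < R * r ^ n" using R r q by simp
    have "q * (R * r ^ n) \<le> r * (R * r ^ n)" using pos r by (intro mult_right_mono) auto
    then have "zcount q (R * r ^ n) = zcount q (R * r ^ Suc n) +
        (if defexp q (- (R * r ^ Suc n)) * defexp q (- (R * r ^ n)) < 0 then 1 else 0)"
    proof (intro zcount_step[OF q] nz)
      show "0 < R * r ^ Suc n" "R * r ^ Suc n < R * r ^ n" using pos r q by (simp_all add: mult_less_cancel_left_pos R)
    qed (use Suc.prems in \<open>auto simp: mult_ac\<close>)
    moreover have "{i. i < Suc n \<and> defexp q (- (R * r ^ Suc i)) * defexp q (- (R * r ^ i)) < 0} =
        {i. i < n \<and> defexp q (- (R * r ^ Suc i)) * defexp q (- (R * r ^ i)) < 0} \<union>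
        (if defexp q (- (R * r ^ Suc n)) * defexp q (- (R * r ^ n)) < 0 then {n} else {})"
      by (auto simp: less_Suc_eq)
    ultimately show ?case using Suc by (auto simp: card_insert_if)
  qed simp
  from this[of m] show ?thesis using zcount_half[OF q R(2)] by simp
qed

text \<open>The number of zeros to the right grows strictly from one zero to the next on its left,
  so the description in \<open>defexp_zero\<close> has at most one solution.\<close>

lemma defexp_zero_eqI:
  assumes q: "0 < q" "q < 1" and z: "defexp q z = 0" "zcount q (- z) = k - 1"
  shows "defexp_zero q k = z"
  unfolding defexp_zero_def
proof (rule the_equality)
  have set: "{y. defexp q y = 0 \<and> x < y} = {y. - (- x) < y \<and> defexp q y = 0}" for x by auto
  show "defexp q z = 0 \<and> card {y. defexp q y = 0 \<and> z < y} = k - 1"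
    using z unfolding set zcount_def by simp
  fix x assume "defexp q x = 0 \<and> card {y. defexp q y = 0 \<and> x < y} = k - 1"
  then have x: "defexp q x = 0" "zcount q (- x) = k - 1" unfolding set zcount_def by auto
  have less: "zcount q (- u) < zcount q (- v)" if "v < u" "defexp q u = 0" for u v
    unfolding zcount_def
    by (rule psubset_card_mono[OF finite_defexp_zeros[OF q]]) (use that in auto)
  show "x = z"
    using less[of x z] less[of z x] x z by (metis less_irrefl linorder_neqE_linordered_idom)
qed

section \<open>The series of f around its term of index k - 1\<close>

definition Gf :: "real \<Rightarrow> real \<Rightarrow> nat \<Rightarrow> real" where
  "Gf y x j = y ^ j / (\<Prod>i<j. 1 + real i * x)"

text \<open>With \<open>y\<close> for 1 + a(x) x^2, \<open>Gf\<close> is G_j whereas this is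
  H_{j+1}: as in \<open>hcoef\<close>, \<open>j\<close> counts factors.\<close>

definition Hf :: "real \<Rightarrow> real \<Rightarrow> nat \<Rightarrow> real" where
  "Hf y x j = (\<Prod>i<j. 1 - real (Suc i) * x) / y ^ j"

definition Phi :: "real \<Rightarrow> real \<Rightarrow> real \<Rightarrow> real" where
  "Phi q y x = suminf (\<lambda>j. (-1) ^ Suc j * q ^ tri j * (Gf y x (Suc j) - Hf y x j))"

text \<open>The quadratic exponent absorbs geometric growth in \<open>j\<close>; the termwise bounds
  C E^j of the expansion rely on this.\<close>

lemma summable_superexponential:
  fixes q E :: real
  assumes "0 < q" "q < 1" "0 < E"
  shows "summable (\<lambda>j. q ^ tri j * E ^ j)"
proof -
  have "(\<lambda>n. q ^ Suc n) \<longlonglongrightarrow> 0"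
    using LIMSEQ_Suc[OF LIMSEQ_power_zero[of q]] assms by (simp del: power_Suc)
  then have "(\<lambda>n. E * q ^ Suc n) \<longlonglongrightarrow> E * 0"
    by (intro tendsto_mult tendsto_const)
  then have "\<forall>\<^sub>F n in sequentially. E * q ^ Suc n < 1 / 2"
    by (rule order_tendstoD(2)) simp
  then obtain N where N: "\<And>n. n \<ge> N \<Longrightarrow> E * q ^ Suc n < 1 / 2"
    by (auto simp: eventually_sequentially)
  show ?thesis
  proof (rule summable_ratio_test[of "1 / 2" N])
    fix n assume "N \<le> n"
    have pos: "0 < q ^ tri n * E ^ n" using assms by simp
    have "q ^ tri (Suc n) * E ^ Suc n = (E * q ^ Suc n) * (q ^ tri n * E ^ n)"
      by (simp add: tri_Suc power_add mult_ac)
    also have "\<dots> \<le> 1 / 2 * (q ^ tri n * E ^ n)"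
      using N[OF \<open>N \<le> n\<close>] pos by (intro mult_right_mono) auto
    finally show "norm (q ^ tri (Suc n) * E ^ Suc n) \<le> 1 / 2 * norm (q ^ tri n * E ^ n)"
      using assms pos by (simp add: abs_mult del: power_Suc)
  qed simp
qed

lemma Gf_abs_le: "0 \<le> x \<Longrightarrow> 0 < y \<Longrightarrow> \<bar>Gf y x j\<bar> \<le> y ^ j"
proof -
  assume x: "0 \<le> x" and y: "0 < y"
  have "1 \<le> (\<Prod>i<j. 1 + real i * x)" using x by (intro prod_ge_1) auto
  then show ?thesis using y unfolding Gf_def by (simp add: divide_le_eq mult_left_le)
qed

text \<open>At x = 1/(m + 1) the factors lie in [0, 1] up to i = m, where one vanishes; the large
  negative ones come only after it.\<close>

lemma Hf_prod_abs_le: "\<bar>\<Prod>i<j. 1 - real (Suc i) * (1 / real (Suc m))\<bar> \<le> 1"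
proof (cases "j \<le> m")
  case True
  have "\<bar>1 - real (Suc i) * (1 / real (Suc m))\<bar> \<le> 1" if "i < j" for i
  proof -
    have "real (Suc i) * (1 / real (Suc m)) \<le> 1" using that True by (simp add: divide_le_eq)
    then show ?thesis by (simp add: abs_le_iff del: of_nat_Suc)
  qed
  then show ?thesis unfolding abs_prod by (intro prod_le_1) auto
next
  case False
  then have "(\<Prod>i<j. 1 - real (Suc i) * (1 / real (Suc m))) = 0"
    by (intro prod_zero) (auto intro!: bexI[of _ m])
  then show ?thesis by (simp only: abs_zero zero_le_one)
qed

lemma Hf_abs_le: "0 < y \<Longrightarrow> \<bar>Hf y (1 / real (Suc m)) j\<bar> \<le> (1 / y) ^ j"
  unfolding Hf_def using Hf_prod_abs_le[where j = j and m = m]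
  by (simp add: power_one_over divide_right_mono del: of_nat_Suc abs_divide add: abs_divide)

lemma Hf_eq_0: "m < j \<Longrightarrow> Hf y (1 / real (Suc m)) j = 0"
  unfolding Hf_def by (auto intro!: prod_zero bexI[of _ m])

lemma summable_Phi_parts:
  assumes "0 < q" "q < 1" "0 < y"
  shows "summable (\<lambda>j. (-1) ^ Suc j * q ^ tri j * Gf y (1 / real (Suc m)) (Suc j))"
    and "summable (\<lambda>j. (-1) ^ Suc j * q ^ tri j * Hf y (1 / real (Suc m)) j)"
proof -
  have "summable (\<lambda>j. q ^ tri j * y ^ j * y)"
    using summable_superexponential[OF assms] by (rule summable_mult2)
  then show "summable (\<lambda>j. (-1) ^ Suc j * q ^ tri j * Gf y (1 / real (Suc m)) (Suc j))"
  proof (rule summable_comparison_test'[where N = 0])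
    show "norm ((-1) ^ Suc j * q ^ tri j * Gf y (1 / real (Suc m)) (Suc j)) \<le> q ^ tri j * y ^ j * y" for j
      using Gf_abs_le[of "1 / real (Suc m)" y "Suc j"] assms
      by (simp add: abs_mult power_abs mult_ac mult_left_mono)
  qed
  have "summable (\<lambda>j. q ^ tri j * (1 / y) ^ j)"
    using summable_superexponential[of q "1 / y"] assms by simp
  then show "summable (\<lambda>j. (-1) ^ Suc j * q ^ tri j * Hf y (1 / real (Suc m)) j)"
  proof (rule summable_comparison_test'[where N = 0])
    show "norm ((-1) ^ Suc j * q ^ tri j * Hf y (1 / real (Suc m)) j) \<le> q ^ tri j * (1 / y) ^ j" for j
      using Hf_abs_le[of y m j] assms
      by (simp add: abs_mult power_abs mult_left_mono del: of_nat_Suc)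
  qed
qed

text \<open>At \<open>x = - k q\<^sup>1\<^sup>-\<^sup>k y\<close> the ratios of the terms of the series to the term of index \<open>k - 1 = m\<close>
  are \<open>\<plusminus>q\<^bsup>tri j\<^esup>\<close> times \<open>G\<^bsub>j+1\<^esub>\<close> (to the right) and \<open>H\<^bsub>j+1\<^esub>\<close> (to the left).\<close>

lemma defexp_expand:
  assumes q: "0 < q" "q < 1" and y: "0 < y"
  obtains T where "T > 0" "defexp q (- (real (Suc m) * y / q ^ m)) = (-1) ^ m * T * Phi q y (1 / real (Suc m))"
proof -
  define R where "R = real (Suc m) * y / q ^ m"
  define x where "x = 1 / real (Suc m)"
  define t where "t n = q ^ (n * (n - 1) div 2) * (- R) ^ n / fact n" for n
  have R: "R > 0" using q y by (simp add: R_def)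
  have t_Suc: "t (Suc n) = t n * (- R * q ^ n / real (Suc n))" for n
  proof -
    have "q ^ (Suc n * (Suc n - 1) div 2) = q ^ (n * (n - 1) div 2) * q ^ n"
      unfolding pairs_Suc by (simp add: power_add)
    then show ?thesis unfolding t_def by (simp add: mult_ac del: of_nat_Suc)
  qed
  have ratio: "- R * q ^ (m + j) / real (Suc (m + j)) = - (q ^ j * (y / (1 + real j * x)))" for j
  proof -
    have "1 + real j * x = real (Suc (m + j)) / real (Suc m)" by (simp add: x_def field_simps)
    moreover have "R * q ^ (m + j) = real (Suc m) * y * q ^ j"
      using q by (simp add: R_def power_add del: of_nat_Suc)
    ultimately show ?thesis by (simp add: mult_ac del: of_nat_Suc)
  qed
  have up: "t (m + Suc j) = t m * ((-1) ^ Suc j * q ^ tri j * Gf y x (Suc j))" for j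
  proof (induction j)
    case 0
    show ?case using ratio[of 0] t_Suc[of m] by (simp add: Gf_def)
  next
    case (Suc j)
    have "t (m + Suc (Suc j)) = t (m + Suc j) * - (q ^ Suc j * (y / (1 + real (Suc j) * x)))"
      using ratio[of "Suc j"] t_Suc[of "m + Suc j"] by (simp only: add_Suc_right)
    also have "\<dots> = t m * (((-1) ^ Suc j * -1) * (q ^ tri j * q ^ Suc j) * (Gf y x (Suc j) * (y / (1 + real (Suc j) * x))))"
      unfolding Suc by (simp only: mult_ac mult_minus_right mult_minus_left mult_1_left mult_1_right)
    also have "Gf y x (Suc j) * (y / (1 + real (Suc j) * x)) = Gf y x (Suc (Suc j))"
      by (simp add: Gf_def mult_ac)
    finally show ?case by (simp add: tri_Suc power_add)
  qed
  have down: "t (m - j) = t m * ((-1) ^ j * q ^ tri j * Hf y x j)" if "j \<le> m" for j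
    using that
  proof (induction j)
    case 0
    show ?case by (simp add: Hf_def)
  next
    case (Suc j)
    define l where "l = m - Suc j"
    have l: "m - j = Suc l" "m = l + Suc j" using Suc.prems by (auto simp: l_def)
    have xl: "1 - real (Suc j) * x = real (Suc l) / real (Suc m)"
      unfolding x_def l(2) by (simp add: field_simps)
    have "q ^ m = q ^ l * q ^ Suc j" by (simp only: l(2) power_add)
    then have "R * (q ^ l * q ^ Suc j) = real (Suc m) * y" using q by (simp add: R_def del: of_nat_Suc)
    moreover have "- R * q ^ l / real (Suc l) * (- (q ^ Suc j * (real (Suc l) / real (Suc m) / y))) =
        (R * (q ^ l * q ^ Suc j)) / (real (Suc m) * y)"
      by (simp add: mult_ac del: of_nat_Suc power_Suc)
    ultimately have "- R * q ^ l / real (Suc l) * (- (q ^ Suc j * ((1 - real (Suc j) * x) / y))) = 1"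
      unfolding xl using y by (simp del: of_nat_Suc)
    then have "t l = t (m - j) * (- (q ^ Suc j * ((1 - real (Suc j) * x) / y)))"
      unfolding l(1) t_Suc[of l] by (simp only: mult.assoc mult_1_right)
    also have "\<dots> = t m * (((-1) ^ j * -1) * (q ^ tri j * q ^ Suc j) * (Hf y x j * ((1 - real (Suc j) * x) / y)))"
      using Suc by (simp add: mult_ac)
    also have "Hf y x j * ((1 - real (Suc j) * x) / y) = Hf y x (Suc j)"
      by (simp add: Hf_def mult_ac)
    finally show ?case by (simp add: tri_Suc power_add l_def)
  qed
  have "summable t" unfolding t_def using q by (intro summable_defexp) auto
  then have "suminf t = suminf (\<lambda>j. t (j + Suc m)) + (\<Sum>n<Suc m. t n)"
    by (rule suminf_split_initial_segment)
  also have "suminf (\<lambda>j. t (j + Suc m)) = t m * suminf (\<lambda>j. (-1) ^ Suc j * q ^ tri j * Gf y x (Suc j))"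
  proof -
    have "t (j + Suc m) = t m * ((-1) ^ Suc j * q ^ tri j * Gf y x (Suc j))" for j
      using up[of j] by (simp add: add.commute)
    then show ?thesis using suminf_mult[OF summable_Phi_parts(1)[OF q y, of m]] by (simp add: x_def)
  qed
  also have "(\<Sum>n<Suc m. t n) = (\<Sum>j<Suc m. t (m - j))"
    using sum.nat_diff_reindex[of t "Suc m"] by simp
  also have "\<dots> = (\<Sum>j<Suc m. t m * ((-1) ^ j * q ^ tri j * Hf y x j))"
    using down by (intro sum.cong) auto
  also have "\<dots> = - (t m * suminf (\<lambda>j. (-1) ^ Suc j * q ^ tri j * Hf y x j))"
  proof -
    \<comment> \<open>\<open>Hf\<close> vanishes beyond j = m, which extends the finite left part of
      the series to an infinite one.\<close>
    have "suminf (\<lambda>j. (-1) ^ Suc j * q ^ tri j * Hf y x j) = (\<Sum>j<Suc m. (-1) ^ Suc j * q ^ tri j * Hf y x j)"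
      using Hf_eq_0[of m _ y] by (intro suminf_finite) (auto simp: x_def)
    then show ?thesis by (simp add: sum_distrib_left sum_negf del: sum.lessThan_Suc)
  qed
  finally have "suminf t = t m * (suminf (\<lambda>j. (-1) ^ Suc j * q ^ tri j * Gf y x (Suc j)) - suminf (\<lambda>j. (-1) ^ Suc j * q ^ tri j * Hf y x j))"
    by (simp add: right_diff_distrib)
  also have "suminf (\<lambda>j. (-1) ^ Suc j * q ^ tri j * Gf y x (Suc j)) - suminf (\<lambda>j. (-1) ^ Suc j * q ^ tri j * Hf y x j) = Phi q y x"
    unfolding Phi_def right_diff_distrib x_def
    by (rule suminf_diff[OF summable_Phi_parts[OF q y]])
  also have "t m = (-1) ^ m * (q ^ (m * (m - 1) div 2) * R ^ m / fact m)"
    unfolding t_def by (simp add: power_minus[of R])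
  finally have "defexp q (- R) = (-1) ^ m * (q ^ (m * (m - 1) div 2) * R ^ m / fact m) * Phi q y x"
    unfolding defexp_def t_def .
  moreover have "0 < q ^ (m * (m - 1) div 2) * R ^ m / fact m" using q R by simp
  ultimately show thesis using that unfolding R_def x_def by blast
qed


text \<open>With k = m + 1 this is k q^(1/2-k), that is y = q^(-1/2): on a logarithmic scale about
  half way from k q^(1-k) to (k+1) q^(-k).\<close>

definition sep_radius :: "real \<Rightarrow> nat \<Rightarrow> real" where
  "sep_radius q m = real (Suc m) * (1 / sqrt q) / q ^ m"

definition half_Phi :: "real \<Rightarrow> nat \<Rightarrow> real" where
  "half_Phi q m = Phi q (1 / sqrt q) (1 / real (Suc m))"

lemma sep_radius_pos: "0 < q \<Longrightarrow> 0 < sep_radius q m"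
  by (simp add: sep_radius_def)

text \<open>y = q^(-1/2) completes the squares: the exponents of q become (j^2 - 1)/2 and ((j+1)^2 -
  1)/2, so both families are theta terms in sqrt q up to the products.\<close>

lemma half_Phi_terms:
  assumes "0 < q"
  shows "q ^ tri j * Gf (1 / sqrt q) x (Suc j) = sqrt q ^ j\<^sup>2 / sqrt q / (\<Prod>i<Suc j. 1 + real i * x)"
    and "q ^ tri j * Hf (1 / sqrt q) x j = sqrt q ^ (Suc j)\<^sup>2 / sqrt q * (\<Prod>i<j. 1 - real (Suc i) * x)"
proof -
  define r where "r = sqrt q"
  have r: "0 < r" "q = r ^ 2" using assms by (simp_all add: r_def)
  have qt: "q ^ tri j = r ^ j\<^sup>2 * r ^ j"
    unfolding r(2) power_mult[symmetric] tri_eq by (simp add: power2_eq_square power_add algebra_simps)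
  have "q ^ tri j * Gf (1 / r) x (Suc j) = (r ^ j\<^sup>2 * (r ^ j / r ^ Suc j)) / (\<Prod>i<Suc j. 1 + real i * x)"
    unfolding qt Gf_def power_one_over by (simp only: mult_ac times_divide_eq_right times_divide_eq_left mult_1_left mult_1_right divide_divide_eq_left)
  also have "r ^ j / r ^ Suc j = 1 / r" using r by simp
  finally show "q ^ tri j * Gf (1 / sqrt q) x (Suc j) = sqrt q ^ j\<^sup>2 / sqrt q / (\<Prod>i<Suc j. 1 + real i * x)"
    by (simp add: r_def)
  have "(Suc j)\<^sup>2 = j\<^sup>2 + j + j + 1" by (simp add: power2_eq_square)
  then have "r ^ (Suc j)\<^sup>2 / r = r ^ j\<^sup>2 * r ^ j * r ^ j" using r by (simp add: power_add)
  moreover have "q ^ tri j * Hf (1 / r) x j = r ^ j\<^sup>2 * r ^ j * r ^ j * (\<Prod>i<j. 1 - real (Suc i) * x)"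
    unfolding qt Hf_def using r by (simp add: power_one_over mult_ac del: of_nat_Suc)
  ultimately show "q ^ tri j * Hf (1 / sqrt q) x j = sqrt q ^ (Suc j)\<^sup>2 / sqrt q * (\<Prod>i<j. 1 - real (Suc i) * x)"
    by (simp add: r_def)
qed

lemma half_Phi_term_bound:
  assumes q: "0 < q" "q < 1"
  shows "\<bar>(-1) ^ Suc j * q ^ tri j * (Gf (1 / sqrt q) (1 / real (Suc m)) (Suc j) - Hf (1 / sqrt q) (1 / real (Suc m)) j)\<bar>
     \<le> (sqrt q ^ j\<^sup>2 + sqrt q ^ (Suc j)\<^sup>2) / sqrt q"
proof -
  let ?x = "1 / real (Suc m)"
  have r: "0 < sqrt q" using q by simp
  have "1 \<le> (\<Prod>i<Suc j. 1 + real i * ?x)" by (intro prod_ge_1) auto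
  then have G: "\<bar>q ^ tri j * Gf (1 / sqrt q) ?x (Suc j)\<bar> \<le> sqrt q ^ j\<^sup>2 / sqrt q"
    unfolding half_Phi_terms[OF q(1)] using r
    by (subst abs_of_nonneg) (auto simp: divide_le_eq mult_le_cancel_left1 simp del: prod.lessThan_Suc of_nat_Suc)
  have H: "\<bar>q ^ tri j * Hf (1 / sqrt q) ?x j\<bar> \<le> sqrt q ^ (Suc j)\<^sup>2 / sqrt q"
  proof -
    have A: "0 \<le> sqrt q ^ (Suc j)\<^sup>2 / sqrt q" using r by simp
    show ?thesis unfolding half_Phi_terms[OF q(1)] abs_mult abs_of_nonneg[OF A]
      by (rule mult_left_le[OF Hf_prod_abs_le A])
  qed
  have "\<bar>(-1) ^ Suc j * q ^ tri j * (Gf (1 / sqrt q) ?x (Suc j) - Hf (1 / sqrt q) ?x j)\<bar> =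
     \<bar>q ^ tri j * Gf (1 / sqrt q) ?x (Suc j) - q ^ tri j * Hf (1 / sqrt q) ?x j\<bar>"
    unfolding right_diff_distrib[symmetric] mult.assoc abs_mult[of "(-1) ^ Suc j"] by (simp add: power_abs del: of_nat_Suc)
  also have "\<dots> \<le> sqrt q ^ j\<^sup>2 / sqrt q + sqrt q ^ (Suc j)\<^sup>2 / sqrt q"
    using G H by linarith
  finally show ?thesis by (simp add: add_divide_distrib)
qed

lemma le_square_nat: "(j::nat) \<le> j\<^sup>2"
  by (cases j) (auto simp: power2_eq_square)

text \<open>At x = 0 the products are 1, and the two families combine to -1/r times the theta series
  of \<open>theta_pos\<close>.\<close>

lemma half_Phi_limit_neg:
  assumes q: "0 < q" "q < 1"
  shows "suminf (\<lambda>j. (-1) ^ Suc j * q ^ tri j * (Gf (1 / sqrt q) 0 (Suc j) - Hf (1 / sqrt q) 0 j)) < 0"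
proof -
  define r where "r = sqrt q"
  define u where "u j = (-1) ^ Suc j * r ^ (Suc j)\<^sup>2" for j
  have r: "0 < r" "r < 1" using q by (auto simp: r_def)
  have su: "summable (\<lambda>j. (-1) ^ j * r ^ j\<^sup>2)"
  proof (rule summable_comparison_test')
    show "summable (\<lambda>j. r ^ j)" using r by (intro summable_geometric) auto
    show "norm ((-1) ^ j * r ^ j\<^sup>2) \<le> r ^ j" if "j \<ge> 0" for j
      using r power_decreasing[OF le_square_nat[of j], of r] by (simp add: abs_mult power_abs)
  qed
  have uu: "u j = (\<lambda>j. (-1) ^ j * r ^ j\<^sup>2) (Suc j)" for j by (simp add: u_def)
  have su': "summable u" using su unfolding uu[abs_def] by (subst summable_Suc_iff)
  have "suminf (\<lambda>j. (-1) ^ j * r ^ j\<^sup>2) = suminf u + 1"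
    using suminf_split_head[OF su] unfolding uu[abs_def] by simp
  moreover have "(-1) ^ Suc j * q ^ tri j * (Gf (1 / sqrt q) 0 (Suc j) - Hf (1 / sqrt q) 0 j) =
     - (1 / r) * ((-1) ^ j * r ^ j\<^sup>2 + u j)" for j
  proof -
    have "(-1) ^ Suc j * q ^ tri j * (Gf (1 / sqrt q) 0 (Suc j) - Hf (1 / sqrt q) 0 j) =
       (-1) ^ Suc j * (r ^ j\<^sup>2 / r) - (-1) ^ Suc j * (r ^ (Suc j)\<^sup>2 / r)"
      using half_Phi_terms[OF q(1), of j 0] by (simp add: r_def mult.assoc right_diff_distrib del: power_Suc)
    then show ?thesis unfolding u_def by (simp add: algebra_simps)
  qed
  ultimately have "suminf (\<lambda>j. (-1) ^ Suc j * q ^ tri j * (Gf (1 / sqrt q) 0 (Suc j) - Hf (1 / sqrt q) 0 j)) =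
     - (1 / r) * (1 + 2 * suminf u)"
    using suminf_mult[OF summable_add[OF su su'], of "- (1 / r)"] suminf_add[OF su su'] by simp
  moreover have "0 < 1 + 2 * suminf u" unfolding u_def using theta_pos[OF r] .
  ultimately show ?thesis using r by (simp add: divide_neg_pos)
qed

text \<open>The product filter records uniformity: one bound on m serves all q near
  \<open>q0\<close>. Confining q between q0/2 and (1 + q0)/2 makes the majorant independent of
  q.\<close>

lemma half_Phi_eventually_neg:
  assumes q0: "0 < q0" "q0 < 1"
  shows "\<forall>\<^sub>F p in sequentially \<times>\<^sub>F nhds q0. half_Phi (snd p) (fst p) < 0"
proof -
  let ?F = "sequentially \<times>\<^sub>F nhds q0"
  define a where "a j p = (-1) ^ Suc j * snd p ^ tri j *
     (Gf (1 / sqrt (snd p)) (1 / real (Suc (fst p))) (Suc j) - Hf (1 / sqrt (snd p)) (1 / real (Suc (fst p))) j)" for j p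
  have Q: "(snd \<longlongrightarrow> q0) ?F" by (rule filterlim_snd)
  have X: "((\<lambda>p. 1 / real (Suc (fst p))) \<longlongrightarrow> 0) ?F"
  proof (rule filterlim_compose[of "\<lambda>n. 1 / real (Suc n)" _ sequentially])
    show "(\<lambda>n. 1 / real (Suc n)) \<longlonglongrightarrow> 0" using LIMSEQ_inverse_real_of_nat by (simp add: inverse_eq_divide)
  qed (rule filterlim_fst)
  have ev: "\<forall>\<^sub>F p in ?F. q0 / 2 < snd p" "\<forall>\<^sub>F p in ?F. snd p < (1 + q0) / 2"
    by (rule order_tendstoD(1)[OF Q], use q0 in simp, rule order_tendstoD(2)[OF Q], use q0 in simp)
  have "((\<lambda>p. suminf (\<lambda>j. a j p)) \<longlongrightarrow> suminf (\<lambda>j. (-1) ^ Suc j * q0 ^ tri j * (Gf (1 / sqrt q0) 0 (Suc j) - Hf (1 / sqrt q0) 0 j))) ?F"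
  proof (rule tannery_uniform)
    show "?F \<noteq> bot" by (simp add: prod_filter_eq_bot)
    show "((\<lambda>p. a j p) \<longlongrightarrow> (-1) ^ Suc j * q0 ^ tri j * (Gf (1 / sqrt q0) 0 (Suc j) - Hf (1 / sqrt q0) 0 j)) ?F" for j
      unfolding a_def Gf_def Hf_def using q0
      by (intro tendsto_intros Q X) auto
    show "summable (\<lambda>j. 2 / sqrt (q0 / 2) * sqrt ((1 + q0) / 2) ^ j)"
      using q0 by (intro summable_mult summable_geometric) auto
    show "\<forall>\<^sub>F p in ?F. \<forall>j. \<bar>a j p\<bar> \<le> 2 / sqrt (q0 / 2) * sqrt ((1 + q0) / 2) ^ j"
      using ev
    proof eventually_elim
      case (elim p)
      define q where "q = snd p"
      have q: "0 < q" "q < 1" "q0 / 2 < q" "q < (1 + q0) / 2" using elim q0 by (auto simp: q_def)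
      show ?case
      proof
        fix j
        have le: "sqrt q ^ n \<le> sqrt ((1 + q0) / 2) ^ j" if "j \<le> n" for n
        proof -
          have "sqrt q ^ n \<le> sqrt q ^ j" using q that by (intro power_decreasing) auto
          also have "\<dots> \<le> sqrt ((1 + q0) / 2) ^ j" using q by (intro power_mono) auto
          finally show ?thesis .
        qed
        have "\<bar>a j p\<bar> \<le> (sqrt q ^ j\<^sup>2 + sqrt q ^ (Suc j)\<^sup>2) / sqrt q"
          unfolding a_def q_def[symmetric] by (rule half_Phi_term_bound[OF q(1,2)])
        also have "\<dots> \<le> (2 * sqrt ((1 + q0) / 2) ^ j) / sqrt (q0 / 2)"
        proof (rule frac_le)
          have "j \<le> (Suc j)\<^sup>2" using le_square_nat[of "Suc j"] by linarith
          then show "sqrt q ^ j\<^sup>2 + sqrt q ^ (Suc j)\<^sup>2 \<le> 2 * sqrt ((1 + q0) / 2) ^ j"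
            using le[OF le_square_nat] le[of "(Suc j)\<^sup>2"] by linarith
        qed (use q q0 in auto)
        finally show "\<bar>a j p\<bar> \<le> 2 / sqrt (q0 / 2) * sqrt ((1 + q0) / 2) ^ j" by simp
      qed
    qed
  qed
  from order_tendstoD(2)[OF this half_Phi_limit_neg[OF q0]]
  show ?thesis unfolding a_def half_Phi_def Phi_def .
qed

lemma defexp_sep_radius_sign:
  assumes "0 < q" "q < 1" "half_Phi q m < 0"
  shows "(-1) ^ m * defexp q (- sep_radius q m) < 0"
proof -
  obtain T where T: "T > 0" "defexp q (- sep_radius q m) = (-1) ^ m * T * half_Phi q m"
    using defexp_expand[of q "1 / sqrt q" m] assms unfolding sep_radius_def half_Phi_def by auto
  then have "(-1) ^ m * defexp q (- sep_radius q m) = ((-1) ^ m * (-1) ^ m) * (T * half_Phi q m)"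
    by (simp only: mult_ac)
  also have "\<dots> = T * half_Phi q m" by (simp flip: power_mult_distrib)
  also have "\<dots> < 0" using T assms by (simp add: mult_pos_neg)
  finally show ?thesis .
qed

text \<open>The condition on \<open>M\<close> says that from there on the radii grow by at most
  1/q^2 per step; with alternating signs each step adds exactly one zero.\<close>

lemma zcount_sep_radius_advance:
  assumes q: "0 < q" "q < 1" and M: "q * (real M + 2) \<le> real M + 1" and neg: "\<And>m. M \<le> m \<Longrightarrow> half_Phi q m < 0"
  shows "M \<le> m \<Longrightarrow> zcount q (sep_radius q m) = zcount q (sep_radius q M) + (m - M)"
proof (induction rule: dec_induct)
  case (step m)
  let ?a = "sep_radius q m" and ?b = "sep_radius q (Suc m)"
  have a: "0 < ?a" using q by (intro sep_radius_pos)
  have b: "?b = ?a * ((real m + 2) / (real m + 1)) / q"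
  proof -
    have "real (Suc (Suc m)) = real (Suc m) * ((real m + 2) / (real m + 1))" by (simp add: field_simps)
    then show ?thesis unfolding sep_radius_def by (simp only: power_Suc) (simp add: mult_ac)
  qed
  have "q * (real m + 2) = q * (real M + 2) + q * (real m - real M)" by (simp add: algebra_simps)
  also have "\<dots> \<le> (real M + 1) + 1 * (real m - real M)"
    using M q step by (intro add_mono mult_right_mono) auto
  finally have qm: "q * (real m + 2) \<le> real m + 1" by simp
  have "zcount q ?b = Suc (zcount q ?a)"
  proof (rule zcount_double_step[OF q a])
    have "?a * 1 < ?a * ((real m + 2) / (real m + 1) / q)"
    proof (rule mult_strict_left_mono[OF _ a])
      have "q * (real m + 1) < 1 * (real m + 2)" using q by (intro mult_strict_mono) auto
      then show "1 < (real m + 2) / (real m + 1) / q" using q by (simp add: mult.commute)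
    qed
    then show "?a < ?b" unfolding b by simp
    have "q\<^sup>2 * ?b = ?a * (q * (real m + 2) / (real m + 1))" unfolding b using q by (simp add: power2_eq_square)
    also have "\<dots> \<le> ?a * 1" using a qm by (intro mult_left_mono) auto
    finally show "q\<^sup>2 * ?b \<le> ?a" by simp
    have "(-1) ^ m * defexp q (- ?a) < 0" "(-1) ^ Suc m * defexp q (- ?b) < 0"
      by (rule defexp_sep_radius_sign[OF q neg], use step(1) in simp)+
    then have "0 < ((-1) ^ m * defexp q (- ?a)) * ((-1) ^ Suc m * defexp q (- ?b))" by (rule mult_neg_neg)
    also have "\<dots> = ((-1) ^ m * (-1) ^ Suc m) * (defexp q (- ?b) * defexp q (- ?a))" by (simp only: mult_ac)
    also have "(-1) ^ m * (-1) ^ Suc m = (-1::real)" by (simp flip: power_mult_distrib)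
    finally show "defexp q (- ?b) * defexp q (- ?a) < 0" by simp
  qed
  then show ?case using step by simp
qed simp

section \<open>Stability of the count under changes of q\<close>

lemma tendsto_eventually_sign:
  fixes l :: real
  assumes "(g \<longlongrightarrow> l) F" "l \<noteq> 0"
  shows "\<forall>\<^sub>F x in F. g x \<noteq> 0 \<and> (g x < 0 \<longleftrightarrow> l < 0)"
proof (cases "l < 0")
  case True
  show ?thesis using order_tendstoD(2)[OF assms(1) True] by eventually_elim (use True in auto)
next
  case False
  then have "0 < l" using assms(2) by simp
  show ?thesis using order_tendstoD(1)[OF assms(1) \<open>0 < l\<close>] by eventually_elim (use \<open>0 < l\<close> in auto)
qed

text \<open>Each positive exponent i and each of the finitely many zeros in range exclude one ratio,
  an i-th root; an interval has room to avoid them all.\<close>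

lemma generic_grid_ratio:
  assumes q: "0 < q" "q < 1" and s: "q < s" and R: "0 < R" "defexp q (- R) \<noteq> 0"
  obtains r where "q < r" "r < s" "\<And>i. i \<le> m \<Longrightarrow> defexp q (- (R * r ^ i)) \<noteq> 0"
proof -
  let ?Z = "{x. - (R + 1) < x \<and> defexp q x = 0}"
  define B where "B = (\<Union>i\<in>{1..m}. (\<lambda>z. root i (- z / R)) ` ?Z)"
  have "finite B" unfolding B_def by (intro finite_UN_I finite_imageI finite_defexp_zeros[OF q]) simp
  moreover have "infinite {q<..<min s 1}" using s q by (intro infinite_Ioo) auto
  ultimately obtain r where r: "r \<in> {q<..<min s 1}" "r \<notin> B" by (meson finite_subset subsetI)
  have "defexp q (- (R * r ^ i)) \<noteq> 0" if "i \<le> m" for i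
  proof (cases "i = 0")
    case False
    show ?thesis
    proof
      assume zero: "defexp q (- (R * r ^ i)) = 0"
      have "r ^ i \<le> 1" using r q by (intro power_le_one) auto
      then have "R * r ^ i < R + 1" using R by (smt (verit) mult_left_le)
      then have "- (R * r ^ i) \<in> ?Z" using zero by simp
      moreover have "r = root i (- (- (R * r ^ i)) / R)"
        using R r q False by (simp add: real_root_power_cancel)
      ultimately have "r \<in> B" unfolding B_def using that False by (auto intro!: bexI[of _ i] image_eqI[of _ _ "- (R * r ^ i)"])
      then show False using r by simp
    qed
  qed (use R in simp)
  then show thesis using that[of r] r by auto
qed

text \<open>A ratio \<open>r\<close> generic for \<open>q0\<close> still exceeds all nearby q, and
  the finitely many grid values keep their signs by joint continuity, so \<open>zcount_grid\<close>
  returns the same number.\<close>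

lemma zcount_sep_radius_locally_constant:
  assumes q0: "0 < q0" "q0 < 1" and nz: "defexp q0 (- sep_radius q0 M) \<noteq> 0"
  shows "\<forall>\<^sub>F q in nhds q0. zcount q (sep_radius q M) = zcount q0 (sep_radius q0 M)"
proof -
  define R where "R q = sep_radius q M" for q
  have R0: "0 < R q0" using q0 by (simp add: R_def sep_radius_pos)
  define s where "s = (1 + q0) / 2"
  have s: "q0 < s" "0 < s" "s < 1" using q0 by (auto simp: s_def)
  obtain m where m: "s ^ m < 1 / (2 * R q0)"
    using real_arch_pow_inv[of "1 / (2 * R q0)" s] s R0 by auto
  obtain r where r: "q0 < r" "r < s" "\<And>i. i \<le> m \<Longrightarrow> defexp q0 (- (R q0 * r ^ i)) \<noteq> 0"
    using generic_grid_ratio[OF q0 s(1) R0, of m] nz unfolding R_def by blast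
  have "r ^ m \<le> s ^ m" using r q0 by (intro power_mono) auto
  then have small: "R q0 * r ^ m < 1 / 2" using m R0 by (simp add: field_simps) (smt (verit) mult_left_mono)
  have id: "((\<lambda>q. q) \<longlongrightarrow> q0) (nhds q0)" by (rule filterlim_ident)
  have Rt: "(R \<longlongrightarrow> R q0) (nhds q0)"
    unfolding R_def sep_radius_def using q0 by (intro tendsto_intros id) auto
  have ev01: "\<forall>\<^sub>F q in nhds q0. 0 < q" "\<forall>\<^sub>F q in nhds q0. q < r"
    using order_tendstoD[OF id] q0 r by auto
  have ft: "((\<lambda>q. defexp q (- (R q * r ^ i))) \<longlongrightarrow> defexp q0 (- (R q0 * r ^ i))) (nhds q0)" for i
  proof (rule tendsto_defexp[OF id])
    show "((\<lambda>q. - (R q * r ^ i)) \<longlongrightarrow> - (R q0 * r ^ i)) (nhds q0)" by (intro tendsto_intros Rt)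
    show "\<forall>\<^sub>F q in nhds q0. 0 \<le> q \<and> q \<le> 1"
      using ev01 by eventually_elim (use r s in auto)
  qed simp
  have "\<forall>\<^sub>F q in nhds q0. \<forall>i\<in>{..m}. defexp q (- (R q * r ^ i)) \<noteq> 0 \<and> (defexp q (- (R q * r ^ i)) < 0 \<longleftrightarrow> defexp q0 (- (R q0 * r ^ i)) < 0)"
    using r(3) by (intro eventually_ball_finite ballI tendsto_eventually_sign ft) auto
  moreover have "\<forall>\<^sub>F q in nhds q0. R q * r ^ m < 1 / 2"
    by (rule order_tendstoD(2)[OF _ small]) (intro tendsto_intros Rt)
  ultimately show ?thesis using ev01
  proof eventually_elim
    case (elim q)
    have q: "0 < q" "q < 1" using elim r s by auto
    have pos: "0 < R q" using q by (simp add: R_def sep_radius_pos)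
    have "zcount q (R q) = card {i. i < m \<and> defexp q (- (R q * r ^ Suc i)) * defexp q (- (R q * r ^ i)) < 0}"
      using elim r s by (intro zcount_grid[OF q _ _ pos]) auto
    also have "{i. i < m \<and> defexp q (- (R q * r ^ Suc i)) * defexp q (- (R q * r ^ i)) < 0} =
       {i. i < m \<and> defexp q0 (- (R q0 * r ^ Suc i)) * defexp q0 (- (R q0 * r ^ i)) < 0}"
    proof (rule Collect_cong, rule conj_cong[OF refl])
      fix i assume "i < m"
      then have "i \<in> {..m}" "Suc i \<in> {..m}" by auto
      then show "(defexp q (- (R q * r ^ Suc i)) * defexp q (- (R q * r ^ i)) < 0) =
        (defexp q0 (- (R q0 * r ^ Suc i)) * defexp q0 (- (R q0 * r ^ i)) < 0)"
        using elim(1) r(3)[of i] r(3)[of "Suc i"] \<open>i < m\<close> unfolding mult_less_0_iff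
        by (metis Suc_leI less_imp_le linorder_neqE_linordered_idom not_less_iff_gr_or_eq)
    qed
    also have "card \<dots> = zcount q0 (R q0)"
      using r s R0 small by (intro zcount_grid[OF q0, symmetric]) auto
    finally show ?case unfolding R_def .
  qed
qed

text \<open>This is c(q) = 0 of the overview: for large k the k-th radius encloses exactly k
  zeros.\<close>

definition regular_count :: "real \<Rightarrow> bool" where
  "regular_count q \<longleftrightarrow> (\<exists>K. \<forall>m\<ge>K. zcount q (sep_radius q m) = Suc m)"

text \<open>One \<open>M\<close> serves all q near \<open>q0\<close>, for the signs and for the
  growth of the radii. From \<open>M\<close> on the counts advance in step, so the count at
  \<open>M\<close> alone decides regularity.\<close>

lemma regular_count_locally_constant:
  assumes q0: "0 < q0" "q0 < 1"
  shows "\<forall>\<^sub>F q in nhds q0. 0 < q \<and> q < 1 \<and> (regular_count q \<longleftrightarrow> regular_count q0)"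
proof -
  obtain Pf Pg where P: "eventually Pf sequentially" "eventually Pg (nhds q0)"
    "\<And>m q. Pf m \<Longrightarrow> Pg q \<Longrightarrow> half_Phi q m < 0"
    using half_Phi_eventually_neg[OF q0] unfolding eventually_prod_filter by auto
  obtain M0 where M0: "\<And>m. m \<ge> M0 \<Longrightarrow> Pf m" using P(1) by (auto simp: eventually_sequentially)
  define q1 where "q1 = (1 + q0) / 2"
  have q1: "q0 < q1" "q1 < 1" using q0 by (auto simp: q1_def)
  \<comment> \<open>The growth condition q1 (M + 2) <= M + 1 amounts to 2 q1 - 1 <= M (1 - q1), for
    which M (1 - q1) > 1 is enough.\<close>
  obtain M1 :: nat where M1: "1 / (1 - q1) < real M1" using reals_Archimedean2 by blast
  define M where "M = max M0 M1"
  have "1 / (1 - q1) < real M" using M1 by (simp add: M_def)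
  then have MM: "1 < real M * (1 - q1)" using q1 by (simp add: divide_less_eq)
  have crit: "regular_count q \<longleftrightarrow> zcount q (sep_radius q M) = Suc M" if q: "0 < q" "q < q1" "Pg q" for q
  proof -
    have "q * (real M + 2) \<le> q1 * (real M + 2)" using q by (intro mult_right_mono) auto
    also have "\<dots> \<le> real M + 1" using MM q1 by (simp add: algebra_simps)
    finally have adv: "zcount q (sep_radius q m) = zcount q (sep_radius q M) + (m - M)" if "m \<ge> M" for m
      using q q1 P(3) M0 that by (intro zcount_sep_radius_advance) (auto simp: M_def)
    show ?thesis
    proof
      assume "regular_count q"
      then obtain K where K: "\<And>m. m \<ge> K \<Longrightarrow> zcount q (sep_radius q m) = Suc m"
        unfolding regular_count_def by blast
      show "zcount q (sep_radius q M) = Suc M" using K[of "max K M"] adv[of "max K M"] by simp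
    next
      assume "zcount q (sep_radius q M) = Suc M"
      then have "zcount q (sep_radius q m) = Suc m" if "m \<ge> M" for m using adv[OF that] that by simp
      then show "regular_count q" unfolding regular_count_def by blast
    qed
  qed
  have Pg0: "Pg q0" using P(2) eventually_nhds_x_imp_x by blast
  have "defexp q0 (- sep_radius q0 M) \<noteq> 0"
    using defexp_sep_radius_sign[OF q0, of M] P(3)[OF M0 Pg0, of M] by (auto simp: M_def)
  from zcount_sep_radius_locally_constant[OF q0 this]
  have "\<forall>\<^sub>F q in nhds q0. zcount q (sep_radius q M) = zcount q0 (sep_radius q0 M)" .
  moreover have "\<forall>\<^sub>F q in nhds q0. q \<in> {0<..<q1}"
    using q0 q1 by (intro eventually_nhds_in_open) auto
  ultimately show ?thesis using P(2)
    by eventually_elim (use crit Pg0 q0 q1 in auto)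
qed

text \<open>With sqrt q = 1/10 the first term is -(10 - 1) = -9 and the others add at most 20/9. The
  sign thus holds for every \<open>m\<close>, not merely for large ones.\<close>

lemma half_Phi_neg_base: "half_Phi (1 / 100) m < 0"
proof -
  define q :: real where "q = 1 / 100"
  define x where "x = 1 / real (Suc m)"
  have q: "0 < q" "q < 1" and sq: "sqrt q = 1 / 10"
    by (simp_all add: q_def real_sqrt_divide)
  define a where "a j = (-1) ^ Suc j * q ^ tri j * (Gf (1 / sqrt q) x (Suc j) - Hf (1 / sqrt q) x j)" for j
  have y: "0 < 1 / sqrt q" using q by simp
  have sm: "summable a"
    unfolding a_def x_def right_diff_distrib by (rule summable_diff[OF summable_Phi_parts[OF q y]])
  have "half_Phi q m = suminf a" unfolding half_Phi_def Phi_def a_def x_def ..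
  also have "\<dots> = suminf (\<lambda>j. a (Suc j)) + a 0" using suminf_split_head[OF sm] by simp
  also have "a 0 = - 9" by (simp add: a_def Gf_def Hf_def sq)
  also have "suminf (\<lambda>j. a (Suc j)) \<le> suminf (\<lambda>j. 2 * (1 / 10) ^ j)"
  proof (rule suminf_le)
    show "summable (\<lambda>j. a (Suc j))" using sm by (subst summable_Suc_iff)
    show "summable (\<lambda>j. 2 * (1 / 10 :: real) ^ j)" by (intro summable_mult summable_geometric) auto
    fix j
    have "\<bar>a (Suc j)\<bar> \<le> (sqrt q ^ (Suc j)\<^sup>2 + sqrt q ^ (Suc (Suc j))\<^sup>2) / sqrt q"
      unfolding a_def x_def by (rule half_Phi_term_bound[OF q])
    also have "\<dots> \<le> (sqrt q ^ Suc j + sqrt q ^ Suc j) / sqrt q"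
    proof (intro divide_right_mono add_mono power_decreasing)
      show "Suc j \<le> (Suc j)\<^sup>2" by (rule le_square_nat)
      show "Suc j \<le> (Suc (Suc j))\<^sup>2" using le_square_nat[of "Suc (Suc j)"] by linarith
    qed (auto simp: sq)
    also have "\<dots> = 2 * (1 / 10) ^ j" by (simp add: sq)
    finally show "a (Suc j) \<le> 2 * (1 / 10) ^ j" by simp
  qed
  also have "suminf (\<lambda>j. 2 * (1 / 10 :: real) ^ j) = 2 * (1 / (1 - 1 / 10))"
    by (subst suminf_mult) (auto simp: suminf_geometric)
  finally show ?thesis unfolding q_def by simp
qed

text \<open>As all signs are known, counting may start at m = 0, where a single cell from 1/2 to 10
  contains one sign change.\<close>

lemma regular_count_base: "regular_count (1 / 100)"
proof -
  define q :: real where "q = 1 / 100"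
  have q: "0 < q" "q < 1" and sq: "sqrt q = 1 / 10"
    by (simp_all add: q_def real_sqrt_divide)
  have R0: "sep_radius q 0 = 10" by (simp add: sep_radius_def sq)
  have s0: "defexp q (- 10) < 0"
    using defexp_sep_radius_sign[OF q, of 0] half_Phi_neg_base[of 0, folded q_def] by (simp add: R0)
  have sh: "0 < defexp q (- (1 / 2))" by (rule defexp_pos[OF q]) simp
  have "zcount q 10 = zcount q (1 / 2) + (if defexp q (- (1 / 2)) * defexp q (- 10) < 0 then 1 else 0)"
    using s0 sh by (intro zcount_step[OF q]) (auto simp: q_def)
  then have z0: "zcount q (sep_radius q 0) = 1"
    using s0 sh zcount_half[OF q, of "1 / 2"] by (simp add: R0 mult_pos_neg)
  have "zcount q (sep_radius q m) = zcount q (sep_radius q 0) + (m - 0)" for m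
    by (rule zcount_sep_radius_advance[OF q]) (auto simp: q_def half_Phi_neg_base)
  then show ?thesis unfolding regular_count_def z0 q_def[symmetric] by simp
qed

text \<open>The number of zeros exceeding \<open>- sep_radius q m\<close> is \<open>m + 1\<close> up to a constant depending only on \<open>q\<close>;
  the constant is locally constant in \<open>q\<close> and vanishes for one \<open>q\<close>.\<close>

lemma regular_count_all:
  assumes "0 < q" "q < 1"
  shows "regular_count q"
proof (rule connected_induction_simple[of "{0<..<1}" "1 / 100" q regular_count])
  fix a :: real assume a: "a \<in> {0<..<1}"
  from regular_count_locally_constant[of a] a obtain S where
    S: "open S" "a \<in> S" "\<And>q. q \<in> S \<Longrightarrow> 0 < q \<and> q < 1 \<and> (regular_count q \<longleftrightarrow> regular_count a)"
    unfolding eventually_nhds by auto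
  show "\<exists>T. openin (top_of_set {0<..<1}) T \<and> a \<in> T \<and> (\<forall>x\<in>T. \<forall>y\<in>T. regular_count x \<longrightarrow> regular_count y)"
  proof (intro exI[of _ S] conjI ballI impI)
    show "openin (top_of_set {0<..<1}) S" using S by (intro open_subset) auto
    show "regular_count y" if "x \<in> S" "y \<in> S" "regular_count x" for x y
      using S(3)[OF that(1)] S(3)[OF that(2)] that(3) by blast
  qed (rule S(2))
qed (use assms regular_count_base in \<open>auto simp: connected_Ioo\<close>)

lemma half_Phi_neg_eventually:
  assumes q: "0 < q" "q < 1"
  shows "\<exists>M. \<forall>m\<ge>M. half_Phi q m < 0"
proof -
  obtain Pf Pg where P: "eventually Pf sequentially" "eventually Pg (nhds q)"
    "\<And>m p. Pf m \<Longrightarrow> Pg p \<Longrightarrow> half_Phi p m < 0"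
    using half_Phi_eventually_neg[OF q] unfolding eventually_prod_filter by auto
  have "Pg q" using P(2) eventually_nhds_x_imp_x by blast
  then show ?thesis using P(1,3) unfolding eventually_sequentially by blast
qed

text \<open>The counts m + 1 and m + 2 at consecutive radii leave exactly one zero between them,
  with m + 1 zeros to its right.\<close>

lemma defexp_zero_locate:
  assumes q: "0 < q" "q < 1"
  shows "\<exists>M. \<forall>m\<ge>M. \<forall>z. - sep_radius q (Suc m) < z \<longrightarrow> z < - sep_radius q m \<longrightarrow> defexp q z = 0 \<longrightarrow>
     defexp_zero q (Suc (Suc m)) = z"
proof -
  obtain K where K: "\<And>m. m \<ge> K \<Longrightarrow> zcount q (sep_radius q m) = Suc m"
    using regular_count_all[OF q] unfolding regular_count_def by blast
  obtain M where M: "\<And>m. m \<ge> M \<Longrightarrow> half_Phi q m < 0" using half_Phi_neg_eventually[OF q] by blast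
  have "defexp_zero q (Suc (Suc m)) = z"
    if m: "m \<ge> max K M" and z: "- sep_radius q (Suc m) < z" "z < - sep_radius q m" "defexp q z = 0" for m z
  proof (rule defexp_zero_eqI[OF q z(3)])
    let ?a = "sep_radius q m" and ?b = "sep_radius q (Suc m)"
    let ?Z = "{x. - ?b < x \<and> x < - ?a \<and> defexp q x = 0}"
    have nz: "defexp q (- ?a) \<noteq> 0" using defexp_sep_radius_sign[OF q, of m] M[of m] m by auto
    have "zcount q ?b = zcount q ?a + card ?Z" using z by (intro zcount_split[OF q _ nz]) auto
    then have "card ?Z = 1" using K[of m] K[of "Suc m"] m by simp
    then obtain w where w: "?Z = {w}" by (rule card_1_singletonE)
    have "z \<in> ?Z" using z by simp
    then have Z: "?Z = {z}" unfolding w by simp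
    have "{x. - (- z) < x \<and> x < - ?a \<and> defexp q x = 0} \<subseteq> ?Z - {z}" using z by auto
    then have "{x. - (- z) < x \<and> x < - ?a \<and> defexp q x = 0} = {}" unfolding Z by simp
    moreover have "zcount q (- z) = zcount q ?a + card {x. - (- z) < x \<and> x < - ?a \<and> defexp q x = 0}"
      using z by (intro zcount_split[OF q _ nz]) auto
    ultimately have "zcount q (- z) = zcount q ?a" by (simp only: card.empty add_0_right)
    then show "zcount q (- z) = Suc (Suc m) - 1" using K[of m] m by simp
  qed
  then show ?thesis by blast
qed

section \<open>The asymptotic expansion\<close>

lemma sum_convolution_shift:
  fixes g :: "nat \<Rightarrow> nat \<Rightarrow> real"
  shows "(\<Sum>m<M. \<Sum>i<m. g i (m - 1 - i)) = (\<Sum>i<M. \<Sum>l<M - 1 - i. g i l)"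
proof -
  have "(\<Sum>m<M. \<Sum>i<m. g i (m - 1 - i)) = (\<Sum>(m, i)\<in>Sigma {..<M} (\<lambda>m. {..<m}). g i (m - 1 - i))"
    by (simp add: sum.Sigma)
  also have "\<dots> = (\<Sum>(i, l)\<in>Sigma {..<M} (\<lambda>i. {..<M - 1 - i}). g i l)"
    by (rule sum.reindex_bij_witness[of _ "\<lambda>(i, l). (l + 1 + i, i)" "\<lambda>(m, i). (i, m - 1 - i)"]) auto
  also have "\<dots> = (\<Sum>i<M. \<Sum>l<M - 1 - i. g i l)" by (simp add: sum.Sigma)
  finally show ?thesis .
qed

text \<open>Both \<open>G\<close> (with \<open>s = 1\<close>, \<open>p j = j\<close>, \<open>r j = j + 1\<close>) and \<open>H\<close> (with \<open>s = -1\<close>, \<open>p j = j + 1\<close>, \<open>r j = j\<close>)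
  satisfy a difference equation of this form, and the remainders inherit it.\<close>

lemma uniform_taylor_remainder:
  fixes F :: "nat \<Rightarrow> real \<Rightarrow> real" and f :: "nat \<Rightarrow> nat \<Rightarrow> real" and a :: "nat \<Rightarrow> real"
  assumes X: "\<And>x. x \<in> X \<Longrightarrow> 0 < x \<and> x \<le> 1"
    and F0: "\<And>x. F 0 x = 1" and f0: "\<And>j. f j 0 = 1" "\<And>m. f 0 (Suc m) = 0"
    and Frec: "\<And>x j. x \<in> X \<Longrightarrow> F (Suc j) x - F j x =
        s * x\<^sup>2 * (\<Sum>i<N. a i * x ^ i) * F (p j) x - c j * x * F (r j) x"
    and frec: "\<And>j m. f (Suc j) (Suc m) - f j (Suc m) = s * (\<Sum>i<m. a i * f (p j) (m - 1 - i)) - c j * f (r j) m"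
    and a0: "\<And>i. N \<le> i \<Longrightarrow> a i = 0"
    and Fb: "\<And>x j. x \<in> X \<Longrightarrow> \<bar>F j x\<bar> \<le> B ^ j" and B: "1 \<le> B"
    and s: "\<bar>s\<bar> = 1" and c: "\<And>j. \<bar>c j\<bar> \<le> real (Suc j)" and p: "\<And>j. p j \<le> Suc j" and r: "\<And>j. r j \<le> Suc j"
  shows "\<exists>C E. 0 \<le> C \<and> 1 \<le> E \<and> (\<forall>x\<in>X. \<forall>j. \<bar>F j x - (\<Sum>m<M. f j m * x ^ m)\<bar> \<le> C * E ^ j * x ^ M)"
proof (induction M rule: less_induct)
  case (less M')
  show ?case
  proof (cases M')
    case 0
    then show ?thesis using Fb B by (intro exI[of _ 1] exI[of _ B]) auto
  next
    case (Suc M)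
    define Rem where "Rem j L x = F j x - (\<Sum>m<L. f j m * x ^ m)" for j L x
    have "\<forall>L\<in>{..M}. \<exists>C E. 0 \<le> C \<and> 1 \<le> E \<and> (\<forall>x\<in>X. \<forall>j. \<bar>Rem j L x\<bar> \<le> C * E ^ j * x ^ L)"
      unfolding Rem_def using less Suc by auto
    then obtain C E where CE: "\<And>L. L \<le> M \<Longrightarrow> 0 \<le> C L \<and> 1 \<le> E L \<and> (\<forall>x\<in>X. \<forall>j. \<bar>Rem j L x\<bar> \<le> C L * E L ^ j * x ^ L)"
      by (metis atMost_iff)
    define Cm where "Cm = (\<Sum>L\<le>M. C L)"
    define Em where "Em = (\<Sum>L\<le>M. E L)"
    have Cm: "C L \<le> Cm" "0 \<le> Cm" if "L \<le> M" for L
      unfolding Cm_def using CE that by (auto intro!: member_le_sum sum_nonneg)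
    have Em: "E L \<le> Em" "1 \<le> Em" if "L \<le> M" for L
    proof -
      show "E L \<le> Em" unfolding Em_def using CE that by (intro member_le_sum) (auto intro: order_trans[OF zero_le_one])
      then show "1 \<le> Em" using CE[OF that] by linarith
    qed
    have Em1: "1 \<le> Em" and Cm0: "0 \<le> Cm" using Em(2)[of M] Cm(2)[of M] by auto
    have bound: "\<bar>Rem l L x\<bar> \<le> Cm * Em ^ Suc j * x ^ L" if "x \<in> X" "l \<le> Suc j" "L \<le> M" for x l j L
    proof -
      have "\<bar>Rem l L x\<bar> \<le> C L * E L ^ l * x ^ L" using CE that by blast
      also have "\<dots> \<le> Cm * Em ^ Suc j * x ^ L"
      proof (intro mult_right_mono mult_mono)
        have "E L ^ l \<le> Em ^ l" using Em that CE[of L] by (intro power_mono) auto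
        also have "\<dots> \<le> Em ^ Suc j" using Em1 that by (intro power_increasing)
        finally show "E L ^ l \<le> Em ^ Suc j" .
      qed (use Cm that CE[of L] X[of x] in auto)
      finally show ?thesis .
    qed
    define A where "A = (\<Sum>i<N + M. \<bar>a i\<bar>)"
    have A: "0 \<le> A" by (simp add: A_def sum_nonneg)
    define K where "K = Cm * (1 + A)"
    have K: "0 \<le> K" using Cm0 A by (simp add: K_def)
    \<comment> \<open>The Taylor polynomials satisfy the difference equation with truncated sums, so
      the remainders satisfy it too, and the right side has orders at most \<open>M\<close>. For i
      >= M - 1 the subtraction gives order 0, that is \<open>F\<close> itself, and x^(i+1) supplies
      the missing powers.\<close>
    have step: "Rem (Suc j) (Suc M) x - Rem j (Suc M) x =
        s * x * (\<Sum>i<N + M. a i * x ^ Suc i * Rem (p j) (M - 1 - i) x) - c j * x * Rem (r j) M x" if x: "x \<in> X" for x j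
    proof -
      have alpha: "(\<Sum>i<N. a i * x ^ i) = (\<Sum>i<N + M. a i * x ^ i)"
        using a0 by (intro sum.mono_neutral_left) auto
      have "(\<Sum>m<Suc M. f (Suc j) m * x ^ m) - (\<Sum>m<Suc M. f j m * x ^ m) =
          (\<Sum>m<M. (f (Suc j) (Suc m) - f j (Suc m)) * x ^ Suc m)"
        unfolding sum.lessThan_Suc_shift by (simp add: f0 sum_subtractf left_diff_distrib)
      also have "\<dots> = s * x * (\<Sum>m<M. \<Sum>i<m. a i * f (p j) (m - 1 - i) * x ^ m) - c j * x * (\<Sum>m<M. f (r j) m * x ^ m)"
        unfolding frec by (simp add: sum_subtractf sum_distrib_left sum_distrib_right algebra_simps)
      also have "(\<Sum>m<M. \<Sum>i<m. a i * f (p j) (m - 1 - i) * x ^ m) =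
          (\<Sum>m<M. \<Sum>i<m. (\<lambda>i l. a i * x ^ Suc i * (f (p j) l * x ^ l)) i (m - 1 - i))"
      proof (intro sum.cong refl)
        fix m i :: nat assume "i \<in> {..<m}"
        then have "m = Suc i + (m - 1 - i)" by auto
        then have "x ^ m = x ^ Suc i * x ^ (m - 1 - i)" by (metis power_add)
        then show "a i * f (p j) (m - 1 - i) * x ^ m = a i * x ^ Suc i * (f (p j) (m - 1 - i) * x ^ (m - 1 - i))"
          by (simp only: mult_ac)
      qed
      also have "\<dots> = (\<Sum>i<M. \<Sum>l<M - 1 - i. a i * x ^ Suc i * (f (p j) l * x ^ l))"
        by (rule sum_convolution_shift)
      also have "\<dots> = (\<Sum>i<N + M. a i * x ^ Suc i * (\<Sum>l<M - 1 - i. f (p j) l * x ^ l))"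
        unfolding sum_distrib_left by (intro sum.mono_neutral_left) auto
      finally have "Rem (Suc j) (Suc M) x - Rem j (Suc M) x = (F (Suc j) x - F j x) -
         (s * x * (\<Sum>i<N + M. a i * x ^ Suc i * (\<Sum>l<M - 1 - i. f (p j) l * x ^ l)) - c j * x * (\<Sum>m<M. f (r j) m * x ^ m))"
        unfolding Rem_def by linarith
      also have "F (Suc j) x - F j x = s * x * (\<Sum>i<N + M. a i * x ^ Suc i * F (p j) x) - c j * x * F (r j) x"
        unfolding Frec[OF x] alpha by (simp add: sum_distrib_left sum_distrib_right power2_eq_square mult_ac)
      finally show ?thesis unfolding Rem_def
        by (simp add: right_diff_distrib sum_subtractf)
    qed
    \<comment> \<open>Base 4 \<open>Em\<close> absorbs the factor j + 1 coming from
      \<open>c\<close>: (4 E)^j + (j + 1) E^(j+1) <= (1 + 2) 4^j E^(j+1) for E >= 1.\<close>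
    have "\<bar>Rem j (Suc M) x\<bar> \<le> K * (4 * Em) ^ j * x ^ Suc M" if x: "x \<in> X" for x j
    proof (induction j)
      case 0
      have "(\<Sum>m<Suc M. f 0 m * x ^ m) = 1" unfolding sum.lessThan_Suc_shift by (simp add: f0)
      then show ?case using K X[OF x] by (simp add: Rem_def F0 del: sum.lessThan_Suc)
    next
      case (Suc j)
      have x01: "0 < x" "x \<le> 1" using X[OF x] by auto
      have "\<bar>a i * x ^ Suc i * Rem (p j) (M - 1 - i) x\<bar> \<le> \<bar>a i\<bar> * (Cm * Em ^ Suc j * x ^ M)" for i
      proof -
        have "\<bar>Rem (p j) (M - 1 - i) x\<bar> \<le> Cm * Em ^ Suc j * x ^ (M - 1 - i)"
          by (rule bound[OF x p]) auto
        then have "x ^ Suc i * \<bar>Rem (p j) (M - 1 - i) x\<bar> \<le> x ^ Suc i * (Cm * Em ^ Suc j * x ^ (M - 1 - i))"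
          using x01 by (intro mult_left_mono) auto
        also have "\<dots> = Cm * Em ^ Suc j * x ^ (Suc i + (M - 1 - i))"
          by (simp only: power_add mult_ac)
        also have "\<dots> \<le> Cm * Em ^ Suc j * x ^ M"
          using x01 Cm0 Em1 by (intro mult_left_mono power_decreasing) auto
        finally show ?thesis
          using x01 mult_left_mono[of _ _ "\<bar>a i\<bar>"] by (fastforce simp: abs_mult mult.assoc)
      qed
      then have "\<bar>\<Sum>i<N + M. a i * x ^ Suc i * Rem (p j) (M - 1 - i) x\<bar> \<le> (\<Sum>i<N + M. \<bar>a i\<bar> * (Cm * Em ^ Suc j * x ^ M))"
        by (intro order_trans[OF sum_abs] sum_mono)
      also have "\<dots> = A * (Cm * Em ^ Suc j * x ^ M)" by (simp add: A_def sum_distrib_right)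
      finally have "\<bar>s * x * (\<Sum>i<N + M. a i * x ^ Suc i * Rem (p j) (M - 1 - i) x)\<bar> \<le> x * (A * (Cm * Em ^ Suc j * x ^ M))"
        using x01 s by (simp add: abs_mult mult_left_mono)
      also have "\<dots> = A * (Cm * Em ^ Suc j * x ^ Suc M)" by simp
      also have "\<dots> \<le> real (Suc j) * (A * (Cm * Em ^ Suc j * x ^ Suc M))"
      proof -
        have "0 \<le> A * (Cm * Em ^ Suc j * x ^ Suc M)" using x01 A Cm0 Em1 by (intro mult_nonneg_nonneg) auto
        then have "1 * (A * (Cm * Em ^ Suc j * x ^ Suc M)) \<le> real (Suc j) * (A * (Cm * Em ^ Suc j * x ^ Suc M))"
          by (intro mult_right_mono) auto
        then show ?thesis by (simp only: mult_1_left)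
      qed
      finally have 1: "\<bar>s * x * (\<Sum>i<N + M. a i * x ^ Suc i * Rem (p j) (M - 1 - i) x)\<bar> \<le>
          real (Suc j) * (A * (Cm * Em ^ Suc j * x ^ Suc M))" .
      have "\<bar>c j * x * Rem (r j) M x\<bar> \<le> real (Suc j) * x * (Cm * Em ^ Suc j * x ^ M)"
        unfolding abs_mult using bound[OF x r order_refl, of j] c[of j] x01
        by (intro mult_mono) auto
      then have 2: "\<bar>c j * x * Rem (r j) M x\<bar> \<le> real (Suc j) * (Cm * Em ^ Suc j * x ^ Suc M)"
        by (simp add: mult_ac)
      have "\<bar>Rem (Suc j) (Suc M) x\<bar> \<le> \<bar>Rem j (Suc M) x\<bar> +
          (real (Suc j) * (A * (Cm * Em ^ Suc j * x ^ Suc M)) + real (Suc j) * (Cm * Em ^ Suc j * x ^ Suc M))"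
        using step[OF x, of j] 1 2 by linarith
      also have "real (Suc j) * (A * (Cm * Em ^ Suc j * x ^ Suc M)) + real (Suc j) * (Cm * Em ^ Suc j * x ^ Suc M) =
          real (Suc j) * Em ^ Suc j * (K * x ^ Suc M)"
        unfolding K_def by (simp only: algebra_simps)
      also have "\<bar>Rem j (Suc M) x\<bar> \<le> (4 * Em) ^ j * (K * x ^ Suc M)" using Suc by (simp only: mult_ac)
      also have "(4 * Em) ^ j * (K * x ^ Suc M) + real (Suc j) * Em ^ Suc j * (K * x ^ Suc M) =
          ((4 * Em) ^ j + real (Suc j) * Em ^ Suc j) * (K * x ^ Suc M)" by (simp only: distrib_right)
      also have "\<dots> \<le> (4 * Em) ^ Suc j * (K * x ^ Suc M)"
      proof (rule mult_right_mono)
        have "(4 * Em) ^ j * 1 \<le> (4 * Em) ^ j * Em" using Em1 by (intro mult_left_mono) auto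
        also have "\<dots> = 4 ^ j * Em ^ Suc j" by (simp add: power_mult_distrib)
        finally have e1: "(4 * Em) ^ j \<le> 4 ^ j * Em ^ Suc j" by simp
        have "real (Suc j) \<le> 2 ^ Suc j" using less_exp[of "Suc j"] by (metis less_imp_le of_nat_le_iff of_nat_numeral of_nat_power)
        also have "\<dots> \<le> 2 * 4 ^ j" by (simp add: power_mono)
        finally have "real (Suc j) * Em ^ Suc j \<le> 2 * 4 ^ j * Em ^ Suc j" using Em1 by (intro mult_right_mono) auto
        then have "(4 * Em) ^ j + real (Suc j) * Em ^ Suc j \<le> 3 * (4 ^ j * Em ^ Suc j)" using e1 by linarith
        also have "\<dots> \<le> 4 * (4 ^ j * Em ^ Suc j)" using Em1 by (intro mult_right_mono) auto
        also have "\<dots> = (4 * Em) ^ Suc j" by (simp add: power_mult_distrib)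
        finally show "(4 * Em) ^ j + real (Suc j) * Em ^ Suc j \<le> (4 * Em) ^ Suc j" .
        show "0 \<le> K * x ^ Suc M" using K x01 by simp
      qed
      finally show ?case by (simp only: mult_ac)
    qed
    then show ?thesis using K Em1 unfolding Rem_def Suc by (intro exI[of _ K] exI[of _ "4 * Em"]) auto
  qed
qed


definition pert :: "nat \<Rightarrow> (nat \<Rightarrow> real) \<Rightarrow> real \<Rightarrow> real" where
  "pert n a x = 1 + x\<^sup>2 * (\<Sum>i<n. a i * x ^ i)"

lemma Gf_Suc:
  assumes "0 \<le> x"
  shows "Gf y x (Suc j) - Gf y x j = (y - 1) * Gf y x j - real j * x * Gf y x (Suc j)"
proof -
  have "0 < 1 + real j * x" using assms by (simp add: add_pos_nonneg)
  then have "Gf y x (Suc j) * (1 + real j * x) = y * Gf y x j" by (simp add: Gf_def)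
  then show ?thesis by (simp add: algebra_simps)
qed

lemma Hf_Suc:
  assumes "y \<noteq> 0"
  shows "Hf y x (Suc j) - Hf y x j = - (y - 1) * Hf y x (Suc j) - real (Suc j) * x * Hf y x j"
proof -
  have "Hf y x (Suc j) * y = (1 - real (Suc j) * x) * Hf y x j" using assms by (simp add: Hf_def del: of_nat_Suc)
  then show ?thesis by (simp add: algebra_simps)
qed

text \<open>The points 1/(m + 1) are those at which \<open>Hf\<close> is bounded, and y in [1/2, 2]
  bounds both y^j and y^(-j) by 2^j, the growth fed into
  \<open>uniform_taylor_remainder\<close>.\<close>

lemma GH_remainder:
  fixes a :: "nat \<Rightarrow> real"
  assumes a0: "\<And>i. n \<le> i \<Longrightarrow> a i = 0"
    and X: "\<And>x. x \<in> X \<Longrightarrow> (\<exists>m. x = 1 / real (Suc m)) \<and> 1 / 2 \<le> pert n a x \<and> pert n a x \<le> 2"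
  shows "\<exists>C E. 0 \<le> C \<and> 1 \<le> E \<and> (\<forall>x\<in>X. \<forall>j. \<bar>Gf (pert n a x) x j - (\<Sum>m<M. gcoef a j m * x ^ m)\<bar> \<le> C * E ^ j * x ^ M)"
    and "\<exists>C E. 0 \<le> C \<and> 1 \<le> E \<and> (\<forall>x\<in>X. \<forall>j. \<bar>Hf (pert n a x) x j - (\<Sum>m<M. hcoef a j m * x ^ m)\<bar> \<le> C * E ^ j * x ^ M)"
proof -
  have x01: "0 < x \<and> x \<le> 1" if "x \<in> X" for x using X[OF that] by (auto simp: divide_le_eq)
  show "\<exists>C E. 0 \<le> C \<and> 1 \<le> E \<and> (\<forall>x\<in>X. \<forall>j. \<bar>Gf (pert n a x) x j - (\<Sum>m<M. gcoef a j m * x ^ m)\<bar> \<le> C * E ^ j * x ^ M)"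
  proof (rule uniform_taylor_remainder[where s = 1 and p = "\<lambda>j. j" and r = Suc and c = real and B = 2 and N = n and a = a])
    fix x j assume x: "x \<in> X"
    show "Gf (pert n a x) x (Suc j) - Gf (pert n a x) x j =
        1 * x\<^sup>2 * (\<Sum>i<n. a i * x ^ i) * Gf (pert n a x) x j - real j * x * Gf (pert n a x) x (Suc j)"
      using Gf_Suc[of x "pert n a x" j] x01[OF x] by (simp add: pert_def)
    have "\<bar>Gf (pert n a x) x j\<bar> \<le> pert n a x ^ j" using X[OF x] x01[OF x] by (intro Gf_abs_le) auto
    also have "\<dots> \<le> 2 ^ j" using X[OF x] by (intro power_mono) auto
    finally show "\<bar>Gf (pert n a x) x j\<bar> \<le> 2 ^ j" .
  qed (use x01 a0 in \<open>auto simp: Gf_def gcoef_0\<close>)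
  show "\<exists>C E. 0 \<le> C \<and> 1 \<le> E \<and> (\<forall>x\<in>X. \<forall>j. \<bar>Hf (pert n a x) x j - (\<Sum>m<M. hcoef a j m * x ^ m)\<bar> \<le> C * E ^ j * x ^ M)"
  proof (rule uniform_taylor_remainder[where s = "-1" and p = Suc and r = "\<lambda>j. j" and c = "\<lambda>j. real (Suc j)" and B = 2 and N = n and a = a])
    fix x j assume x: "x \<in> X"
    show "Hf (pert n a x) x (Suc j) - Hf (pert n a x) x j =
        - 1 * x\<^sup>2 * (\<Sum>i<n. a i * x ^ i) * Hf (pert n a x) x (Suc j) - real (Suc j) * x * Hf (pert n a x) x j"
      using Hf_Suc[of "pert n a x" x j] X[OF x] by (simp add: pert_def)
    obtain m where m: "x = 1 / real (Suc m)" using X[OF x] by blast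
    have "\<bar>Hf (pert n a x) x j\<bar> \<le> (1 / pert n a x) ^ j"
      using X[OF x] unfolding m by (intro Hf_abs_le) auto
    also have "\<dots> \<le> 2 ^ j" using X[OF x] by (intro power_mono) (auto simp: divide_le_eq)
    finally show "\<bar>Hf (pert n a x) x j\<bar> \<le> 2 ^ j" .
  qed (use x01 a0 in \<open>auto simp: Hf_def hcoef_0\<close>)
qed

text \<open>Two consecutive remainders at one fixed x differ by the term f j m x^m, so their bounds
  pass to the coefficient.\<close>

lemma coefficient_bound_of_remainder:
  fixes F :: "nat \<Rightarrow> real" and f :: "nat \<Rightarrow> nat \<Rightarrow> real"
  assumes x: "0 < x"
    and rem: "\<And>M. \<exists>C E. 0 \<le> C \<and> 1 \<le> E \<and> (\<forall>j. \<bar>F j - (\<Sum>m<M. f j m * x ^ m)\<bar> \<le> C * E ^ j * x ^ M)"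
  shows "\<exists>C E. 0 \<le> C \<and> 1 \<le> E \<and> (\<forall>j. \<bar>f j m\<bar> \<le> C * E ^ j)"
proof -
  obtain C E where 1: "0 \<le> C" "1 \<le> E" "\<And>j. \<bar>F j - (\<Sum>i<m. f j i * x ^ i)\<bar> \<le> C * E ^ j * x ^ m"
    using rem[of m] by blast
  obtain C' E' where 2: "0 \<le> C'" "1 \<le> E'" "\<And>j. \<bar>F j - (\<Sum>i<Suc m. f j i * x ^ i)\<bar> \<le> C' * E' ^ j * x ^ Suc m"
    using rem[of "Suc m"] by blast
  have "\<bar>f j m\<bar> \<le> (C + C' * x) * (E + E') ^ j" for j
  proof -
    have "E ^ j \<le> (E + E') ^ j" "E' ^ j \<le> (E + E') ^ j" using 1 2 by (auto intro!: power_mono)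
    then have le: "C * E ^ j * x ^ m \<le> C * (E + E') ^ j * x ^ m" "C' * E' ^ j * x ^ Suc m \<le> C' * (E + E') ^ j * x ^ Suc m"
      using 1 2 x by (auto intro!: mult_right_mono mult_left_mono)
    have "\<bar>f j m * x ^ m\<bar> \<le> C * E ^ j * x ^ m + C' * E' ^ j * x ^ Suc m"
      using 1(3)[of j] 2(3)[of j] unfolding sum.lessThan_Suc by linarith
    also have "\<dots> \<le> C * (E + E') ^ j * x ^ m + C' * (E + E') ^ j * x ^ Suc m" using le by linarith
    also have "\<dots> = (C + C' * x) * (E + E') ^ j * x ^ m" by (simp add: algebra_simps)
    finally have "\<bar>f j m\<bar> * x ^ m \<le> (C + C' * x) * (E + E') ^ j * x ^ m" using x by (simp add: abs_mult)
    then show ?thesis using x by (simp add: mult_le_cancel_right)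
  qed
  then show ?thesis using 1 2 x by (intro exI[of _ "C + C' * x"] exI[of _ "E + E'"]) auto
qed

lemma summable_weighted:
  fixes b :: "nat \<Rightarrow> real"
  assumes "0 < q" "q < 1" "0 \<le> C" "1 \<le> E" "\<And>j. \<bar>b j\<bar> \<le> C * E ^ j"
  shows "summable (\<lambda>j. (-1) ^ Suc j * q ^ tri j * b j)"
proof (rule summable_comparison_test')
  show "summable (\<lambda>j. q ^ tri j * E ^ j * C)"
    using assms by (intro summable_mult2 summable_superexponential) auto
  show "norm ((-1) ^ Suc j * q ^ tri j * b j) \<le> q ^ tri j * E ^ j * C" if "j \<ge> 0" for j
    using mult_left_mono[OF assms(5)[of j], of "q ^ tri j"] assms(1) by (simp add: abs_mult power_abs mult_ac)
qed

definition Phi_coeff :: "real \<Rightarrow> (nat \<Rightarrow> real) \<Rightarrow> nat \<Rightarrow> real" where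
  "Phi_coeff q a m = suminf (\<lambda>j. (-1) ^ Suc j * q ^ tri j * (gcoef a (Suc j) m - hcoef a j m))"

text \<open>The remainders of G_j and H_j are at most C E^j x^M with constants independent of x; the
  weights q^(tri j) make these bounds summable, so the expansions may be added up over j.\<close>

lemma Phi_expansion:
  fixes a :: "nat \<Rightarrow> real"
  assumes q: "0 < q" "q < 1" and a0: "\<And>i. n \<le> i \<Longrightarrow> a i = 0"
    and X: "\<And>x. x \<in> X \<Longrightarrow> (\<exists>m. x = 1 / real (Suc m)) \<and> 1 / 2 \<le> pert n a x \<and> pert n a x \<le> 2" and ne: "X \<noteq> {}"
  shows "summable (\<lambda>j. (-1) ^ Suc j * q ^ tri j * (gcoef a (Suc j) m - hcoef a j m))"
    and "\<exists>K. \<forall>x\<in>X. \<bar>Phi q (pert n a x) x - (\<Sum>m<M. Phi_coeff q a m * x ^ m)\<bar> \<le> K * x ^ M"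
proof -
  have x01: "0 < x" if "x \<in> X" for x using X[OF that] by auto
  obtain x0 where x0: "x0 \<in> X" using ne by blast
  have remG: "\<exists>C E. 0 \<le> C \<and> 1 \<le> E \<and> (\<forall>j. \<bar>Gf (pert n a x0) x0 j - (\<Sum>m<M. gcoef a j m * x0 ^ m)\<bar> \<le> C * E ^ j * x0 ^ M)" for M
    using GH_remainder(1)[where n = n and a = a and X = X and M = M, OF a0 X] x0 by blast
  have remH: "\<exists>C E. 0 \<le> C \<and> 1 \<le> E \<and> (\<forall>j. \<bar>Hf (pert n a x0) x0 j - (\<Sum>m<M. hcoef a j m * x0 ^ m)\<bar> \<le> C * E ^ j * x0 ^ M)" for M
    using GH_remainder(2)[where n = n and a = a and X = X and M = M, OF a0 X] x0 by blast
  show sm: "summable (\<lambda>j. (-1) ^ Suc j * q ^ tri j * (gcoef a (Suc j) m - hcoef a j m))" for m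
  proof -
    obtain C E where G: "0 \<le> C" "1 \<le> E" "\<And>j. \<bar>gcoef a j m\<bar> \<le> C * E ^ j"
      using coefficient_bound_of_remainder[OF x01[OF x0] remG, of m] by blast
    obtain C' E' where H: "0 \<le> C'" "1 \<le> E'" "\<And>j. \<bar>hcoef a j m\<bar> \<le> C' * E' ^ j"
      using coefficient_bound_of_remainder[OF x01[OF x0] remH, of m] by blast
    have "\<bar>gcoef a (Suc j) m\<bar> \<le> (C * E) * E ^ j" for j using G(3)[of "Suc j"] by (simp add: mult_ac)
    then have "summable (\<lambda>j. (-1) ^ Suc j * q ^ tri j * gcoef a (Suc j) m)"
      using G by (intro summable_weighted[OF q, of "C * E" E]) auto
    moreover have "summable (\<lambda>j. (-1) ^ Suc j * q ^ tri j * hcoef a j m)"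
      using H by (intro summable_weighted[OF q, of C' E']) auto
    ultimately show ?thesis unfolding right_diff_distrib by (rule summable_diff)
  qed
  obtain C E where G: "0 \<le> C" "1 \<le> E" "\<And>x j. x \<in> X \<Longrightarrow> \<bar>Gf (pert n a x) x j - (\<Sum>m<M. gcoef a j m * x ^ m)\<bar> \<le> C * E ^ j * x ^ M"
    using GH_remainder(1)[where n = n and a = a and X = X and M = M, OF a0 X] by blast
  obtain C' E' where H: "0 \<le> C'" "1 \<le> E'" "\<And>x j. x \<in> X \<Longrightarrow> \<bar>Hf (pert n a x) x j - (\<Sum>m<M. hcoef a j m * x ^ m)\<bar> \<le> C' * E' ^ j * x ^ M"
    using GH_remainder(2)[where n = n and a = a and X = X and M = M, OF a0 X] by blast
  define D where "D = C * E + C'"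
  define W where "W j = q ^ tri j * (E + E') ^ j * D" for j
  have W: "summable W" unfolding W_def using q G H by (intro summable_mult2 summable_superexponential) auto
  have "\<bar>Phi q (pert n a x) x - (\<Sum>m<M. Phi_coeff q a m * x ^ m)\<bar> \<le> suminf W * x ^ M" if x: "x \<in> X" for x
  proof -
    obtain k where k: "x = 1 / real (Suc k)" using X[OF x] by blast
    have y: "0 < pert n a x" using X[OF x] by linarith
    define t where "t j = (-1) ^ Suc j * q ^ tri j * (Gf (pert n a x) x (Suc j) - Hf (pert n a x) x j)" for j
    define u where "u m j = (-1) ^ Suc j * q ^ tri j * (gcoef a (Suc j) m - hcoef a j m)" for m j
    have st: "summable t"
      using summable_diff[OF summable_Phi_parts[OF q y, of k]] unfolding t_def right_diff_distrib k[symmetric] .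
    have su: "summable (u m)" for m unfolding u_def by (rule sm)
    have "suminf (\<lambda>j. \<Sum>m<M. u m j * x ^ m) = (\<Sum>m<M. suminf (\<lambda>j. u m j * x ^ m))"
      by (rule suminf_sum) (intro summable_mult2 su)
    also have "\<dots> = (\<Sum>m<M. Phi_coeff q a m * x ^ m)"
      unfolding Phi_coeff_def u_def[symmetric] by (simp add: suminf_mult2[OF su])
    finally have "Phi q (pert n a x) x - (\<Sum>m<M. Phi_coeff q a m * x ^ m) = suminf t - suminf (\<lambda>j. \<Sum>m<M. u m j * x ^ m)"
      unfolding Phi_def t_def by simp
    also have "\<dots> = suminf (\<lambda>j. t j - (\<Sum>m<M. u m j * x ^ m))"
      by (rule suminf_diff[OF st]) (intro summable_sum summable_mult2 su)
    finally have eq: "Phi q (pert n a x) x - (\<Sum>m<M. Phi_coeff q a m * x ^ m) = suminf (\<lambda>j. t j - (\<Sum>m<M. u m j * x ^ m))" .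
    have "\<bar>t j - (\<Sum>m<M. u m j * x ^ m)\<bar> \<le> W j * x ^ M" for j
    proof -
      let ?g = "Gf (pert n a x) x (Suc j) - (\<Sum>m<M. gcoef a (Suc j) m * x ^ m)"
      let ?h = "Hf (pert n a x) x j - (\<Sum>m<M. hcoef a j m * x ^ m)"
      have "(\<Sum>m<M. u m j * x ^ m) = (-1) ^ Suc j * q ^ tri j * ((\<Sum>m<M. gcoef a (Suc j) m * x ^ m) - (\<Sum>m<M. hcoef a j m * x ^ m))"
        unfolding u_def sum_subtractf[symmetric] sum_distrib_left by (simp only: left_diff_distrib mult.assoc)
      then have "t j - (\<Sum>m<M. u m j * x ^ m) = (-1) ^ Suc j * q ^ tri j * (?g - ?h)"
        unfolding t_def by (simp only: right_diff_distrib)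
      then have "\<bar>t j - (\<Sum>m<M. u m j * x ^ m)\<bar> = q ^ tri j * \<bar>?g - ?h\<bar>"
        using q by (simp add: abs_mult power_abs del: of_nat_Suc)
      also have "\<dots> \<le> q ^ tri j * (C * E ^ Suc j * x ^ M + C' * E' ^ j * x ^ M)"
        using G(3)[OF x, of "Suc j"] H(3)[OF x, of j] q by (intro mult_left_mono) auto
      also have "\<dots> \<le> q ^ tri j * (C * E * (E + E') ^ j * x ^ M + C' * (E + E') ^ j * x ^ M)"
      proof -
        have "E ^ j \<le> (E + E') ^ j" "E' ^ j \<le> (E + E') ^ j" using G H by (auto intro!: power_mono)
        then have "C * E * E ^ j * x ^ M \<le> C * E * (E + E') ^ j * x ^ M" "C' * E' ^ j * x ^ M \<le> C' * (E + E') ^ j * x ^ M"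
          using G H x01[OF x] by (auto intro!: mult_right_mono mult_left_mono)
        then show ?thesis using q by (intro mult_left_mono add_mono) (auto simp: mult_ac)
      qed
      also have "\<dots> = W j * x ^ M" unfolding W_def D_def by (simp add: algebra_simps)
      finally show ?thesis .
    qed
    then have "\<bar>suminf (\<lambda>j. t j - (\<Sum>m<M. u m j * x ^ m))\<bar> \<le> suminf (\<lambda>j. W j * x ^ M)"
      using norm_suminf_le[of "\<lambda>j. t j - (\<Sum>m<M. u m j * x ^ m)" "\<lambda>j. W j * x ^ M"] summable_mult2[OF W, of "x ^ M"]
      by simp
    then show ?thesis unfolding eq using suminf_mult2[OF W, of "x ^ M"] by simp
  qed
  then show "\<exists>K. \<forall>x\<in>X. \<bar>Phi q (pert n a x) x - (\<Sum>m<M. Phi_coeff q a m * x ^ m)\<bar> \<le> K * x ^ M" by blast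
qed

text \<open>Both sides are -(1 + ... + j) whatever \<open>a\<close> is. Hence Phi starts at x^2,
  division by x^2 is exact, and the correction of k q^(1-k) starts at k^(-2).\<close>

lemma gcoef_hcoef_1: "gcoef a (Suc j) (Suc 0) = hcoef a j (Suc 0)"
  by (induction j) (auto simp: gcoef_0 hcoef_0)

lemma Phi_coeff_01: "Phi_coeff q a 0 = 0" "Phi_coeff q a (Suc 0) = 0"
  unfolding Phi_coeff_def gcoef_hcoef_1 by (simp_all add: gcoef_0 hcoef_0 del: gcoef.simps hcoef.simps)

text \<open>The left side is the coefficient of x^(m-1) in (1 + a x^2) Phi / x^2, the form for which
  the S_i(m) are defined. As v = 2 tri j, summing over j replaces v^i by 2^i \<open>tser i\<close>;
  by \<open>tser_Ppoly\<close> these become the factors 3 * 2^i P_i of the recursion, up to sign and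
  the common factor \<open>tser 0 q\<close>.\<close>

lemma Phi_coeff_rec:
  fixes a :: "nat \<Rightarrow> real"
  assumes q: "0 < q" "q < 1" and m: "m \<ge> 1"
    and sm: "\<And>m. summable (\<lambda>j. (-1) ^ Suc j * q ^ tri j * (gcoef a (Suc j) m - hcoef a j m))"
    and a: "\<And>k. k < m - 1 \<Longrightarrow> a k = Cq (Suc k) q"
  shows "Phi_coeff q a (Suc m) + (\<Sum>i<m - 2. a i * Phi_coeff q a (m - 1 - i)) = - (a (m - 1) - Cq m q) * tser 0 q"
proof -
  define w where "w j = (-1) ^ Suc j * q ^ tri j" for j
  define d where "d j l = gcoef a (Suc j) l - hcoef a j l" for j l
  define S where "S i = mp_eval of_rat a (Spoly m i)" for i
  have aux: "- (A * T + (B * T + - Q * T)) = - (A - (- B + Q)) * T" for A B Q T :: real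
    by (simp add: algebra_simps)
  have sm': "summable (\<lambda>j. w j * d j l)" for l using sm unfolding w_def d_def .
  have SC: "S i = mp_eval of_rat (\<lambda>k. Cq (Suc k) q) (Spoly m i)" for i
    unfolding S_def using a by (intro mp_eval_cong[OF Spoly_below[OF m]]) auto
  have st: "summable (\<lambda>j. (-1) ^ j * (2 * real j + 1) * real (tri j) ^ i * q ^ tri j)" for i
  proof -
    have "summable (\<lambda>j. (\<lambda>N. real N ^ i * tcoef N * q ^ N) (tri j))"
      using summable_tcoef[of q i] q by (subst summable_mono_reindex[OF strict_mono_tri]) (auto simp: tcoef_def)
    then show ?thesis by (simp add: tcoef_def inv_tri mult_ac)
  qed
  have "Phi_coeff q a (Suc m) + (\<Sum>i<m - 2. a i * Phi_coeff q a (m - 1 - i)) =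
     suminf (\<lambda>j. w j * d j (Suc m)) + (\<Sum>i<m - 2. suminf (\<lambda>j. a i * (w j * d j (m - 1 - i))))"
    unfolding Phi_coeff_def w_def[symmetric] d_def[symmetric] by (simp add: suminf_mult[OF sm'])
  also have "(\<Sum>i<m - 2. suminf (\<lambda>j. a i * (w j * d j (m - 1 - i)))) = suminf (\<lambda>j. \<Sum>i<m - 2. a i * (w j * d j (m - 1 - i)))"
    by (rule suminf_sum[symmetric]) (intro summable_mult sm')
  also have "suminf (\<lambda>j. w j * d j (Suc m)) + \<dots> = suminf (\<lambda>j. w j * d j (Suc m) + (\<Sum>i<m - 2. a i * (w j * d j (m - 1 - i))))"
    by (rule suminf_add[OF sm']) (intro summable_sum summable_mult sm')
  also have "\<dots> = suminf (\<lambda>j. - (a (m - 1) * ((-1) ^ j * (2 * real j + 1) * real (tri j) ^ 0 * q ^ tri j) +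
      (\<Sum>i\<le>m. S i * 2 ^ i * ((-1) ^ j * (2 * real j + 1) * real (tri j) ^ i * q ^ tri j))))"
  proof (rule suminf_cong)
    fix j
    define u where "u = (-1) ^ j * (2 * real j + 1) * q ^ tri j"
    have two: "real j * (real j + 1) = 2 * real (tri j)" by (simp add: real_tri)
    have "w j * d j (Suc m) + (\<Sum>i<m - 2. a i * (w j * d j (m - 1 - i))) = w j * (d j (Suc m) + (\<Sum>i<m - 2. a i * d j (m - 1 - i)))"
      by (simp add: distrib_left sum_distrib_left mult_ac)
    also have "d j (Suc m) + (\<Sum>i<m - 2. a i * d j (m - 1 - i)) =
        (2 * real j + 1) * (a (m - 1) + (\<Sum>i\<le>m. S i * (2 * real (tri j)) ^ i))"
      using Spoly_real[OF m, of a j] unfolding d_def S_def two .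
    also have "w j * ((2 * real j + 1) * (a (m - 1) + (\<Sum>i\<le>m. S i * (2 * real (tri j)) ^ i))) =
        (w j * (2 * real j + 1)) * (a (m - 1) + (\<Sum>i\<le>m. S i * (2 * real (tri j)) ^ i))" by (simp only: mult.assoc)
    also have "w j * (2 * real j + 1) = - u" by (simp add: w_def u_def)
    also have "- u * (a (m - 1) + (\<Sum>i\<le>m. S i * (2 * real (tri j)) ^ i)) =
        - (a (m - 1) * u + (\<Sum>i\<le>m. S i * (2 * real (tri j)) ^ i * u))"
      by (simp add: distrib_left sum_distrib_left sum_negf mult_ac)
    finally show "w j * d j (Suc m) + (\<Sum>i<m - 2. a i * (w j * d j (m - 1 - i))) =
      - (a (m - 1) * ((-1) ^ j * (2 * real j + 1) * real (tri j) ^ 0 * q ^ tri j) +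
      (\<Sum>i\<le>m. S i * 2 ^ i * ((-1) ^ j * (2 * real j + 1) * real (tri j) ^ i * q ^ tri j)))"
      unfolding u_def by (simp add: power_mult_distrib mult_ac)
  qed
  also have "\<dots> = - (a (m - 1) * tser 0 q + (\<Sum>i\<le>m. S i * 2 ^ i * tser i q))"
  proof -
    have "(\<lambda>j. - (a (m - 1) * ((-1) ^ j * (2 * real j + 1) * real (tri j) ^ 0 * q ^ tri j) +
      (\<Sum>i\<le>m. S i * 2 ^ i * ((-1) ^ j * (2 * real j + 1) * real (tri j) ^ i * q ^ tri j)))) sums
      - (a (m - 1) * tser 0 q + (\<Sum>i\<le>m. S i * 2 ^ i * tser i q))"
      unfolding tser_def by (intro sums_minus sums_add sums_mult sums_sum summable_sums st)
    then show ?thesis by (rule sums_unique[symmetric])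
  qed
  also have "(\<Sum>i\<le>m. S i * 2 ^ i * tser i q) = S 0 * tser 0 q + (\<Sum>i\<in>{1..m}. S i * 2 ^ i * tser i q)"
  proof -
    have "{..m} = insert 0 {1..m}" by auto
    then show ?thesis by simp
  qed
  also have "(\<Sum>i\<in>{1..m}. S i * 2 ^ i * tser i q) =
     (\<Sum>i\<in>{1..m}. - (3 * 2 ^ i * S i * mp_eval of_rat (\<lambda>k. Aser k q) (Ppoly i)) * tser 0 q)"
  proof (rule sum.cong[OF refl])
    fix i assume "i \<in> {1..m}"
    then obtain l where l: "i = Suc l" by (cases i) auto
    show "S i * 2 ^ i * tser i q = - (3 * 2 ^ i * S i * mp_eval of_rat (\<lambda>k. Aser k q) (Ppoly i)) * tser 0 q"
      unfolding l tser_Ppoly[OF q] by (simp only: mult_ac mult_minus_left mult_minus_right)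
  qed
  also have "\<dots> = - (\<Sum>i\<in>{1..m}. 3 * 2 ^ i * S i * mp_eval of_rat (\<lambda>k. Aser k q) (Ppoly i)) * tser 0 q"
    by (simp only: sum_distrib_right[symmetric] sum_negf)
  also have "- (a (m - 1) * tser 0 q + (S 0 * tser 0 q + - (\<Sum>i\<in>{1..m}. 3 * 2 ^ i * S i * mp_eval of_rat (\<lambda>k. Aser k q) (Ppoly i)) * tser 0 q)) =
     - (a (m - 1) - (- S 0 + (\<Sum>i\<in>{1..m}. 3 * 2 ^ i * S i * mp_eval of_rat (\<lambda>k. Aser k q) (Ppoly i)))) * tser 0 q"
    by (rule aux)
  also have "- S 0 + (\<Sum>i\<in>{1..m}. 3 * 2 ^ i * S i * mp_eval of_rat (\<lambda>k. Aser k q) (Ppoly i)) = Cq m q"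
    unfolding Cq_rec[OF m] SC ..
  finally show ?thesis .
qed


section \<open>Signs at perturbed points and location of the zeros\<close>

lemma pert_tendsto: "((\<lambda>m. pert n a (1 / real (Suc m))) \<longlongrightarrow> 1) sequentially"
proof -
  have "((\<lambda>x. pert n a x) \<longlongrightarrow> pert n a 0) (nhds 0)"
    unfolding pert_def by (intro tendsto_intros filterlim_ident)
  moreover have "(\<lambda>m. 1 / real (Suc m)) \<longlonglongrightarrow> 0"
    using LIMSEQ_inverse_real_of_nat by (simp add: inverse_eq_divide)
  ultimately have "((\<lambda>m. pert n a (1 / real (Suc m))) \<longlongrightarrow> pert n a 0) sequentially"
    by (rule filterlim_compose)
  then show ?thesis by (simp add: pert_def)
qed

text \<open>All coefficients of \<open>\<Phi>\<close> up to order \<open>n\<close> vanish, and the one of order \<open>n + 1\<close> is a negative multiple of \<open>e\<close>.\<close>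

lemma Phi_sign_perturbed:
  assumes q: "0 < q" "q < 1" and n: "n \<ge> 1" and e: "e \<noteq> 0"
  defines "a \<equiv> \<lambda>i. if i < n then Cq (Suc i) q + (if i = n - 1 then e else 0) else 0"
  shows "\<forall>\<^sub>F m in sequentially. e * Phi q (pert n a (1 / real (Suc m))) (1 / real (Suc m)) < 0"
proof -
  have a0: "a i = 0" if "n \<le> i" for i using that by (simp add: a_def)
  have "\<forall>\<^sub>F m in sequentially. 1 / 2 < pert n a (1 / real (Suc m))" "\<forall>\<^sub>F m in sequentially. pert n a (1 / real (Suc m)) < 2"
    by (rule order_tendstoD(1)[OF pert_tendsto], simp, rule order_tendstoD(2)[OF pert_tendsto], simp)
  then have "\<forall>\<^sub>F m in sequentially. 1 / 2 < pert n a (1 / real (Suc m)) \<and> pert n a (1 / real (Suc m)) < 2"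
    by eventually_elim simp
  then obtain m0 where m0: "\<And>m. m \<ge> m0 \<Longrightarrow> 1 / 2 < pert n a (1 / real (Suc m)) \<and> pert n a (1 / real (Suc m)) < 2"
    unfolding eventually_sequentially by blast
  define X where "X = {1 / real (Suc m) |m. m \<ge> m0}"
  have X: "(\<exists>m. x = 1 / real (Suc m)) \<and> 1 / 2 \<le> pert n a x \<and> pert n a x \<le> 2" if "x \<in> X" for x
    using that m0 unfolding X_def by (auto intro: less_imp_le)
  have ne: "X \<noteq> {}" unfolding X_def by blast
  note sm = Phi_expansion(1)[OF q a0 X ne]
  \<comment> \<open>At order \<open>m\<close> only a_k with k < m - 1 must equal the C_{k+1}, so the
    perturbation at index n - 1 is admissible even for m = n.\<close>
  have rec: "Phi_coeff q a (Suc m) + (\<Sum>i<m - 2. a i * Phi_coeff q a (m - 1 - i)) = - (a (m - 1) - Cq m q) * tser 0 q"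
    if "1 \<le> m" "m \<le> n" for m
    using that by (intro Phi_coeff_rec[OF q _ sm]) (auto simp: a_def)
  have zero: "Phi_coeff q a l = 0" if "l \<le> n" for l
    using that
  proof (induction l rule: less_induct)
    case (less l)
    consider "l = 0" | "l = Suc 0" | m where "l = Suc m" "1 \<le> m"
      by (cases l) (auto simp: Suc_le_eq)
    then show ?case
    proof cases
      case 3
      have "(\<Sum>i<m - 2. a i * Phi_coeff q a (m - 1 - i)) = 0"
        using less 3 by (intro sum.neutral) auto
      moreover have "a (m - 1) = Cq m q" using 3 less.prems by (auto simp: a_def)
      ultimately show ?thesis using rec[of m] 3 less.prems by simp
    qed (auto simp: Phi_coeff_01)
  qed
  have top: "Phi_coeff q a (Suc n) = - e * tser 0 q"
  proof -
    have "(\<Sum>i<n - 2. a i * Phi_coeff q a (n - 1 - i)) = 0"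
      using zero by (intro sum.neutral) auto
    moreover have "a (n - 1) = Cq n q + e" using n by (simp add: a_def)
    ultimately show ?thesis using rec[of n] n by simp
  qed
  have T: "0 < tser 0 q" using tser_0[OF q] by simp
  obtain K where K: "\<And>x. x \<in> X \<Longrightarrow> \<bar>Phi q (pert n a x) x - (\<Sum>m<n + 2. Phi_coeff q a m * x ^ m)\<bar> \<le> K * x ^ (n + 2)"
    using Phi_expansion(2)[OF q a0 X ne, of "n + 2"] by blast
  \<comment> \<open>The remainder carries one more power of x than the leading term, so it loses for
    large m.\<close>
  have "(\<lambda>m. (\<bar>e\<bar> * K) * (1 / real (Suc m))) \<longlonglongrightarrow> (\<bar>e\<bar> * K) * 0"
    using LIMSEQ_inverse_real_of_nat by (intro tendsto_mult tendsto_const) (simp add: inverse_eq_divide)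
  then have "\<forall>\<^sub>F m in sequentially. (\<bar>e\<bar> * K) * (1 / real (Suc m)) < e\<^sup>2 * tser 0 q"
    by (rule order_tendstoD(2)) (use e T in simp)
  then show ?thesis using eventually_ge_at_top[of m0]
  proof eventually_elim
    case (elim m)
    define x where "x = 1 / real (Suc m)"
    have x: "x \<in> X" "0 < x" unfolding X_def x_def using elim by auto
    have "(\<Sum>m<n + 2. Phi_coeff q a m * x ^ m) = - e * tser 0 q * x ^ Suc n"
      using zero top by (simp add: numeral_2_eq_2)
    then have "\<bar>Phi q (pert n a x) x + e * tser 0 q * x ^ Suc n\<bar> \<le> K * x ^ (n + 2)"
      using K[OF x(1)] by simp
    then have "\<bar>e\<bar> * \<bar>Phi q (pert n a x) x + e * tser 0 q * x ^ Suc n\<bar> \<le> \<bar>e\<bar> * (K * x ^ (n + 2))"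
      by (intro mult_left_mono) auto
    also have "\<dots> = (\<bar>e\<bar> * K * x) * x ^ Suc n" by simp
    also have "\<dots> < e\<^sup>2 * tser 0 q * x ^ Suc n"
      using elim x by (intro mult_strict_right_mono) (auto simp: x_def)
    finally have "\<bar>e * Phi q (pert n a x) x + e\<^sup>2 * tser 0 q * x ^ Suc n\<bar> < e\<^sup>2 * tser 0 q * x ^ Suc n"
      unfolding abs_mult[symmetric] by (simp add: distrib_left power2_eq_square mult_ac)
    then show ?case unfolding x_def[symmetric] by linarith
  qed
qed

text \<open>The perturbations by e and -e give opposite signs of f at two points enclosing the
  predicted one. Both values of y tend to 1, hence lie in (sqrt q, 1/sqrt q), which keeps the
  enclosed zero between consecutive separating radii and so fixes its index.\<close>

lemma defexp_zero_expansion: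
  assumes q: "0 < q" "q < 1" and n: "n \<ge> 1" and e: "0 < e"
  shows "\<forall>\<^sub>F k in sequentially. \<bar>defexp_zero q k / (- real k / q ^ (k - 1)) - 1 - (\<Sum>i=1..n. Cq i q / real k ^ (i + 1))\<bar>
     \<le> e * (1 / real k ^ (n + 1))"
proof -
  define a where "a e i = (if i < n then Cq (Suc i) q + (if i = n - 1 then e else 0) else 0)" for e i
  have pert_eq: "pert n (a e) x = 1 + (\<Sum>i=1..n. Cq i q * x ^ (i + 1)) + e * x ^ (n + 1)" for e x
  proof -
    have "x\<^sup>2 * (\<Sum>i<n. a e i * x ^ i) = (\<Sum>i<n. Cq (Suc i) q * x ^ (Suc i + 1) + (if i = n - 1 then e * x ^ (n + 1) else 0))"
      unfolding sum_distrib_left using n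
      by (intro sum.cong) (auto simp: a_def power2_eq_square algebra_simps power_eq_if)
    also have "\<dots> = (\<Sum>i<n. Cq (Suc i) q * x ^ (Suc i + 1)) + e * x ^ (n + 1)"
      using n by (simp add: sum.distrib)
    also have "(\<Sum>i<n. Cq (Suc i) q * x ^ (Suc i + 1)) = (\<Sum>i=1..n. Cq i q * x ^ (i + 1))"
      by (rule sum.reindex_bij_witness[of _ "\<lambda>i. i - 1" Suc]) auto
    finally show ?thesis by (simp add: pert_def)
  qed
  obtain M where M: "\<And>m z. m \<ge> M \<Longrightarrow> - sep_radius q (Suc m) < z \<Longrightarrow> z < - sep_radius q m \<Longrightarrow> defexp q z = 0 \<Longrightarrow>
     defexp_zero q (Suc (Suc m)) = z"
    using defexp_zero_locate[OF q] by blast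
  have s: "0 < sqrt q" "sqrt q < 1" using q by auto
  have "\<forall>\<^sub>F m in sequentially. e * Phi q (pert n (a e) (1 / real (Suc m))) (1 / real (Suc m)) < 0"
    unfolding a_def using e by (intro Phi_sign_perturbed[OF q n]) auto
  moreover have "\<forall>\<^sub>F m in sequentially. (- e) * Phi q (pert n (a (- e)) (1 / real (Suc m))) (1 / real (Suc m)) < 0"
    unfolding a_def using e by (intro Phi_sign_perturbed[OF q n]) auto
  moreover have "\<forall>\<^sub>F m in sequentially. pert n (a e) (1 / real (Suc m)) < 1 / sqrt q"
    by (rule order_tendstoD(2)[OF pert_tendsto]) (use s in simp)
  moreover have "\<forall>\<^sub>F m in sequentially. sqrt q < pert n (a (- e)) (1 / real (Suc m))"
    by (rule order_tendstoD(1)[OF pert_tendsto]) (use s in simp)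
  ultimately have "\<forall>\<^sub>F m in sequentially. \<bar>defexp_zero q (Suc m) / (- real (Suc m) / q ^ m) - 1 - (\<Sum>i=1..n. Cq i q / real (Suc m) ^ (i + 1))\<bar>
     \<le> e * (1 / real (Suc m) ^ (n + 1))"
    using eventually_ge_at_top[of "Suc M"]
  proof eventually_elim
    case (elim m)
    define x where "x = 1 / real (Suc m)"
    define R where "R = real (Suc m) / q ^ m"
    define yp where "yp = pert n (a e) x"
    define ym where "ym = pert n (a (- e)) x"
    obtain l where l: "m = Suc l" "l \<ge> M" using elim(5) by (cases m) auto
    have x: "0 < x" by (simp add: x_def)
    have R: "0 < R" using q by (simp add: R_def)
    have le: "ym < yp" unfolding ym_def yp_def pert_eq using e x by simp
    have y: "sqrt q < ym" "yp < 1 / sqrt q" using elim by (simp_all add: ym_def yp_def x_def)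
    have pos: "0 < ym" "0 < yp" using y le s by linarith+
    obtain Tp where Tp: "Tp > 0" "defexp q (- (R * yp)) = (-1) ^ m * Tp * Phi q yp x"
      using defexp_expand[OF q pos(2), of m] unfolding R_def x_def by auto
    obtain Tm where Tm: "Tm > 0" "defexp q (- (R * ym)) = (-1) ^ m * Tm * Phi q ym x"
      using defexp_expand[OF q pos(1), of m] unfolding R_def x_def by auto
    have "Phi q yp x < 0" using elim(1) e unfolding yp_def x_def by (simp add: mult_less_0_iff)
    moreover have "0 < Phi q ym x" using elim(2) e unfolding ym_def x_def by (simp add: mult_less_0_iff zero_less_mult_iff)
    ultimately have "(Tp * Tm) * (Phi q yp x * Phi q ym x) < 0" using Tp Tm by (simp add: mult_pos_neg mult_neg_pos)
    moreover have "defexp q (- (R * yp)) * defexp q (- (R * ym)) = ((-1) ^ m * (-1) ^ m) * ((Tp * Tm) * (Phi q yp x * Phi q ym x))"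
      unfolding Tp Tm by (simp only: mult_ac)
    ultimately have "defexp q (- (R * yp)) * defexp q (- (R * ym)) < 0" by (simp flip: power_mult_distrib)
    then obtain z where z: "- (R * yp) < z" "z < - (R * ym)" "defexp q z = 0"
      using defexp_zero_between[OF q, of "- (R * yp)" "- (R * ym)"] le R by auto
    have "R * yp < sep_radius q (Suc l)"
    proof -
      have "R * yp < R * (1 / sqrt q)" using R y by (intro mult_strict_left_mono)
      then show ?thesis by (simp add: R_def sep_radius_def l mult_ac)
    qed
    moreover have "sep_radius q l < R * ym"
    proof -
      \<comment> \<open>This moves one power of q from the factor into q^l, so that the inner radius
        compares with R sqrt q, the leading factor changing only from m to m + 1.\<close>
      have "1 / sqrt q = sqrt q / q" using q by (simp add: frac_eq_eq)
      then have "sep_radius q l = real (Suc l) / q ^ Suc l * sqrt q"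
        unfolding sep_radius_def by (simp only: power_Suc) (simp add: mult_ac)
      also have "\<dots> \<le> R * sqrt q"
        unfolding R_def l using q s by (intro mult_right_mono divide_right_mono) auto
      also have "\<dots> < R * ym" using R y by (intro mult_strict_left_mono)
      finally show ?thesis .
    qed
    ultimately have "defexp_zero q (Suc m) = z" unfolding l using z l by (intro M) auto
    moreover have "z / (- R) < yp" "ym < z / (- R)" using z R by (simp_all add: field_simps)
    moreover have "- real (Suc m) / q ^ m = - R" by (simp add: R_def del: of_nat_Suc)
    ultimately have "\<bar>defexp_zero q (Suc m) / (- real (Suc m) / q ^ m) - 1 - (\<Sum>i=1..n. Cq i q * x ^ (i + 1))\<bar> \<le> e * x ^ (n + 1)"
      unfolding yp_def ym_def pert_eq by (simp add: abs_le_iff)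
    then show ?case unfolding x_def power_one_over by simp
  qed
  then have "\<forall>\<^sub>F k in sequentially. (\<lambda>k. \<bar>defexp_zero q k / (- real k / q ^ (k - 1)) - 1 - (\<Sum>i=1..n. Cq i q / real k ^ (i + 1))\<bar>
     \<le> e * (1 / real k ^ (n + 1))) (Suc k)"
    by eventually_elim simp
  then show ?thesis by (subst (asm) eventually_sequentially_Suc)
qed

theorem theorem1p1:
  shows "(\<forall>i\<ge>1. mp_vars (Chat i) \<subseteq> {..<i}) \<and>
    (\<forall>q::real. 0 < q \<and> q < 1 \<longrightarrow> (\<forall>n\<ge>1. \<exists>\<epsilon>::nat \<Rightarrow> real.
       \<epsilon> \<in> o(\<lambda>k. 1 / real k ^ (n + 1)) \<and>
       (\<forall>k\<ge>1. defexp_zero q k = - real k * q powr (1 - real k) *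
           (1 + (\<Sum>i=1..n. Cq i q / real k ^ (i + 1)) + \<epsilon> k))))"
proof (intro conjI allI impI)
  show "mp_vars (Chat i) \<subseteq> {..<i}" if "i \<ge> 1" for i
    using Chat_below[OF that] by (simp add: mp_below_def)
next
  fix q :: real and n :: nat assume "0 < q \<and> q < 1" and n: "1 \<le> n"
  then have q: "0 < q" "q < 1" by auto
  \<comment> \<open>The error is what the claimed identity leaves over, so the identity holds for
    all k >= 1 at once and only the size of the error needs proof.\<close>
  define \<epsilon> where "\<epsilon> k = defexp_zero q k / (- real k / q ^ (k - 1)) - 1 - (\<Sum>i=1..n. Cq i q / real k ^ (i + 1))" for k
  have "\<epsilon> \<in> o(\<lambda>k. 1 / real k ^ (n + 1))"
  proof (rule landau_o.smallI)
    fix c :: real assume "0 < c"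
    from defexp_zero_expansion[OF q n this]
    show "\<forall>\<^sub>F k in sequentially. norm (\<epsilon> k) \<le> c * norm (1 / real k ^ (n + 1))"
      by eventually_elim (simp add: \<epsilon>_def)
  qed
  moreover have "defexp_zero q k = - real k * q powr (1 - real k) * (1 + (\<Sum>i=1..n. Cq i q / real k ^ (i + 1)) + \<epsilon> k)"
    if "k \<ge> 1" for k
  proof -
    have "q powr (1 - real k) = 1 / q ^ (k - 1)"
    proof -
      have "1 - real k = - real (k - 1)" using that by (simp add: of_nat_diff)
      then show ?thesis using q by (simp only: powr_minus powr_realpow inverse_eq_divide)
    qed
    then have c: "- real k * q powr (1 - real k) = - real k / q ^ (k - 1)" by simp
    have nz: "- real k / q ^ (k - 1) \<noteq> 0" using that q by simp
    have main: "1 + (\<Sum>i=1..n. Cq i q / real k ^ (i + 1)) + \<epsilon> k = defexp_zero q k / (- real k / q ^ (k - 1))"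
      by (simp add: \<epsilon>_def)
    have cancel: "u = v * (u / v)" if "v \<noteq> 0" for u v :: real using that by simp
    show ?thesis unfolding c main by (rule cancel[OF nz])
  qed
  ultimately show "\<exists>\<epsilon>. \<epsilon> \<in> o(\<lambda>k. 1 / real k ^ (n + 1)) \<and>
       (\<forall>k\<ge>1. defexp_zero q k = - real k * q powr (1 - real k) *
           (1 + (\<Sum>i=1..n. Cq i q / real k ^ (i + 1)) + \<epsilon> k))" by blast
qed

end
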